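(* Let $q:[a,\infty)\to\mathbb{R}$ satisfy the standing assumptions in the context, and let $B(\lambda)=\operatorname{Im}m^{+}(\lambda)$ and $\tilde\theta_0(x,\lambda)$ be as defined in the context. Let $I\subset(-\infty,\infty)$ be an interval on which $B(\lambda)>0$. Let $\Lambda\subset I$ be a bounded interval and let $C$ and $D$ be measurable functions on $\Lambda$ satisfying, for all $\lambda\in\Lambda$, $$0\le C(\lambda)<D(\lambda)\le\pi .$$ Then the family of functions $\{\tilde\theta_0(x,\cdot):I\to[0,\pi] \mid x\in(a,\infty)\}$ has the asymptotic property $$\lim_{x\to\infty}\mu\left(\Lambda\cap\{\lambda : C(\lambda)<\tilde\theta_0(x,\lambda)<D(\lambda)\}\right)=\frac1\pi\int_\Lambda\{D(\lambda)-C(\lambda)\}\,d\lambda ,$$ where $\mu$ denotes Lebesgue measure on $\mathbb{R}$.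
   Context: Fix $a\in\mathbb{R}$ and consider the half-line Sturm–Liouville problem $-y''+q(x)y=\lambda y$ on $a\le x<\infty$, with $y(a)=0$. Standing assumptions: $q$ is real-valued and continuous on $[a,\infty)$; the endpoint $x=\infty$ is of limit point type, and is either oscillatory for all real $\lambda$ (case LP/O), or there is a real number $\Lambda_0$ such that the equation is oscillatory at $\infty$ for all $\lambda\in(\Lambda_0,\infty)$ and nonoscillatory at $\infty$ for all $\lambda\in(-\infty,\Lambda_0)$ (case LP/O-N); and there exist one or more intervals on which the problem has absolutely continuous spectrum (expressed by the condition $B(\lambda)>0$ on $I$, with $B$ as below). For $\lambda\in\mathbb{C}$, $u(\cdot,\lambda)$ and $v(\cdot,\lambda)$ are the solutions of $-y''+qy=\lambda y$ with $u(a,\lambda)=1$, $u'(a,\lambda)=0$, $v(a,\lambda)=0$, $v'(a,\lambda)=1$. For $\operatorname{Im}z\neq0$, the Titchmarsh–Weyl function $m(z)$ is defined by the requirement $u(\cdot,z)+m(z)v(\cdot,z)\in L_2(a,\infty)$. Its boundary value on the real axis is $m^{+}(\lambda)=\lim_{\epsilon\to0^+}m(\lambda+i\epsilon)=A(\lambda)+iB(\lambda)$ with $A,B$ real-valued. Saying that $B(\lambda)>0$ on $I$ includes that this (finite) limit exists for $\lambda\in I$. For $\lambda\in I$ and $x\in[a,\infty)$, the phase $\theta_0(x,\lambda)$ is defined by the polar representation $u+Av=r_0\cos\theta_0$, $Bv=r_0\sin\theta_0$, i.e. $\cot\theta_0(x,\lambda)=\frac{u(x,\lambda)+A(\lambda)v(x,\lambda)}{B(\lambda)v(x,\lambda)}$,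 with the continuous branch satisfying $\theta_0(a,\lambda)=0$; equivalently $$\theta_0(x,\lambda)=\int_a^x\frac{B(\lambda)}{(u(t,\lambda)+A(\lambda)v(t,\lambda))^2+B(\lambda)^2v(t,\lambda)^2}\,dt ,$$ which is strictly increasing in $x$. Let $x_0=a$ and let $x_n=x_n(\lambda)$ be the $n$-th zero of $v(\cdot,\lambda)$ in $(a,\infty)$. Then $\tilde\theta_0$ is $\theta_0$ reduced modulo $\pi$: $\tilde\theta_0(x,\lambda)=\theta_0(x,\lambda)-n\pi$ for $x\in(x_n,x_{n+1})$, and it is set back to $0$ whenever $x$ passes through a zero of $v(\cdot,\lambda)$. *)

theory Defs
  imports "HOL-Analysis.Analysis"
begin

text \<open>
  \<open>sl_solution q a z y y'\<close>: \<open>y\<close> solves \<open>- y'' + q y = z y\<close> on \<open>[a, \<infinity>)\<close> with derivative \<open>y'\<close>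
  (one-sided at \<open>a\<close>).  The values of \<open>y\<close> and \<open>y'\<close> to the left of \<open>a\<close> are irrelevant.  Instantiated
  with \<open>'b = complex\<close> for the spectral theory and with \<open>'b = real\<close> for oscillation.
\<close>
definition sl_solution ::
  "(real \<Rightarrow> real) \<Rightarrow> real \<Rightarrow> 'b::real_normed_field \<Rightarrow> (real \<Rightarrow> 'b) \<Rightarrow> (real \<Rightarrow> 'b) \<Rightarrow> bool" where
  "sl_solution q a z y y' \<longleftrightarrow>
     (\<forall>x\<ge>a. (y has_vector_derivative y' x) (at x within {a..}) \<and>
            (y' has_vector_derivative (of_real (q x) - z) * y x) (at x within {a..}))"

text \<open>Existence, and uniqueness on \<open>[a, \<infinity>)\<close>, hold for continuous \<open>q\<close>.\<close>
definition sl_ivp :: "(real \<Rightarrow> real) \<Rightarrow> real \<Rightarrow> complex \<Rightarrow> complex \<Rightarrow> complex \<Rightarrow> real \<Rightarrow> complex" where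
  "sl_ivp q a z c0 c1 = (SOME y. \<exists>y'. sl_solution q a z y y' \<and> y a = c0 \<and> y' a = c1)"

definition sl_u :: "(real \<Rightarrow> real) \<Rightarrow> real \<Rightarrow> real \<Rightarrow> complex \<Rightarrow> complex" where
  "sl_u q a x z = sl_ivp q a z 1 0 x"

definition sl_v :: "(real \<Rightarrow> real) \<Rightarrow> real \<Rightarrow> real \<Rightarrow> complex \<Rightarrow> complex" where
  "sl_v q a x z = sl_ivp q a z 0 1 x"

definition in_L2 :: "real \<Rightarrow> (real \<Rightarrow> complex) \<Rightarrow> bool" where
  "in_L2 a f \<longleftrightarrow> set_borel_measurable lborel {a<..} f \<and>
                 set_integrable lborel {a<..} (\<lambda>x. (cmod (f x))\<^sup>2)"

text \<open>
  Weyl's alternative: if all solutions are square integrable for one complex \<open>z\<close>, then they are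
  for every complex \<open>z\<close> (limit circle); otherwise the endpoint is limit point.
\<close>
definition limit_point_at_infinity :: "(real \<Rightarrow> real) \<Rightarrow> real \<Rightarrow> bool" where
  "limit_point_at_infinity q a \<longleftrightarrow>
     \<not> (\<exists>z::complex. \<forall>y y'. sl_solution q a z y y' \<longrightarrow> in_L2 a y)"

definition oscillatory_at_infinity :: "(real \<Rightarrow> real) \<Rightarrow> real \<Rightarrow> real \<Rightarrow> bool" where
  "oscillatory_at_infinity q a lam \<longleftrightarrow>
     (\<forall>y y' :: real \<Rightarrow> real. sl_solution q a lam y y' \<and> (\<exists>x\<ge>a. y x \<noteq> 0) \<longrightarrow>
        (\<forall>X\<ge>a. \<exists>x>X. y x = 0))"

definition nonoscillatory_at_infinity :: "(real \<Rightarrow> real) \<Rightarrow> real \<Rightarrow> real \<Rightarrow> bool" where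
  "nonoscillatory_at_infinity q a lam \<longleftrightarrow>
     (\<forall>y y' :: real \<Rightarrow> real. sl_solution q a lam y y' \<and> (\<exists>x\<ge>a. y x \<noteq> 0) \<longrightarrow>
        (\<exists>X\<ge>a. \<forall>x>X. y x \<noteq> 0))"

text \<open>Only meaningful for \<open>Im z \<noteq> 0\<close>, where the limit point property makes the value unique.\<close>
definition weyl_m :: "(real \<Rightarrow> real) \<Rightarrow> real \<Rightarrow> complex \<Rightarrow> complex" where
  "weyl_m q a z = (THE m. in_L2 a (\<lambda>x. sl_u q a x z + m * sl_v q a x z))"

definition has_m_boundary_value :: "(real \<Rightarrow> real) \<Rightarrow> real \<Rightarrow> real \<Rightarrow> bool" where
  "has_m_boundary_value q a lam \<longleftrightarrow>
     (\<exists>l. ((\<lambda>e. weyl_m q a (Complex lam e)) \<longlongrightarrow> l) (at_right 0))"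

definition m_plus :: "(real \<Rightarrow> real) \<Rightarrow> real \<Rightarrow> real \<Rightarrow> complex" where
  "m_plus q a lam = Lim (at_right 0) (\<lambda>e. weyl_m q a (Complex lam e))"

definition m_A :: "(real \<Rightarrow> real) \<Rightarrow> real \<Rightarrow> real \<Rightarrow> real" where
  "m_A q a lam = Re (m_plus q a lam)"

definition m_B :: "(real \<Rightarrow> real) \<Rightarrow> real \<Rightarrow> real \<Rightarrow> real" where
  "m_B q a lam = Im (m_plus q a lam)"

text \<open>
  The continuous branch of the polar angle of \<open>(u + A v, B v)\<close> starting from \<open>0\<close> at \<open>a\<close>; for
  \<open>B > 0\<close> it exists and is unique on \<open>[a, \<infinity>)\<close>.  For real spectral parameter \<open>u\<close> and \<open>v\<close> take
  real values there, so that the two complex equations are real ones.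
\<close>
definition is_phase :: "(real \<Rightarrow> real) \<Rightarrow> real \<Rightarrow> real \<Rightarrow> (real \<Rightarrow> real) \<Rightarrow> bool" where
  "is_phase q a lam th \<longleftrightarrow>
     continuous_on {a..} th \<and> th a = 0 \<and>
     (\<forall>x\<ge>a. \<exists>r>0.
        sl_u q a x (of_real lam) + of_real (m_A q a lam) * sl_v q a x (of_real lam)
          = of_real (r * cos (th x)) \<and>
        of_real (m_B q a lam) * sl_v q a x (of_real lam) = of_real (r * sin (th x)))"

definition theta0 :: "(real \<Rightarrow> real) \<Rightarrow> real \<Rightarrow> real \<Rightarrow> real \<Rightarrow> real" where
  "theta0 q a x lam = (SOME th. is_phase q a lam th) x"

text \<open>
  The (finite) number of zeros of \<open>v\<close> in \<open>(a, x]\<close>, i.e. the \<open>n\<close> with \<open>x\<^sub>n \<le> x < x\<^sub>n\<^sub>+\<^sub>1\<close>, where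
  \<open>x\<^sub>0 = a\<close>, \<open>x\<^sub>n\<close> is the \<open>n\<close>-th zero, and \<open>x\<^sub>n\<^sub>+\<^sub>1 = \<infinity>\<close> if there are only \<open>n\<close> zeros.
\<close>
definition num_zeros_v :: "(real \<Rightarrow> real) \<Rightarrow> real \<Rightarrow> real \<Rightarrow> real \<Rightarrow> nat" where
  "num_zeros_v q a x lam = card {t. a < t \<and> t \<le> x \<and> sl_v q a t (of_real lam) = 0}"

text \<open>At a zero \<open>x = x\<^sub>n\<close> one has \<open>\<theta>\<^sub>0 = n \<pi>\<close>, so the value there is \<open>0\<close>.\<close>
definition theta0_tilde :: "(real \<Rightarrow> real) \<Rightarrow> real \<Rightarrow> real \<Rightarrow> real \<Rightarrow> real" where
  "theta0_tilde q a x lam = theta0 q a x lam - real (num_zeros_v q a x lam) * pi"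

end

theory Submission
  imports Defs "HOL-Complex_Analysis.Complex_Analysis"
begin

text \<open>
  Let \<open>m_fin x z = - u(x, z) / v(x, z)\<close> be the \<open>m\<close>-function of the interval \<open>[a, x]\<close>.  It is a Herglotz
  function of \<open>z\<close>, and in the limit point case it converges to \<open>m\<close> on the upper half-plane as
  \<open>x \<rightarrow> \<infinity>\<close> (\<open>m_fin_tendsto_weyl_m\<close>).  On the real axis it is real, and there its value \<open>- u / v\<close> together
  with \<open>A\<close> and \<open>B\<close> determines the reduced phase.  The theorem says that real boundary values of
  Herglotz functions which converge inside are distributed, in the limit, according to the harmonic
  measure seen from the boundary value \<open>A + \<i> B\<close> of the limit; the phase is the coordinate in which
  this harmonic measure is uniform.

  To prove it, fix \<open>0 < c < pi\<close> and put \<open>F = cos c + m_fin x sin c\<close>.  Almost everywhere on the real axis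
  \<open>arg F\<close> is \<open>pi\<close> times the indicator of the set where the angle \<open>phi\<close> of the vector \<open>(u, v)\<close>, taken
  modulo \<open>pi\<close>, is less than \<open>c\<close>.  Cauchy's theorem for \<open>Ln F\<close> on a rectangle of height \<open>e\<close> compares the
  integral of \<open>arg F\<close> along the real axis with that at height \<open>e\<close>, where \<open>x \<rightarrow> \<infinity>\<close> is harmless.  The
  vertical sides contribute \<open>ln |F|\<close>, and the error is \<open>O (e ln (1/e))\<close> uniformly in \<open>x\<close>
  (\<open>boundary_layer\<close>), because
  \<open>\<kappa> Im z (1 + |m_fin x z|\<^sup>2) \<le> Im (m_fin x z)\<close> with the same \<open>\<kappa>\<close> for
  all \<open>x \<ge> a + 1\<close> and all \<open>z\<close> in a bounded set (\<open>m_fin_coercive\<close>).  Letting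
  \<open>x \<rightarrow> \<infinity>\<close> and then \<open>e \<rightarrow> 0\<close> gives the limit distribution of \<open>phi\<close> on intervals of spectral
  parameters (\<open>phi_distribution_limit\<close>).

  The threshold \<open>D \<lambda>\<close> for the reduced phase becomes a threshold for \<open>phi\<close> which is merely
  measurable in \<open>\<lambda>\<close>, even if \<open>D\<close> is constant, since \<open>A\<close> and \<open>B\<close> are only measurable.  Monotonicity in the
  threshold extends the limit from constants to continuous and then to measurable thresholds
  (\<open>distribution_limit_measurable_threshold\<close>).  Inserting the translated threshold
  (\<open>phase_threshold\<close>) into the limit distribution leaves exactly \<open>D / pi\<close>.
\<close>

section \<open>Initial value problems for second-order linear equations\<close>

lemma at_within_ray:
  fixes a x :: real assumes "x < b"
  shows "at x within {a..b} = at x within {a..}"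
  by (rule at_within_nhd[of x "{..<b}"]) (use assms in auto)

lemma has_vector_derivative_suminf:
  fixes f :: "nat \<Rightarrow> real \<Rightarrow> complex"
  assumes S: "convex S" and x: "x \<in> S"
    and d: "\<And>n x. x \<in> S \<Longrightarrow> (f n has_vector_derivative f' n x) (at x within S)"
    and b: "\<And>n x. x \<in> S \<Longrightarrow> cmod (f n x) \<le> b n" "summable b"
    and b': "\<And>n x. x \<in> S \<Longrightarrow> cmod (f' n x) \<le> b' n" "summable b'"
  shows "((\<lambda>x. \<Sum>n. f n x) has_vector_derivative (\<Sum>n. f' n x)) (at x within S)"
proof -
  have ul: "uniform_limit S (\<lambda>n x. \<Sum>i<n. f' i x) (\<lambda>x. \<Sum>i. f' i x) sequentially"
    by (rule Weierstrass_m_test[OF _ b'(2)]) (use b'(1) in auto)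
  have "\<exists>g. \<forall>x\<in>S. (\<lambda>n. f n x) sums g x \<and> (g has_derivative (\<lambda>h. h *\<^sub>R (\<Sum>n. f' n x))) (at x within S)"
  proof (rule has_derivative_series[OF S _ _ x])
    show "(f n has_derivative (\<lambda>h. h *\<^sub>R f' n x)) (at x within S)" if "x \<in> S" for n x
      using d[OF that] by (simp add: has_vector_derivative_def)
    show "(\<lambda>n. f n x) sums (\<Sum>n. f n x)"
      by (rule summable_sums, rule summable_comparison_test'[OF b(2)], rule b(1)[OF x])
    fix e :: real assume e: "e > 0"
    show "\<forall>\<^sub>F n in sequentially. \<forall>x\<in>S. \<forall>h. cmod ((\<Sum>i<n. h *\<^sub>R f' i x) - h *\<^sub>R (\<Sum>n. f' n x)) \<le> e * norm h"
      using uniform_limitD[OF ul e]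
    proof eventually_elim
      case (elim n)
      show ?case
      proof (intro ballI allI)
        fix x h assume "x \<in> S"
        hence "cmod ((\<Sum>i<n. f' i x) - (\<Sum>i. f' i x)) \<le> e" using elim by (auto simp: dist_norm less_imp_le)
        moreover have "(\<Sum>i<n. h *\<^sub>R f' i x) - h *\<^sub>R (\<Sum>n. f' n x) = h *\<^sub>R ((\<Sum>i<n. f' i x) - (\<Sum>i. f' i x))"
          by (simp add: scaleR_right.sum scaleR_diff_right)
        ultimately show "cmod ((\<Sum>i<n. h *\<^sub>R f' i x) - h *\<^sub>R (\<Sum>n. f' n x)) \<le> e * norm h"
          by (simp add: mult_left_mono mult.commute[of e])
      qed
    qed
  qed
  then obtain g where g: "\<And>x. x\<in>S \<Longrightarrow> (\<lambda>n. f n x) sums g x"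
    "\<And>x. x\<in>S \<Longrightarrow> (g has_derivative (\<lambda>h. h *\<^sub>R (\<Sum>n. f' n x))) (at x within S)" by blast
  have "(g has_vector_derivative (\<Sum>n. f' n x)) (at x within S)"
    using g(2)[OF x] by (simp add: has_vector_derivative_def)
  thus ?thesis
    by (rule has_vector_derivative_transform[OF x, rotated]) (use g(1) in \<open>auto simp: sums_iff\<close>)
qed

text \<open>
  Successive integrals of \<open>y'' = p y\<close>.  Their sum is the solution of the initial value problem: the
  \<open>k\<close>-th term is bounded on compact intervals by the \<open>k\<close>-th term of an exponential series.
\<close>
primrec picard :: "(real \<Rightarrow> complex) \<Rightarrow> real \<Rightarrow> complex \<Rightarrow> complex \<Rightarrow> nat \<Rightarrow> real \<Rightarrow> complex" where
  "picard p a c0 c1 0 = (\<lambda>x. c0 + of_real (x - a) * c1)"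
| "picard p a c0 c1 (Suc k) =
     (\<lambda>x. integral {a..x} (\<lambda>s. integral {a..s} (\<lambda>t. p t * picard p a c0 c1 k t)))"

definition picard' :: "(real \<Rightarrow> complex) \<Rightarrow> real \<Rightarrow> complex \<Rightarrow> complex \<Rightarrow> nat \<Rightarrow> real \<Rightarrow> complex" where
  "picard' p a c0 c1 k x =
     (case k of 0 \<Rightarrow> c1 | Suc j \<Rightarrow> integral {a..x} (\<lambda>t. p t * picard p a c0 c1 j t))"

lemma integral_ray_has_vector_derivative:
  fixes f :: "real \<Rightarrow> 'b::banach"
  assumes "continuous_on {a..} f" "a \<le> x"
  shows "((\<lambda>u. integral {a..u} f) has_vector_derivative f x) (at x within {a..})"
proof -
  have "((\<lambda>u. integral {a..u} f) has_vector_derivative f x) (at x within {a..x+1})"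
    by (rule integral_has_vector_derivative) (use assms in \<open>auto intro: continuous_on_subset\<close>)
  thus ?thesis by (simp add: at_within_ray)
qed

lemma continuous_on_if_has_vector_derivative:
  assumes "\<And>x. x \<in> S \<Longrightarrow> (f has_vector_derivative f' x) (at x within S)"
  shows "continuous_on S f"
  using assms has_vector_derivative_continuous continuous_on_eq_continuous_within by blast

lemma picard_props:
  assumes p: "continuous_on {a..} p"
  shows "continuous_on {a..} (picard p a c0 c1 k) \<and> continuous_on {a..} (picard' p a c0 c1 k) \<and>
    (\<forall>x\<ge>a. (picard p a c0 c1 k has_vector_derivative picard' p a c0 c1 k x) (at x within {a..})) \<and>
    (\<forall>x\<ge>a. (picard' p a c0 c1 (Suc k) has_vector_derivative p x * picard p a c0 c1 k x) (at x within {a..}))"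
proof (induction k)
  case 0
  have c: "continuous_on {a..} (picard p a c0 c1 0)" by (auto intro!: continuous_intros)
  show ?case
  proof (intro conjI allI impI c)
    show "continuous_on {a..} (picard' p a c0 c1 0)" by (simp add: picard'_def)
    fix x assume x: "a \<le> x"
    show "(picard p a c0 c1 0 has_vector_derivative picard' p a c0 c1 0 x) (at x within {a..})"
      by (auto simp: picard'_def scaleR_conv_of_real[symmetric] intro!: derivative_eq_intros)
    show "(picard' p a c0 c1 (Suc 0) has_vector_derivative p x * picard p a c0 c1 0 x) (at x within {a..})"
      unfolding picard'_def nat.case
      by (rule integral_ray_has_vector_derivative[OF _ x]) (intro continuous_on_mult p c)
  qed
next
  case (Suc k)
  have c: "continuous_on {a..} (picard' p a c0 c1 (Suc k))"
    by (rule continuous_on_if_has_vector_derivative) (use Suc in auto)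
  have d: "(picard p a c0 c1 (Suc k) has_vector_derivative picard' p a c0 c1 (Suc k) x) (at x within {a..})"
    if "a \<le> x" for x
    using integral_ray_has_vector_derivative[OF c that] by (simp add: picard'_def[abs_def])
  have c': "continuous_on {a..} (picard p a c0 c1 (Suc k))"
    by (rule continuous_on_if_has_vector_derivative) (use d in auto)
  show ?case
  proof (intro conjI allI impI c c' d)
    fix x assume x: "a \<le> x"
    show "(picard' p a c0 c1 (Suc (Suc k)) has_vector_derivative p x * picard p a c0 c1 (Suc k) x) (at x within {a..})"
      unfolding picard'_def nat.case(2)[of _ _ "Suc k"]
      by (rule integral_ray_has_vector_derivative[OF _ x]) (intro continuous_on_mult p c')
  qed auto
qed

lemma integral_pow_fact:
  fixes a x :: real assumes "a \<le> x"
  shows "((\<lambda>t. c * (t-a)^k / fact k) has_integral c * (x-a)^Suc k / fact (Suc k)) {a..x}"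
proof -
  have "((\<lambda>t. c * (t-a)^k / fact k) has_integral (c * (x-a)^Suc k / fact (Suc k) - c * (a-a)^Suc k / fact (Suc k))) {a..x}"
  proof (rule fundamental_theorem_of_calculus[OF assms])
    fix t assume "t \<in> {a..x}"
    have "((\<lambda>t. c * (t-a)^Suc k / fact (Suc k)) has_real_derivative c * (real (Suc k) * (t-a)^k) / fact (Suc k)) (at t within {a..x})"
      using DERIV_power[of "\<lambda>t. t - a" 1 t "{a..x}" "Suc k"]
      by (intro DERIV_cdivide DERIV_cmult) (auto intro!: derivative_eq_intros simp del: power_Suc)
    moreover have "c * (real (Suc k) * (t-a)^k) / fact (Suc k) = c * (t-a)^k / fact k"
      by (simp add: divide_simps)
    ultimately show "((\<lambda>t. c * (t-a)^Suc k / fact (Suc k)) has_vector_derivative c * (t-a)^k / fact k) (at t within {a..x})"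
      by (simp only: has_real_derivative_iff_has_vector_derivative)
  qed
  thus ?thesis by simp
qed

text \<open>
  Each step integrates twice.  One integration is estimated by the length \<open>L\<close> of the interval, the
  other one produces the factorial; with \<open>L \<ge> 1\<close> the same bound serves for the derivatives.
\<close>
lemma picard_bound:
  assumes p: "continuous_on {a..} p" and K: "\<And>t. t \<in> {a..X} \<Longrightarrow> cmod (p t) \<le> K"
    and L: "1 \<le> L" "X - a \<le> L" and x: "x \<in> {a..X}"
  shows "cmod (picard p a c0 c1 k x) \<le> (cmod c0 + L * cmod c1) * (K * L)^k * (x-a)^k / fact k"
    and "cmod (picard' p a c0 c1 k x) \<le> (cmod c0 + L * cmod c1) * (K * L)^k * (x-a)^k / fact k"
proof -
  let ?M = "cmod c0 + L * cmod c1"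
  have K0: "K \<ge> 0" using K[OF x] norm_ge_zero order_trans by blast
  have "\<forall>x\<in>{a..X}. cmod (picard p a c0 c1 k x) \<le> ?M * (K * L)^k * (x-a)^k / fact k \<and>
     cmod (picard' p a c0 c1 k x) \<le> ?M * (K * L)^k * (x-a)^k / fact k"
  proof (induction k)
    case 0
    show ?case
    proof (intro ballI conjI)
      fix x assume x: "x \<in> {a..X}"
      have "cmod (c0 + of_real (x-a) * c1) \<le> cmod c0 + \<bar>x-a\<bar> * cmod c1"
        by (metis norm_triangle_ineq norm_mult norm_of_real)
      also have "\<dots> \<le> ?M" using x L by (intro add_mono mult_right_mono) auto
      finally show "cmod (picard p a c0 c1 0 x) \<le> ?M * (K * L)^0 * (x-a)^0 / fact 0" by simp
      have "cmod c1 \<le> L * cmod c1" using L mult_right_mono[of 1 L "cmod c1"] by simp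
      thus "cmod (picard' p a c0 c1 0 x) \<le> ?M * (K * L)^0 * (x-a)^0 / fact 0"
        using norm_ge_zero[of c0] by (simp add: picard'_def add_increasing)
    qed
  next
    case (Suc k)
    let ?C = "?M * K * (K * L)^k"
    have C0: "?C \<ge> 0" using K0 L by simp
    note props = picard_props[OF p, of c0 c1]
    have d: "cmod (picard' p a c0 c1 (Suc k) x) \<le> ?C * (x-a)^Suc k / fact (Suc k)" if x: "x \<in> {a..X}" for x
    proof -
      have "cmod (integral {a..x} (\<lambda>t. p t * picard p a c0 c1 k t)) \<le> integral {a..x} (\<lambda>t. ?C * (t-a)^k / fact k)"
      proof (rule integral_norm_bound_integral)
        show "(\<lambda>t. p t * picard p a c0 c1 k t) integrable_on {a..x}"
          by (intro integrable_continuous_real continuous_intros continuous_on_subset[OF p]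
                continuous_on_subset[OF conjunct1[OF props]]) auto
        show "(\<lambda>t. ?C * (t-a)^k / fact k) integrable_on {a..x}"
          using integral_pow_fact[of a x ?C k] x by (auto simp: has_integral_integrable_integral)
        fix t assume t: "t \<in> {a..x}"
        have "cmod (p t * picard p a c0 c1 k t) \<le> K * (?M * (K * L)^k * (t-a)^k / fact k)"
          unfolding norm_mult using Suc t x K K0 by (intro mult_mono) auto
        thus "cmod (p t * picard p a c0 c1 k t) \<le> ?C * (t-a)^k / fact k" by (simp add: mult_ac)
      qed
      also have "\<dots> = ?C * (x-a)^Suc k / fact (Suc k)"
        using integral_pow_fact[of a x ?C k] x by (intro integral_unique) auto
      finally show ?thesis by (simp add: picard'_def)
    qed
    show ?case
    proof (intro ballI conjI)
      fix x assume x: "x \<in> {a..X}"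
      let ?E = "?C * ((x-a)^Suc k / fact (Suc k))"
      have E0: "?E \<ge> 0" using x C0 by simp
      have "cmod (picard p a c0 c1 (Suc k) x) = cmod (integral {a..x} (picard' p a c0 c1 (Suc k)))"
        by (simp add: picard'_def[abs_def])
      also have "\<dots> \<le> ?E * (x - a)"
      proof (rule integral_bound)
        show "continuous_on {a..x} (picard' p a c0 c1 (Suc k))"
          by (rule continuous_on_subset[of "{a..}"]) (use props in auto)
        fix t assume t: "t \<in> {a..x}"
        have "cmod (picard' p a c0 c1 (Suc k) t) \<le> ?C * (t-a)^Suc k / fact (Suc k)" using d t x by auto
        also have "\<dots> \<le> ?C * (x-a)^Suc k / fact (Suc k)"
          using t C0 by (intro divide_right_mono mult_left_mono power_mono) auto
        finally show "cmod (picard' p a c0 c1 (Suc k) t) \<le> ?E" by simp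
      qed (use x in auto)
      also have "\<dots> \<le> ?E * L" by (rule mult_left_mono) (use x L E0 in auto)
      also have "\<dots> = ?M * (K * L)^Suc k * (x-a)^Suc k / fact (Suc k)" by (simp add: mult_ac)
      finally show "cmod (picard p a c0 c1 (Suc k) x) \<le> ?M * (K * L)^Suc k * (x-a)^Suc k / fact (Suc k)" .
      have "cmod (picard' p a c0 c1 (Suc k) x) \<le> ?E * 1" using d[OF x] by simp
      also have "\<dots> \<le> ?E * L" by (rule mult_left_mono) (use L E0 in auto)
      also have "\<dots> = ?M * (K * L)^Suc k * (x-a)^Suc k / fact (Suc k)" by (simp add: mult_ac)
      finally show "cmod (picard' p a c0 c1 (Suc k) x) \<le> ?M * (K * L)^Suc k * (x-a)^Suc k / fact (Suc k)" .
    qed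
  qed
  thus "cmod (picard p a c0 c1 k x) \<le> (cmod c0 + L * cmod c1) * (K * L)^k * (x-a)^k / fact k"
    and "cmod (picard' p a c0 c1 k x) \<le> (cmod c0 + L * cmod c1) * (K * L)^k * (x-a)^k / fact k" using x by auto
qed

text \<open>
  The Picard terms and their derivatives are dominated on every \<open>[a, X]\<close> by a summable series, so
  the sum may be differentiated term by term twice.
\<close>
lemma second_order_linear_ivp_exists:
  fixes p :: "real \<Rightarrow> complex"
  assumes p: "continuous_on {a..} p"
  shows "\<exists>y y'. y a = c0 \<and> y' a = c1 \<and> (\<forall>x\<ge>a. (y has_vector_derivative y' x) (at x within {a..}) \<and>
           (y' has_vector_derivative p x * y x) (at x within {a..}))"
proof -
  let ?T = "picard p a c0 c1" and ?S = "picard' p a c0 c1"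
  define y y' where "y = (\<lambda>x. \<Sum>k. ?T k x)" and "y' = (\<lambda>x. \<Sum>k. ?S k x)"
  note props = picard_props[OF p, of c0 c1]
  have "(y has_vector_derivative y' x) (at x within {a..}) \<and>
           (y' has_vector_derivative p x * y x) (at x within {a..})" if x: "x \<ge> a" for x
  proof -
    define X where "X = x + 1"
    have xX: "x \<in> {a..X}" using x by (simp add: X_def)
    have "compact (p ` {a..X})" by (intro compact_continuous_image continuous_on_subset[OF p]) auto
    then obtain K where K: "\<And>t. t \<in> {a..X} \<Longrightarrow> cmod (p t) \<le> K"
      by (metis compact_imp_bounded bounded_iff imageI)
    define L where "L = max 1 (X - a)"
    have L: "1 \<le> L" "X - a \<le> L" by (auto simp: L_def)
    have K0: "K \<ge> 0" using K[OF xX] norm_ge_zero order_trans by blast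
    define M where "M = cmod c0 + L * cmod c1"
    define b where "b k = M * ((K * L * L)^k / fact k)" for k :: nat
    have M0: "M \<ge> 0" using L by (simp add: M_def)
    have sb: "summable b" unfolding b_def
      using summable_exp_generic[of "K*L*L"] by (intro summable_mult) (simp add: divide_inverse mult.commute)
    have le: "M * (K * L)^k * (t-a)^k / fact k \<le> b k" if "t \<in> {a..X}" for k t
    proof -
      have "(t-a)^k \<le> L^k" using that L by (intro power_mono) auto
      hence "M * (K*L)^k * (t-a)^k / fact k \<le> M * (K*L)^k * L^k / fact k"
        using M0 K0 L by (intro divide_right_mono mult_left_mono) auto
      thus ?thesis by (simp add: b_def power_mult_distrib mult_ac)
    qed
    have bT: "cmod (?T k t) \<le> b k" and bS: "cmod (?S k t) \<le> b k" if "t \<in> {a..X}" for k t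
      using picard_bound[OF p K L that, of c0 c1 k] le[OF that, of k] by (auto simp: M_def)
    define D where "D k x = (case k of 0 \<Rightarrow> 0 | Suc j \<Rightarrow> p x * ?T j x)" for k x
    define b' where "b' k = (case k of 0 \<Rightarrow> 0 | Suc j \<Rightarrow> K * b j)" for k
    have sb': "summable b'" using sb by (subst summable_Suc_iff[symmetric]) (simp add: b'_def summable_mult)
    have bD: "cmod (D k t) \<le> b' k" if "t \<in> {a..X}" for k t
      using that K bT K0 by (cases k) (auto simp: D_def b'_def norm_mult intro!: mult_mono)
    have dT: "(?T n has_vector_derivative ?S n t) (at t within {a..X})"
      and dS: "(?S (Suc n) has_vector_derivative p t * ?T n t) (at t within {a..X})"
      if "t \<in> {a..X}" for n t
      using that by (auto intro!: has_vector_derivative_within_subset[of _ _ _ "{a..}"]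
        props[THEN conjunct2, THEN conjunct2, THEN conjunct1, rule_format]
        props[THEN conjunct2, THEN conjunct2, THEN conjunct2, rule_format] simp del: picard.simps)
    have 1: "(y has_vector_derivative y' x) (at x within {a..X})" unfolding y_def y'_def
      by (rule has_vector_derivative_suminf[OF _ xX dT bT sb bS sb]) auto
    have 2: "(y' has_vector_derivative (\<Sum>k. D k x)) (at x within {a..X})" unfolding y'_def
    proof (rule has_vector_derivative_suminf[OF _ xX _ bS sb bD sb'])
      show "(?S n has_vector_derivative D n t) (at t within {a..X})" if "t \<in> {a..X}" for n t
      proof (cases n)
        case 0 thus ?thesis by (simp add: picard'_def[abs_def] D_def)
      next
        case (Suc j)
        thus ?thesis using dS[OF that] by (simp add: D_def)
      qed
    qed auto
    have sT: "summable (\<lambda>k. ?T k x)" by (rule summable_comparison_test'[OF sb]) (use bT xX in auto)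
    have sD: "summable (\<lambda>k. D k x)" by (rule summable_comparison_test'[OF sb']) (use bD xX in auto)
    have "(\<Sum>k. D k x) = (\<Sum>k. D (Suc k) x)"
      using suminf_split_head[OF sD] by (simp add: D_def)
    also have "\<dots> = p x * y x" using suminf_mult[OF sT] by (simp add: D_def y_def)
    finally show ?thesis using 1 2 by (simp add: X_def at_within_ray)
  qed
  moreover have "?T k a = (if k = 0 then c0 else 0)" for k by (cases k) auto
  hence "y a = c0" unfolding y_def using sums_single[of 0 "\<lambda>_. c0"] by (simp add: sums_iff)
  moreover have "?S k a = (if k = 0 then c1 else 0)" for k by (cases k) (auto simp: picard'_def)
  hence "y' a = c1" unfolding y'_def using sums_single[of 0 "\<lambda>_. c1"] by (simp add: sums_iff)
  ultimately show ?thesis by blast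
qed

section \<open>Solutions of the Sturm--Liouville equation\<close>

locale sturm_liouville =
  fixes q :: "real \<Rightarrow> real" and a :: real
  assumes q_cont: "continuous_on {a..} q"
begin

abbreviation sol :: "complex \<Rightarrow> (real \<Rightarrow> complex) \<Rightarrow> (real \<Rightarrow> complex) \<Rightarrow> bool" where
  "sol z f f' \<equiv> sl_solution q a z f f'"

lemma sol_deriv:
  assumes "sol z f f'" "a \<le> x"
  shows "(f has_vector_derivative f' x) (at x within {a..})"
    and "(f' has_vector_derivative (of_real (q x) - z) * f x) (at x within {a..})"
  using assms by (auto simp: sl_solution_def)

lemma sol_cont:
  assumes "sol z f f'" shows "continuous_on {a..} f" "continuous_on {a..} f'"
  by (rule continuous_on_if_has_vector_derivative, use assms sol_deriv in blast)+

lemma sol_lincomb: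
  assumes "sol z f f'" "sol z g g'"
  shows "sol z (\<lambda>x. \<alpha> * f x + \<beta> * g x) (\<lambda>x. \<alpha> * f' x + \<beta> * g' x)"
  unfolding sl_solution_def
  by (auto intro!: derivative_eq_intros sol_deriv[OF assms(1)] sol_deriv[OF assms(2)] simp: algebra_simps)

lemma q_bounded: obtains Q where "Q \<ge> 0" "\<And>t. t \<in> {a..X} \<Longrightarrow> \<bar>q t\<bar> \<le> Q"
proof -
  have "compact (q ` {a..X})" by (intro compact_continuous_image continuous_on_subset[OF q_cont]) auto
  then obtain Q where "\<And>t. t \<in> {a..X} \<Longrightarrow> \<bar>q t\<bar> \<le> Q"
    by (metis compact_imp_bounded bounded_iff imageI real_norm_def)
  thus ?thesis by (intro that[of "max Q 0"]) (auto simp: le_max_iff_disj)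
qed

text \<open>
  The energy \<open>|f|\<^sup>2 + |f'|\<^sup>2\<close> has logarithmic derivative at most \<open>1 + |q - z|\<close>.  The bound is uniform
  for \<open>z\<close> in a disc; it gives uniqueness at once and, below, continuity in the spectral parameter.
\<close>
lemma gronwall:
  assumes f: "sol z f f'" and Q: "\<And>t. t \<in> {a..X} \<Longrightarrow> \<bar>q t\<bar> \<le> Q" and R: "cmod z \<le> R"
    and x: "x \<in> {a..X}"
  shows "(cmod (f x))\<^sup>2 + (cmod (f' x))\<^sup>2 \<le> ((cmod (f a))\<^sup>2 + (cmod (f' a))\<^sup>2) * exp ((1 + Q + R) * (x - a))"
proof (cases "x = a")
  case False
  hence ax: "a < x" using x by auto
  define K where "K = 1 + Q + R"
  define E where "E t = f t \<bullet> f t + f' t \<bullet> f' t" for t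
  define F where "F t = E t * exp (- K * (t - a))" for t
  have Fc: "continuous_on {a..x} F" unfolding F_def E_def
    by (intro continuous_intros continuous_on_subset[OF sol_cont(1)[OF f]]
         continuous_on_subset[OF sol_cont(2)[OF f]]) auto
  have "F x \<le> F a"
  proof (rule DERIV_nonpos_imp_decreasing_open[where f = F and a = a and b = x])
    show "a \<le> x" using ax by simp
    show "continuous_on {a..x} F" by (fact Fc)
  next
    fix t assume t: "a < t" "t < x"
    have at: "at t within {a..} = at t" by (rule at_within_interior) (use t in auto)
    note d = sol_deriv[OF f less_imp_le[OF t(1)], unfolded at]
    let ?p = "of_real (q t) - z"
    have dE: "(E has_real_derivative (2 * (f t \<bullet> f' t) + 2 * (f' t \<bullet> (?p * f t)))) (at t)"
      unfolding E_def has_real_derivative_iff_has_vector_derivative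
      using has_vector_derivative_add[OF
        bounded_bilinear.has_vector_derivative[OF bounded_bilinear_inner d(1) d(1)]
        bounded_bilinear.has_vector_derivative[OF bounded_bilinear_inner d(2) d(2)]]
      by (simp add: inner_commute algebra_simps)
    have dF: "(F has_real_derivative ((2 * (f t \<bullet> f' t) + 2 * (f' t \<bullet> (?p * f t))) - K * E t) * exp (- K * (t - a))) (at t)"
      unfolding F_def by (rule derivative_eq_intros dE refl | simp)+ (simp add: algebra_simps)
    have "\<bar>q t\<bar> \<le> Q" using Q t x by auto
    hence "cmod ?p \<le> Q + R" using norm_triangle_ineq4[of "of_real (q t)" z] R by simp
    moreover have "f' t \<bullet> (?p * f t) \<le> cmod (f' t) * (cmod ?p * cmod (f t))"
      using norm_cauchy_schwarz[of "f' t" "?p * f t"] by (simp add: norm_mult)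
    moreover have "cmod (f' t) * (cmod ?p * cmod (f t)) = cmod ?p * (cmod (f t) * cmod (f' t))" by simp
    moreover have "cmod ?p * (cmod (f t) * cmod (f' t)) \<le> (Q + R) * (cmod (f t) * cmod (f' t))"
      by (rule mult_right_mono) (use calculation in auto)
    moreover have "f t \<bullet> f' t \<le> cmod (f t) * cmod (f' t)" by (rule norm_cauchy_schwarz)
    ultimately have "2 * (f t \<bullet> f' t) + 2 * (f' t \<bullet> (?p * f t)) \<le> K * (2 * (cmod (f t) * cmod (f' t)))"
      by (simp add: K_def algebra_simps)
    also have "\<dots> \<le> K * E t"
    proof (rule mult_left_mono)
      have "0 \<le> (cmod (f t) - cmod (f' t))\<^sup>2" by simp
      thus "2 * (cmod (f t) * cmod (f' t)) \<le> E t"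
        by (simp add: E_def power2_norm_eq_inner[symmetric] power2_diff)
      show "0 \<le> K" using \<open>cmod ?p \<le> Q + R\<close> norm_ge_zero[of ?p] unfolding K_def by linarith
    qed
    finally have "(2 * (f t \<bullet> f' t) + 2 * (f' t \<bullet> (?p * f t)) - K * E t) * exp (- K * (t - a)) \<le> 0"
      by (simp add: mult_le_0_iff)
    with dF show "\<exists>y. (F has_real_derivative y) (at t) \<and> y \<le> 0" by blast
  qed
  hence "E x * exp (- K * (x-a)) * exp (K * (x-a)) \<le> E a * exp (K * (x-a))"
    unfolding F_def by (intro mult_right_mono) auto
  moreover have "exp (- K * (x-a)) * exp (K * (x-a)) = 1" by (simp add: exp_add[symmetric])
  ultimately have "E x \<le> E a * exp (K * (x-a))" by (simp only: mult.assoc mult_1_right)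
  thus ?thesis by (simp add: E_def K_def power2_norm_eq_inner)
qed auto

lemma sol_unique:
  assumes f: "sol z f f'" and g: "sol z g g'" and "f a = g a" "f' a = g' a" "a \<le> x"
  shows "f x = g x"
proof -
  obtain Q where Q: "\<And>t. t \<in> {a..x} \<Longrightarrow> \<bar>q t\<bar> \<le> Q" using q_bounded by blast
  have s: "sol z (\<lambda>x. 1 * f x + (-1) * g x) (\<lambda>x. 1 * f' x + (-1) * g' x)" by (rule sol_lincomb[OF f g])
  have "(cmod (f x - g x))\<^sup>2 + (cmod (f' x - g' x))\<^sup>2 \<le> 0"
    using gronwall[OF s Q order_refl, of x] assms by simp
  thus ?thesis by (simp add: sum_power2_le_zero_iff)
qed

definition ivp' :: "complex \<Rightarrow> complex \<Rightarrow> complex \<Rightarrow> real \<Rightarrow> complex" where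
  "ivp' z c0 c1 = (SOME y'. sol z (sl_ivp q a z c0 c1) y' \<and> y' a = c1)"

lemma ivp:
  "sol z (sl_ivp q a z c0 c1) (ivp' z c0 c1)" "sl_ivp q a z c0 c1 a = c0" "ivp' z c0 c1 a = c1"
proof -
  have "continuous_on {a..} (\<lambda>x. complex_of_real (q x) - z)" by (intro continuous_intros q_cont)
  from second_order_linear_ivp_exists[OF this, of c0 c1]
  have "\<exists>y y'. sol z y y' \<and> y a = c0 \<and> y' a = c1" unfolding sl_solution_def by metis
  hence 1: "\<exists>y'. sol z (sl_ivp q a z c0 c1) y' \<and> sl_ivp q a z c0 c1 a = c0 \<and> y' a = c1"
    unfolding sl_ivp_def by (rule someI_ex)
  hence "\<exists>y'. sol z (sl_ivp q a z c0 c1) y' \<and> y' a = c1" by blast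
  from someI_ex[OF this] 1 show "sol z (sl_ivp q a z c0 c1) (ivp' z c0 c1)"
    "sl_ivp q a z c0 c1 a = c0" "ivp' z c0 c1 a = c1" by (auto simp: ivp'_def)
qed

abbreviation u :: "complex \<Rightarrow> real \<Rightarrow> complex" where "u z x \<equiv> sl_u q a x z"
abbreviation v :: "complex \<Rightarrow> real \<Rightarrow> complex" where "v z x \<equiv> sl_v q a x z"
definition u' :: "complex \<Rightarrow> real \<Rightarrow> complex" where "u' z = ivp' z 1 0"
definition v' :: "complex \<Rightarrow> real \<Rightarrow> complex" where "v' z = ivp' z 0 1"

lemma sol_u: "sol z (u z) (u' z)" "u z a = 1" "u' z a = 0"
  and sol_v: "sol z (v z) (v' z)" "v z a = 0" "v' z a = 1"
  using ivp[of z 1 0] ivp[of z 0 1] by (simp_all add: sl_u_def sl_v_def u'_def v'_def)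

lemma sol_eq_uv:
  assumes "sol z f f'" "a \<le> x"
  shows "f x = f a * u z x + f' a * v z x"
  by (rule sol_unique[OF assms(1) sol_lincomb[OF sol_u(1) sol_v(1)] _ _ assms(2)])
     (simp_all add: sol_u sol_v)

lemma ivp_eq_uv: "a \<le> x \<Longrightarrow> sl_ivp q a z c0 c1 x = c0 * u z x + c1 * v z x"
  using sol_eq_uv[OF ivp(1), of x z c0 c1] by (simp add: ivp)

lemma ray_integrable:
  fixes f :: "real \<Rightarrow> 'b::banach"
  assumes "continuous_on {a..} f" shows "f integrable_on {a..x}"
  by (intro integrable_continuous_real continuous_on_subset[OF assms]) auto

text \<open>
  The derivative of \<open>f' g - f g'\<close> is \<open>(\<zeta> - z) f g\<close>.  For \<open>\<zeta> = z\<close> this is the constancy of the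
  Wronskian; for \<open>\<zeta> \<noteq> z\<close> it compares solutions at different spectral parameters.
\<close>
lemma lagrange_identity:
  assumes f: "sol z f f'" and g: "sol \<zeta> g g'" and x: "a \<le> x"
  shows "f' x * g x - f x * g' x = f' a * g a - f a * g' a + (\<zeta> - z) * integral {a..x} (\<lambda>t. f t * g t)"
proof -
  have "((\<lambda>t. (\<zeta> - z) * (f t * g t)) has_integral (f' x * g x - f x * g' x - (f' a * g a - f a * g' a))) {a..x}"
  proof (rule fundamental_theorem_of_calculus[OF x])
    fix t assume t: "t \<in> {a..x}"
    hence at: "a \<le> t" by auto
    have "((\<lambda>t. f' t * g t - f t * g' t) has_vector_derivative (\<zeta> - z) * (f t * g t)) (at t within {a..})"
      by (rule derivative_eq_intros sol_deriv[OF f at] sol_deriv[OF g at] refl)+ (simp add: algebra_simps)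
    thus "((\<lambda>t. f' t * g t - f t * g' t) has_vector_derivative (\<zeta> - z) * (f t * g t)) (at t within {a..x})"
      by (rule has_vector_derivative_within_subset) auto
  qed
  moreover have "integral {a..x} (\<lambda>t. (\<zeta> - z) * (f t * g t)) = (\<zeta> - z) * integral {a..x} (\<lambda>t. f t * g t)" by (rule integral_mult_right)
  ultimately show ?thesis by (simp only: has_integral_iff) (simp add: algebra_simps)
qed

lemma wronskian: "a \<le> x \<Longrightarrow> u z x * v' z x - u' z x * v z x = 1"
  using lagrange_identity[OF sol_u(1)[of z] sol_v(1)[of z], of x]
  by (simp add: sol_u sol_v algebra_simps)

lemma ivp_bounded:
  obtains M where "M \<ge> 0" "\<And>z t. cmod z \<le> R \<Longrightarrow> t \<in> {a..X} \<Longrightarrow> cmod (sl_ivp q a z c0 c1 t) \<le> M"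
proof (cases "R \<ge> 0")
  case True
  obtain Q where Q: "Q \<ge> 0" "\<And>t. t \<in> {a..X} \<Longrightarrow> \<bar>q t\<bar> \<le> Q" using q_bounded by blast
  let ?M = "((cmod c0)\<^sup>2 + (cmod c1)\<^sup>2) * exp ((1 + Q + R) * (X - a))"
  show ?thesis
  proof (rule that[of "sqrt ?M"])
    fix z t assume z: "cmod z \<le> R" and t: "t \<in> {a..X}"
    have "(cmod (sl_ivp q a z c0 c1 t))\<^sup>2 \<le> (cmod (sl_ivp q a z c0 c1 t))\<^sup>2 + (cmod (ivp' z c0 c1 t))\<^sup>2"
      by simp
    also have "\<dots> \<le> ((cmod c0)\<^sup>2 + (cmod c1)\<^sup>2) * exp ((1 + Q + R) * (t - a))"
      using gronwall[OF ivp(1) Q(2) z t, of c0 c1] by (simp only: ivp)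
    also have "\<dots> \<le> ?M"
    proof (rule mult_left_mono)
      have "(1 + Q + R) * (t - a) \<le> (1 + Q + R) * (X - a)"
        by (rule mult_left_mono) (use True Q(1) t in auto)
      thus "exp ((1 + Q + R) * (t - a)) \<le> exp ((1 + Q + R) * (X - a))" by simp
    qed simp
    finally show "cmod (sl_ivp q a z c0 c1 t) \<le> sqrt ?M" by (rule real_le_rsqrt)
  qed auto
next
  case False
  thus ?thesis by (intro that[of 0]) (auto dest: order_trans[OF norm_ge_zero])
qed

text \<open>
  Variation of constants: Lagrange's identity against \<open>u\<close> and \<open>v\<close> at \<open>z\<close>, solved for the solution at
  \<open>w\<close> by means of the Wronskian.  The explicit factor \<open>w - z\<close> first yields a local Lipschitz bound in
  the spectral parameter and then, inserted into itself, the complex derivative.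
\<close>
lemma ivp_difference:
  assumes x: "a \<le> x"
  shows "sl_ivp q a w c0 c1 x - sl_ivp q a z c0 c1 x =
    (w - z) * (u z x * integral {a..x} (\<lambda>t. sl_ivp q a w c0 c1 t * v z t)
             - v z x * integral {a..x} (\<lambda>t. sl_ivp q a w c0 c1 t * u z t))"
proof -
  let ?f = "sl_ivp q a w c0 c1" and ?f' = "ivp' w c0 c1"
  let ?U = "integral {a..x} (\<lambda>t. ?f t * u z t)" and ?V = "integral {a..x} (\<lambda>t. ?f t * v z t)"
  have 1: "?f' x * v z x - ?f x * v' z x = - c0 + (z - w) * ?V"
    using lagrange_identity[OF ivp(1) sol_v(1) x, of w c0 c1 z] by (simp add: ivp sol_v)
  have 2: "?f' x * u z x - ?f x * u' z x = c1 + (z - w) * ?U"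
    using lagrange_identity[OF ivp(1) sol_u(1) x, of w c0 c1 z] by (simp add: ivp sol_u)
  have "?f x = ?f x * (u z x * v' z x - u' z x * v z x)" using wronskian[OF x] by simp
  also have "\<dots> = (?f' x * u z x - ?f x * u' z x) * v z x - (?f' x * v z x - ?f x * v' z x) * u z x"
    by (simp add: algebra_simps)
  also have "\<dots> = (c1 + (z - w) * ?U) * v z x - (- c0 + (z - w) * ?V) * u z x" by (simp only: 1 2)
  finally show ?thesis by (simp add: ivp_eq_uv[OF x, of z] algebra_simps)
qed

lemma ivp_locally_lipschitz:
  obtains C where "C \<ge> 0" "\<And>w t. cmod (w - z) < 1 \<Longrightarrow> t \<in> {a..X} \<Longrightarrow>
     cmod (sl_ivp q a w c0 c1 t - sl_ivp q a z c0 c1 t) \<le> C * cmod (w - z)"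
proof -
  obtain M where M: "M \<ge> 0" "\<And>w t. cmod w \<le> cmod z + 1 \<Longrightarrow> t \<in> {a..X} \<Longrightarrow> cmod (sl_ivp q a w c0 c1 t) \<le> M"
    using ivp_bounded by blast
  obtain U where U: "U \<ge> 0" "\<And>t. t \<in> {a..X} \<Longrightarrow> cmod (u z t) \<le> U"
    unfolding sl_u_def using ivp_bounded order_refl by metis
  obtain V where V: "V \<ge> 0" "\<And>t. t \<in> {a..X} \<Longrightarrow> cmod (v z t) \<le> V"
    unfolding sl_v_def using ivp_bounded order_refl by metis
  define C where "C = U * (M * V * \<bar>X - a\<bar>) + V * (M * U * \<bar>X - a\<bar>)"
  show ?thesis
  proof (rule that[of C])
    show "C \<ge> 0" using M U V by (simp add: C_def)
    fix w t assume w: "cmod (w - z) < 1" and t: "t \<in> {a..X}"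
    have wz: "cmod w \<le> cmod z + 1" using norm_triangle_sub[of w z] w by simp
    let ?f = "sl_ivp q a w c0 c1"
    have I: "cmod (integral {a..t} (\<lambda>s. ?f s * g s)) \<le> M * G * \<bar>X - a\<bar>"
      if "continuous_on {a..} g" "\<And>s. s \<in> {a..X} \<Longrightarrow> cmod (g s) \<le> G" "G \<ge> 0" for g G
    proof -
      have "cmod (integral {a..t} (\<lambda>s. ?f s * g s)) \<le> M * G * (t - a)"
      proof (rule integral_bound)
        show "continuous_on {a..t} (\<lambda>s. ?f s * g s)"
          by (rule continuous_on_subset[of "{a..}"]) (intro continuous_intros that sol_cont(1)[OF ivp(1)], auto)
        show "cmod (?f s * g s) \<le> M * G" if "s \<in> {a..t}" for s
          unfolding norm_mult using that t \<open>G \<ge> 0\<close> M \<open>\<And>s. s \<in> {a..X} \<Longrightarrow> cmod (g s) \<le> G\<close>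
          by (intro mult_mono M wz) auto
      qed (use t in auto)
      also have "\<dots> \<le> M * G * \<bar>X - a\<bar>" using t M that by (intro mult_left_mono) auto
      finally show ?thesis .
    qed
    have "cmod (?f t - sl_ivp q a z c0 c1 t) = cmod (w - z) *
        cmod (u z t * integral {a..t} (\<lambda>s. ?f s * v z s) - v z t * integral {a..t} (\<lambda>s. ?f s * u z s))"
      using ivp_difference[of t w c0 c1 z] t by (simp add: norm_mult)
    also have "\<dots> \<le> cmod (w - z) * C"
      unfolding C_def
      by (intro mult_left_mono order_trans[OF norm_triangle_ineq4] add_mono)
         (auto simp: norm_mult intro!: mult_mono I U V M sol_cont(1)[OF sol_u(1)] sol_cont(1)[OF sol_v(1)] simp del: atLeastAtMost_iff
          intro: t)
    finally show "cmod (?f t - sl_ivp q a z c0 c1 t) \<le> C * cmod (w - z)" by (simp add: mult.commute)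
  qed
qed

lemma ivp_holomorphic:
  assumes x: "a \<le> x" shows "(\<lambda>z. sl_ivp q a z c0 c1 x) holomorphic_on UNIV"
proof -
  have I: "((\<lambda>w. integral {a..x} (\<lambda>t. sl_ivp q a w c0 c1 t * g t)) \<longlongrightarrow> integral {a..x} (\<lambda>t. sl_ivp q a z c0 c1 t * g t)) (at z)"
    if g: "continuous_on {a..} g" for g z
  proof -
    obtain C where C: "C \<ge> 0" "\<And>w t. cmod (w - z) < 1 \<Longrightarrow> t \<in> {a..x} \<Longrightarrow>
     cmod (sl_ivp q a w c0 c1 t - sl_ivp q a z c0 c1 t) \<le> C * cmod (w - z)" using ivp_locally_lipschitz by blast
    have "compact (g ` {a..x})" by (intro compact_continuous_image continuous_on_subset[OF g]) auto
    then obtain G where G: "\<And>t. t \<in> {a..x} \<Longrightarrow> cmod (g t) \<le> G"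
      by (metis compact_imp_bounded bounded_iff imageI)
    have G0: "G \<ge> 0" using order_trans[OF norm_ge_zero G[of a]] x by auto
    have int: "(\<lambda>t. sl_ivp q a w c0 c1 t * g t) integrable_on {a..x}" for w
      by (intro ray_integrable continuous_intros g sol_cont(1)[OF ivp(1)])
    have "((\<lambda>w. integral {a..x} (\<lambda>t. sl_ivp q a w c0 c1 t * g t) - integral {a..x} (\<lambda>t. sl_ivp q a z c0 c1 t * g t)) \<longlongrightarrow> 0) (at z)"
    proof (rule tendsto_0_le[where f="\<lambda>w. w - z" and K="C * G * (x - a)"])
      show "((\<lambda>w. w - z) \<longlongrightarrow> 0) (at z)" by (auto intro!: tendsto_eq_intros)
      have "\<forall>\<^sub>F w in at z. w \<in> ball z 1" by (rule eventually_at_in_open') auto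
      thus "\<forall>\<^sub>F w in at z. cmod (integral {a..x} (\<lambda>t. sl_ivp q a w c0 c1 t * g t) - integral {a..x} (\<lambda>t. sl_ivp q a z c0 c1 t * g t))
            \<le> cmod (w - z) * (C * G * (x - a))"
      proof eventually_elim
        case (elim w)
        hence w: "cmod (w - z) < 1" by (simp add: dist_norm norm_minus_commute)
        have "cmod (integral {a..x} (\<lambda>t. sl_ivp q a w c0 c1 t * g t) - integral {a..x} (\<lambda>t. sl_ivp q a z c0 c1 t * g t))
           = cmod (integral {a..x} (\<lambda>t. (sl_ivp q a w c0 c1 t - sl_ivp q a z c0 c1 t) * g t))"
          by (simp add: left_diff_distrib integral_diff int)
        also have "\<dots> \<le> (C * cmod (w - z) * G) * (x - a)"
        proof (rule integral_bound[OF x])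
          show "continuous_on {a..x} (\<lambda>t. (sl_ivp q a w c0 c1 t - sl_ivp q a z c0 c1 t) * g t)"
            by (rule continuous_on_subset[of "{a..}"]) (intro continuous_intros g sol_cont(1)[OF ivp(1)], auto)
          show "cmod ((sl_ivp q a w c0 c1 t - sl_ivp q a z c0 c1 t) * g t) \<le> C * cmod (w - z) * G" if "t \<in> {a..x}" for t
            unfolding norm_mult using that C w G by (intro mult_mono) auto
        qed
        finally show ?case by (simp add: mult_ac)
      qed
    qed
    thus ?thesis by (simp add: Lim_null[symmetric])
  qed
  have "((\<lambda>z. sl_ivp q a z c0 c1 x) has_field_derivative
      u z x * integral {a..x} (\<lambda>t. sl_ivp q a z c0 c1 t * v z t)
             - v z x * integral {a..x} (\<lambda>t. sl_ivp q a z c0 c1 t * u z t)) (at z)" for z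
    unfolding has_field_derivative_iff
  proof (rule Lim_transform_eventually)
    show "((\<lambda>w. u z x * integral {a..x} (\<lambda>t. sl_ivp q a w c0 c1 t * v z t)
             - v z x * integral {a..x} (\<lambda>t. sl_ivp q a w c0 c1 t * u z t)) \<longlongrightarrow>
       u z x * integral {a..x} (\<lambda>t. sl_ivp q a z c0 c1 t * v z t)
             - v z x * integral {a..x} (\<lambda>t. sl_ivp q a z c0 c1 t * u z t)) (at z)"
      by (intro tendsto_intros I sol_cont(1)[OF sol_u(1)] sol_cont(1)[OF sol_v(1)])
    have "\<forall>\<^sub>F w in at z. w \<noteq> z" by (simp add: eventually_at_filter)
    thus "\<forall>\<^sub>F w in at z. u z x * integral {a..x} (\<lambda>t. sl_ivp q a w c0 c1 t * v z t)
             - v z x * integral {a..x} (\<lambda>t. sl_ivp q a w c0 c1 t * u z t)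
           = (sl_ivp q a w c0 c1 x - sl_ivp q a z c0 c1 x) / (w - z)"
      by eventually_elim (simp add: ivp_difference[OF x])
  qed
  thus ?thesis by (auto simp: holomorphic_on_def field_differentiable_def intro: has_field_derivative_at_within)
qed

lemma uv_holomorphic:
  assumes "a \<le> x" shows "(\<lambda>z. u z x) holomorphic_on S" "(\<lambda>z. v z x) holomorphic_on S"
  using ivp_holomorphic[OF assms] by (auto simp: sl_u_def sl_v_def intro: holomorphic_on_subset)

text \<open>For real spectral parameter complex conjugation preserves the equation and the initial values.\<close>
lemma uv_real:
  assumes x: "a \<le> x"
  shows "u (of_real lam) x = of_real (Re (u (of_real lam) x))"
    and "v (of_real lam) x = of_real (Re (v (of_real lam) x))"
proof -
  have c: "sol (of_real lam) (\<lambda>x. cnj (f x)) (\<lambda>x. cnj (f' x))" if "sol (of_real lam) f f'" for f f'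
  proof -
    have "((\<lambda>x. cnj (f x)) has_vector_derivative cnj (f' x)) (at x within {a..}) \<and>
      ((\<lambda>x. cnj (f' x)) has_vector_derivative cnj ((of_real (q x) - of_real lam) * f x)) (at x within {a..})" if "a \<le> x" for x
      by (intro conjI bounded_linear.has_vector_derivative[OF bounded_linear_cnj] sol_deriv[OF \<open>sol (of_real lam) f f'\<close> that])
    thus ?thesis by (simp add: sl_solution_def)
  qed
  have "cnj (u (of_real lam) x) = u (of_real lam) x"
    by (rule sol_unique[OF c[OF sol_u(1)] sol_u(1) _ _ x]) (simp_all add: sol_u)
  moreover have "cnj (v (of_real lam) x) = v (of_real lam) x"
    by (rule sol_unique[OF c[OF sol_v(1)] sol_v(1) _ _ x]) (simp_all add: sol_v)
  ultimately show "u (of_real lam) x = of_real (Re (u (of_real lam) x))"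
    "v (of_real lam) x = of_real (Re (v (of_real lam) x))"
    by (auto simp: complex_eq_iff)
qed

end

section \<open>Weyl's limit point theory\<close>

context sturm_liouville begin

definition L2_sq :: "(real \<Rightarrow> complex) \<Rightarrow> real \<Rightarrow> real" where
  "L2_sq f x = integral {a..x} (\<lambda>t. (cmod (f t))\<^sup>2)"

lemma L2_sq_integrable: "continuous_on {a..} f \<Longrightarrow> (\<lambda>t. (cmod (f t))\<^sup>2) integrable_on {a..x}"
  by (intro ray_integrable continuous_intros)

lemma L2_sq_nonneg: "L2_sq f x \<ge> 0"
  unfolding L2_sq_def
  by (cases "(\<lambda>t. (cmod (f t))\<^sup>2) integrable_on {a..x}")
     (auto intro: Henstock_Kurzweil_Integration.integral_nonneg simp: not_integrable_integral)

lemma L2_sq_mono: "continuous_on {a..} f \<Longrightarrow> x \<le> y \<Longrightarrow> L2_sq f x \<le> L2_sq f y"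
  unfolding L2_sq_def by (intro integral_subset_le L2_sq_integrable) auto

lemma L2_sq_lincomb_le:
  assumes "continuous_on {a..} f" "continuous_on {a..} g"
  shows "L2_sq (\<lambda>t. f t + c * g t) x \<le> 2 * L2_sq f x + 2 * (cmod c)\<^sup>2 * L2_sq g x"
proof -
  have "L2_sq (\<lambda>t. f t + c * g t) x \<le> integral {a..x} (\<lambda>t. 2 * (cmod (f t))\<^sup>2 + 2 * (cmod c)\<^sup>2 * (cmod (g t))\<^sup>2)"
    unfolding L2_sq_def
  proof (rule integral_le)
    show "(\<lambda>t. 2 * (cmod (f t))\<^sup>2 + 2 * (cmod c)\<^sup>2 * (cmod (g t))\<^sup>2) integrable_on {a..x}"
      "(\<lambda>t. (cmod (f t + c * g t))\<^sup>2) integrable_on {a..x}"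
      by (intro ray_integrable continuous_intros assms)+
    fix t
    have "(cmod (f t + c * g t))\<^sup>2 \<le> (cmod (f t) + cmod c * cmod (g t))\<^sup>2"
      by (intro power_mono) (auto intro: order_trans[OF norm_triangle_ineq] simp: norm_mult)
    also have "\<dots> \<le> 2 * (cmod (f t))\<^sup>2 + 2 * (cmod c * cmod (g t))\<^sup>2"
      using sum_squares_bound[of "cmod (f t)" "cmod c * cmod (g t)"] by (simp add: power2_sum)
    finally show "(cmod (f t + c * g t))\<^sup>2 \<le> 2 * (cmod (f t))\<^sup>2 + 2 * (cmod c)\<^sup>2 * (cmod (g t))\<^sup>2"
      by (simp add: power_mult_distrib)
  qed
  also have "\<dots> = 2 * L2_sq f x + 2 * (cmod c)\<^sup>2 * L2_sq g x"
    unfolding L2_sq_def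
    by (subst integral_add) (use assms in \<open>auto intro!: ray_integrable continuous_intros\<close>)
  finally show ?thesis .
qed

lemma L2_sq_cmult: "L2_sq (\<lambda>t. c * f t) x = (cmod c)\<^sup>2 * L2_sq f x"
  by (simp add: L2_sq_def norm_mult power_mult_distrib)

lemma in_L2_iff_L2_sq_bounded:
  assumes f: "continuous_on {a..} f"
  shows "in_L2 a f \<longleftrightarrow> (\<exists>K. \<forall>x\<ge>a. L2_sq f x \<le> K)"
proof
  assume "in_L2 a f"
  hence i: "(\<lambda>x. (cmod (f x))\<^sup>2) integrable_on {a<..}"
    using set_borel_integral_eq_integral(1) by (auto simp: in_L2_def)
  have neg: "negligible (({a<..} - {a..}) \<union> ({a..} - {a<..}))"
    by (rule negligible_subset[of "{a}"]) auto
  have i': "(\<lambda>x. (cmod (f x))\<^sup>2) integrable_on {a..}"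
    by (rule integrable_spike_set[OF i]; rule negligible_subset[OF neg]) auto
  have "L2_sq f x \<le> integral {a..} (\<lambda>x. (cmod (f x))\<^sup>2)" for x
    unfolding L2_sq_def by (rule integral_subset_le[OF _ L2_sq_integrable[OF f] i']) auto
  thus "\<exists>K. \<forall>x\<ge>a. L2_sq f x \<le> K" by blast
next
  assume "\<exists>K. \<forall>x\<ge>a. L2_sq f x \<le> K"
  then obtain K where K: "\<And>x. x \<ge> a \<Longrightarrow> L2_sq f x \<le> K" by blast
  define F where "F = (\<lambda>k t. if t \<in> {a..a + real k} then (cmod (f t))\<^sup>2 else 0)"
  have F: "(F k has_integral L2_sq f (a + real k)) {a..}" for k
    unfolding F_def L2_sq_def
    by (rule iffD2[OF has_integral_restrict integrable_integral[OF L2_sq_integrable[OF f]]]) auto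
  have "(\<lambda>x. (cmod (f x))\<^sup>2) integrable_on {a..} \<and>
        ((\<lambda>k. integral {a..} (F k)) \<longlonglongrightarrow> integral {a..} (\<lambda>x. (cmod (f x))\<^sup>2))"
  proof (rule monotone_convergence_increasing)
    show "F k integrable_on {a..}" for k using F by blast
    show "F k x \<le> F (Suc k) x" for k x by (auto simp: F_def)
    show "(\<lambda>k. F k x) \<longlonglongrightarrow> (cmod (f x))\<^sup>2" if "x \<in> {a..}" for x
    proof (rule tendsto_eventually)
      obtain n where n: "x - a \<le> real n" using real_arch_simple by blast
      show "\<forall>\<^sub>F k in sequentially. F k x = (cmod (f x))\<^sup>2"
        using eventually_ge_at_top[of n]
      proof eventually_elim
        case (elim k)
        hence "real n \<le> real k" by simp
        with n have "x \<le> a + real k" by linarith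
        thus ?case using that by (simp add: F_def)
      qed
    qed
    have "\<bar>integral {a..} (F k)\<bar> \<le> K" for k
      using F[of k] K[of "a + real k"] L2_sq_nonneg[of f "a + real k"] by (simp add: integral_unique)
    thus "bounded (range (\<lambda>k. integral {a..} (F k)))" by (auto simp: bounded_iff)
  qed
  hence "(\<lambda>x. (cmod (f x))\<^sup>2) absolutely_integrable_on {a..}"
    by (intro nonnegative_absolutely_integrable_1) auto
  hence "(\<lambda>x. (cmod (f x))\<^sup>2) absolutely_integrable_on {a<..}"
    by (rule set_integrable_subset) auto
  moreover have "(\<lambda>x. indicator {a<..} x *\<^sub>R (cmod (f x))\<^sup>2) \<in> borel_measurable borel"
    by (rule borel_measurable_continuous_on_indicator)
       (auto intro!: continuous_intros continuous_on_subset[OF f])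
  ultimately have "set_integrable lborel {a<..} (\<lambda>x. (cmod (f x))\<^sup>2)"
    unfolding set_integrable_def by (simp add: integrable_completion)
  moreover have "(\<lambda>x. indicator {a<..} x *\<^sub>R f x) \<in> borel_measurable borel"
    by (rule borel_measurable_continuous_on_indicator) (auto intro!: continuous_on_subset[OF f])
  ultimately show "in_L2 a f" by (simp add: in_L2_def set_borel_measurable_def)
qed

text \<open>
  The derivative of \<open>f' cnj f\<close> is \<open>|f'|\<^sup>2 + (q - z) |f|\<^sup>2\<close>, whose imaginary part is \<open>- Im z |f|\<^sup>2\<close>.
\<close>
lemma energy_identity:
  assumes f: "sol z f f'" and x: "a \<le> x"
  shows "Im (f' x * cnj (f x)) = Im (f' a * cnj (f a)) - Im z * L2_sq f x"
proof -
  have "((\<lambda>t. - Im z * (cmod (f t))\<^sup>2) has_integral (Im (f' x * cnj (f x)) - Im (f' a * cnj (f a)))) {a..x}"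
  proof (rule fundamental_theorem_of_calculus[OF x])
    fix t assume t: "t \<in> {a..x}"
    hence at: "a \<le> t" by auto
    have "((\<lambda>t. f' t * cnj (f t)) has_vector_derivative
        f' t * cnj (f' t) + (of_real (q t) - z) * f t * cnj (f t)) (at t within {a..})"
      by (rule has_vector_derivative_mult sol_deriv[OF f at]
           bounded_linear.has_vector_derivative[OF bounded_linear_cnj])+
    from bounded_linear.has_vector_derivative[OF bounded_linear_Im this]
    have "((\<lambda>t. Im (f' t * cnj (f t))) has_vector_derivative - Im z * (cmod (f t))\<^sup>2) (at t within {a..})"
      by (rule back_subst[where P="\<lambda>y. (_ has_vector_derivative y) _"])
         (simp add: cmod_power2[unfolded power2_eq_square] algebra_simps power2_eq_square)
    thus "((\<lambda>t. Im (f' t * cnj (f t))) has_vector_derivative - Im z * (cmod (f t))\<^sup>2) (at t within {a..x})"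
      by (rule has_vector_derivative_within_subset) auto
  qed
  hence "Im (f' x * cnj (f x)) - Im (f' a * cnj (f a)) = integral {a..x} (\<lambda>t. - Im z * (cmod (f t))\<^sup>2)"
    by (rule integral_unique[symmetric])
  also have "\<dots> = - Im z * L2_sq f x" unfolding L2_sq_def by (rule integral_mult_right)
  finally show ?thesis by simp
qed

text \<open>
  Pairing \<open>f\<close> with a function \<open>g\<close> that vanishes to first order at \<open>a + 1\<close> expresses a combination
  of the initial values of \<open>f\<close> as \<open>\<integral> (g'' - (q - z) g) f\<close>.
\<close>
lemma initial_value_le_of_test_function:
  fixes g g' g'' :: "real \<Rightarrow> real"
  assumes f: "sol z f f'"
    and g: "\<And>t. (g has_real_derivative g' t) (at t)" "\<And>t. (g' has_real_derivative g'' t) (at t)"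
    and end0: "g (a+1) = 0" "g' (a+1) = 0"
    and K: "\<And>t. t \<in> {a..a+1} \<Longrightarrow> \<bar>g'' t\<bar> + cmod (of_real (q t) - z) * \<bar>g t\<bar> \<le> K"
  shows "cmod (of_real (g a) * f' a - of_real (g' a) * f a) \<le> K * integral {a..a+1} (\<lambda>t. cmod (f t))"
proof -
  let ?W = "\<lambda>t. of_real (g' t) * f t - of_real (g t) * f' t"
  let ?h = "\<lambda>t. (of_real (g'' t) - (of_real (q t) - z) * of_real (g t)) * f t"
  have h: "(?h has_integral (?W (a+1) - ?W a)) {a..a+1}"
  proof (rule fundamental_theorem_of_calculus)
    fix t assume t: "t \<in> {a..a+1}"
    hence at: "a \<le> t" by auto
    have g1: "((\<lambda>t. complex_of_real (g t)) has_vector_derivative of_real (g' t)) (at t within {a..})"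
      and g2: "((\<lambda>t. complex_of_real (g' t)) has_vector_derivative of_real (g'' t)) (at t within {a..})"
      using g[of t, THEN has_field_derivative_at_within]
      by (auto simp: has_real_derivative_iff_has_vector_derivative
            intro!: bounded_linear.has_vector_derivative[OF bounded_linear_of_real])
    have "(?W has_vector_derivative ?h t) (at t within {a..})"
      by (rule derivative_eq_intros g1 g2 sol_deriv[OF f at] refl)+ (simp add: algebra_simps)
    thus "(?W has_vector_derivative ?h t) (at t within {a..a+1})"
      by (rule has_vector_derivative_within_subset) auto
  qed simp
  have "cmod (of_real (g a) * f' a - of_real (g' a) * f a) = cmod (integral {a..a+1} ?h)"
    using h end0 by (simp add: has_integral_iff)
  also have "\<dots> \<le> integral {a..a+1} (\<lambda>t. K * cmod (f t))"
  proof (rule integral_norm_bound_integral)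
    show "?h integrable_on {a..a+1}" using h by blast
    show "(\<lambda>t. K * cmod (f t)) integrable_on {a..a+1}"
      by (intro ray_integrable continuous_intros sol_cont(1)[OF f])
    fix t assume t: "t \<in> {a..a+1}"
    have "cmod (of_real (g'' t) - (of_real (q t) - z) * of_real (g t)) \<le> \<bar>g'' t\<bar> + cmod (of_real (q t) - z) * \<bar>g t\<bar>"
      by (rule order_trans[OF norm_triangle_ineq4]) (simp add: norm_mult)
    also have "\<dots> \<le> K" by (rule K[OF t])
    finally show "cmod (?h t) \<le> K * cmod (f t)" by (simp add: norm_mult mult_right_mono)
  qed
  also have "\<dots> = K * integral {a..a+1} (\<lambda>t. cmod (f t))" by (rule integral_mult_right)
  finally show ?thesis .
qed

text \<open>
  The square norm over one unit interval controls the initial values, with a constant that is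
  uniform for \<open>z\<close> in a disc, the real axis included.  With \<open>\<tau> = t - a\<close>, the test functions
  \<open>(1 - \<tau>)\<^sup>2\<close> and \<open>\<tau> (1 - \<tau>)\<^sup>2\<close> isolate \<open>f' a + 2 f a\<close> and \<open>f a\<close>.
\<close>
lemma L2_sq_coercive:
  obtains \<kappa> where "\<kappa> > 0"
    "\<And>z f f'. cmod z \<le> R \<Longrightarrow> sol z f f' \<Longrightarrow> \<kappa> * ((cmod (f a))\<^sup>2 + (cmod (f' a))\<^sup>2) \<le> L2_sq f (a+1)"
proof -
  obtain Q where Q: "Q \<ge> 0" "\<And>t. t \<in> {a..a+1} \<Longrightarrow> \<bar>q t\<bar> \<le> Q" using q_bounded by blast
  define K where "K = 6 + Q + \<bar>R\<bar>"
  have K0: "K > 0" using Q by (simp add: K_def)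
  show ?thesis
  proof (rule that[of "1 / (10 * K\<^sup>2)"])
    show "1 / (10 * K\<^sup>2) > 0" using K0 by simp
    fix z f f' assume z: "cmod z \<le> R" and f: "sol z f f'"
    define s where "s = integral {a..a+1} (\<lambda>t. cmod (f t))"
    note fc = sol_cont(1)[OF f]
    have Kb: "\<bar>h\<bar> + cmod (of_real (q t) - z) * \<bar>g\<bar> \<le> K" if "t \<in> {a..a+1}" "\<bar>h\<bar> \<le> 6" "\<bar>g\<bar> \<le> 1" for t h g
    proof -
      have "cmod (of_real (q t) - z) \<le> Q + \<bar>R\<bar>"
        using norm_triangle_ineq4[of "of_real (q t)" z] z Q(2)[OF that(1)] by simp
      hence "cmod (of_real (q t) - z) * \<bar>g\<bar> \<le> (Q + \<bar>R\<bar>) * 1"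
        using that by (intro mult_mono) (auto intro: order_trans[OF norm_ge_zero])
      thus ?thesis using that by (simp add: K_def)
    qed
    \<comment> \<open>both test functions and their derivatives are written out at \<open>t = a\<close>\<close>
    have 1: "cmod (of_real ((1-(a-a))\<^sup>2) * f' a - of_real (- 2 * (1 - (a-a))) * f a) \<le> K * s"
      unfolding s_def
    proof (rule initial_value_le_of_test_function[OF f, where g = "\<lambda>t. (1-(t-a))\<^sup>2" and g' = "\<lambda>t. -2*(1-(t-a))" and g'' = "\<lambda>_. 2"])
      fix t assume t: "t \<in> {a..a+1}"
      have "\<bar>(1-(t-a))\<^sup>2\<bar> \<le> 1" using t by (auto simp: abs_square_le_1)
      thus "\<bar>2\<bar> + cmod (of_real (q t) - z) * \<bar>(1-(t-a))\<^sup>2\<bar> \<le> K" by (intro Kb t) auto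
    qed (auto intro!: derivative_eq_intros simp: algebra_simps)
    have 2: "cmod (of_real ((a-a)*(1-(a-a))\<^sup>2) * f' a - of_real ((1-(a-a))\<^sup>2 - 2*(a-a)*(1-(a-a))) * f a) \<le> K * s"
      unfolding s_def
    proof (rule initial_value_le_of_test_function[OF f, where g = "\<lambda>t. (t-a)*(1-(t-a))\<^sup>2"
          and g' = "\<lambda>t. (1-(t-a))\<^sup>2 - 2*(t-a)*(1-(t-a))" and g'' = "\<lambda>t. -4*(1-(t-a)) + 2*(t-a)"])
      fix t assume t: "t \<in> {a..a+1}"
      have "\<bar>(1-(t-a))\<^sup>2\<bar> \<le> 1" using t by (auto simp: abs_square_le_1)
      hence "\<bar>(t-a)*(1-(t-a))\<^sup>2\<bar> \<le> 1" using t unfolding abs_mult by (intro mult_le_one) auto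
      thus "\<bar>-4*(1-(t-a)) + 2*(t-a)\<bar> + cmod (of_real (q t) - z) * \<bar>(t-a)*(1-(t-a))\<^sup>2\<bar> \<le> K"
        using t by (intro Kb t) auto
    qed (auto intro!: derivative_eq_intros simp: algebra_simps power2_eq_square)
    have fa: "cmod (f a) \<le> K * s" using 2 by simp
    have "cmod (f' a) \<le> cmod (f' a + 2 * f a) + 2 * cmod (f a)"
      using norm_triangle_ineq4[of "f' a + 2 * f a" "2 * f a"] by (simp add: norm_mult)
    also have "\<dots> \<le> K * s + 2 * (K * s)" using 1 fa by (intro add_mono) auto
    finally have fa': "cmod (f' a) \<le> 3 * (K * s)" by simp
    have "0 \<le> integral {a..a+1} (\<lambda>t. (cmod (f t) - s)\<^sup>2)"
      by (intro Henstock_Kurzweil_Integration.integral_nonneg ray_integrable continuous_intros fc) auto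
    also have "(\<lambda>t. (cmod (f t) - s)\<^sup>2) = (\<lambda>t. (cmod (f t))\<^sup>2 - 2 * s * cmod (f t) + s\<^sup>2)"
      by (auto simp: power2_diff algebra_simps)
    also have "integral {a..a+1} \<dots> = L2_sq f (a+1) - 2 * s * s + s\<^sup>2"
    proof -
      have i: "(\<lambda>t. (cmod (f t))\<^sup>2) integrable_on {a..a+1}" "(\<lambda>t. 2 * s * cmod (f t)) integrable_on {a..a+1}"
        by (intro ray_integrable continuous_intros fc)+
      have "integral {a..a+1} (\<lambda>t. 2 * s * cmod (f t)) = 2 * s * s"
        unfolding s_def by (rule integral_mult_right)
      thus ?thesis
        using i by (subst integral_add) (auto intro!: integrable_diff simp: integral_diff L2_sq_def)
    qed
    finally have s: "s\<^sup>2 \<le> L2_sq f (a+1)" by (simp add: power2_eq_square)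
    have "(cmod (f a))\<^sup>2 + (cmod (f' a))\<^sup>2 \<le> (K * s)\<^sup>2 + (3*(K * s))\<^sup>2"
      using fa fa' by (intro add_mono power_mono) auto
    also have "\<dots> = 10 * K\<^sup>2 * s\<^sup>2" by (simp add: power_mult_distrib)
    also have "\<dots> \<le> 10 * K\<^sup>2 * L2_sq f (a+1)" using s by (intro mult_left_mono) auto
    finally show "1 / (10 * K\<^sup>2) * ((cmod (f a))\<^sup>2 + (cmod (f' a))\<^sup>2) \<le> L2_sq f (a+1)"
      using K0 by (simp add: divide_simps mult_ac)
  qed
qed

text \<open>The Titchmarsh--Weyl function of \<open>[a, x]\<close> with a Dirichlet condition at \<open>x\<close>.\<close>
definition m_fin :: "real \<Rightarrow> complex \<Rightarrow> complex" where
  "m_fin x z = - u z x / v z x"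

lemmas u_cont = sol_cont(1)[OF sol_u(1)]
lemmas v_cont = sol_cont(1)[OF sol_v(1)]

lemma v_nonzero:
  assumes z: "Im z > 0" and x: "x \<ge> a + 1"
  shows "v z x \<noteq> 0"
proof
  assume v0: "v z x = 0"
  have "Im z * L2_sq (v z) x = 0"
    using energy_identity[OF sol_v(1), of x z] x v0 by (simp add: sol_v)
  hence "L2_sq (v z) x = 0" using z by simp
  moreover obtain \<kappa> where "\<kappa> > 0" "\<kappa> * ((cmod (v z a))\<^sup>2 + (cmod (v' z a))\<^sup>2) \<le> L2_sq (v z) (a+1)"
    using L2_sq_coercive[of "cmod z"] sol_v(1) order_refl by metis
  ultimately show False using L2_sq_mono[OF v_cont x, of z] by (simp add: sol_v)
qed

text \<open>
  The energy identity for \<open>u + m v\<close>, which vanishes at \<open>x\<close> when \<open>m = m_fin x z\<close>.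
\<close>
lemma m_fin_identity:
  assumes z: "Im z > 0" and x: "x \<ge> a + 1"
  shows "Im (m_fin x z) = Im z * L2_sq (\<lambda>t. u z t + m_fin x z * v z t) x"
proof -
  have s: "sol z (\<lambda>t. 1 * u z t + m_fin x z * v z t) (\<lambda>t. 1 * u' z t + m_fin x z * v' z t)"
    by (rule sol_lincomb[OF sol_u(1) sol_v(1)])
  have "u z x + m_fin x z * v z x = 0" using v_nonzero[OF z x] by (simp add: m_fin_def)
  thus ?thesis using energy_identity[OF s, of x] x by (simp add: sol_u sol_v)
qed

text \<open>
  This single inequality carries all bounds on \<open>m_fin\<close> that are uniform in the length of the
  interval: it bounds \<open>Im m\<close> from below by a multiple of \<open>Im z\<close> and \<open>|m|\<close> from above by a multiple of
  \<open>1 / Im z\<close>.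
\<close>
lemma m_fin_coercive:
  obtains \<kappa> where "\<kappa> > 0"
    "\<And>x z. cmod z \<le> R \<Longrightarrow> Im z > 0 \<Longrightarrow> x \<ge> a + 1 \<Longrightarrow> \<kappa> * Im z * (1 + (cmod (m_fin x z))\<^sup>2) \<le> Im (m_fin x z)"
proof -
  obtain \<kappa> where k: "\<kappa> > 0"
    "\<And>z f f'. cmod z \<le> R \<Longrightarrow> sol z f f' \<Longrightarrow> \<kappa> * ((cmod (f a))\<^sup>2 + (cmod (f' a))\<^sup>2) \<le> L2_sq f (a+1)"
    using L2_sq_coercive by blast
  show ?thesis
  proof (rule that[OF k(1)])
    fix x z assume z: "cmod z \<le> R" "Im z > 0" and x: "x \<ge> a + 1"
    let ?f = "\<lambda>t. 1 * u z t + m_fin x z * v z t"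
    have s: "sol z ?f (\<lambda>t. 1 * u' z t + m_fin x z * v' z t)"
      by (rule sol_lincomb[OF sol_u(1) sol_v(1)])
    have "\<kappa> * (1 + (cmod (m_fin x z))\<^sup>2) \<le> L2_sq ?f (a+1)" using k(2)[OF z(1) s] by (simp add: sol_u sol_v)
    also have "\<dots> \<le> L2_sq ?f x" by (rule L2_sq_mono[OF sol_cont(1)[OF s] x])
    finally have "Im z * (\<kappa> * (1 + (cmod (m_fin x z))\<^sup>2)) \<le> Im z * L2_sq ?f x" using z by (intro mult_left_mono) auto
    thus "\<kappa> * Im z * (1 + (cmod (m_fin x z))\<^sup>2) \<le> Im (m_fin x z)"
      using m_fin_identity[OF z(2) x] by (simp add: mult_ac)
  qed
qed

lemma m_fin_bounds:
  assumes k: "\<kappa> > 0" and z: "Im z > 0" and c: "\<kappa> * Im z * (1 + (cmod m)\<^sup>2) \<le> Im m"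
  shows "\<kappa> * Im z \<le> Im m" "cmod m \<le> 1 / (\<kappa> * Im z)"
proof -
  have kz: "\<kappa> * Im z > 0" using k z by simp
  have "\<kappa> * Im z * 1 \<le> \<kappa> * Im z * (1 + (cmod m)\<^sup>2)" using kz by (intro mult_left_mono) auto
  thus "\<kappa> * Im z \<le> Im m" using c by simp
  hence m0: "cmod m > 0" using kz abs_Im_le_cmod[of m] by linarith
  have "\<kappa> * Im z * (cmod m)\<^sup>2 \<le> \<kappa> * Im z * (1 + (cmod m)\<^sup>2)" using kz by (intro mult_left_mono) auto
  also have "\<dots> \<le> cmod m" using c abs_Im_le_cmod[of m] by linarith
  finally have "\<kappa> * Im z * cmod m \<le> 1" using m0 by (simp add: power2_eq_square)
  thus "cmod m \<le> 1 / (\<kappa> * Im z)" using kz by (simp add: field_simps)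
qed

text \<open>
  Both \<open>u + m_fin x z v\<close> and \<open>u + m_fin y z v\<close> have square norm at most \<open>N\<close> on \<open>[a, x]\<close> for \<open>y \<ge> x\<close>, so
  \<open>|m_fin x z - m_fin y z|\<^sup>2\<close> is at most \<open>4 N\<close> divided by the square norm of \<open>v\<close> over \<open>[a, x]\<close>.
  In the limit point case the latter is unbounded: if \<open>v\<close> were square integrable, the
  bounds on \<open>u + m_fin x z v\<close> and on \<open>m_fin x z\<close> would make \<open>u\<close> square integrable too.
\<close>
lemma m_fin_tendsto_weyl_m:
  assumes lp: "limit_point_at_infinity q a" and z: "Im z > 0"
  shows "((\<lambda>x. m_fin x z) \<longlongrightarrow> weyl_m q a z) at_top" "Im (weyl_m q a z) > 0"
proof -
  obtain \<kappa> where k: "\<kappa> > 0" "\<And>x. x \<ge> a + 1 \<Longrightarrow> \<kappa> * Im z * (1 + (cmod (m_fin x z))\<^sup>2) \<le> Im (m_fin x z)"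
    using m_fin_coercive[of "cmod z"] z order_refl by metis
  define M where "M = 1 / (\<kappa> * Im z)"
  have M0: "M > 0" using k z by (simp add: M_def)
  have mM: "cmod (m_fin x z) \<le> M" if "x \<ge> a + 1" for x
    using m_fin_bounds(2)[OF k(1) z k(2)[OF that]] by (simp add: M_def)
  define N where "N = M / Im z"
  have N0: "N > 0" using M0 z by (simp add: N_def)
  have c: "continuous_on {a..} (\<lambda>t. u z t + m * v z t)" for m
    by (intro continuous_intros u_cont v_cont)
  have nN: "L2_sq (\<lambda>t. u z t + m_fin x z * v z t) x \<le> N" if "x \<ge> a + 1" for x
    using m_fin_identity[OF z that] mM[OF that] abs_Im_le_cmod[of "m_fin x z"] z
    by (simp add: N_def field_simps)
  have nN': "L2_sq (\<lambda>t. u z t + m_fin y z * v z t) x \<le> N" if "x \<ge> a + 1" "x \<le> y" for x y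
    using L2_sq_mono[OF c that(2), of "m_fin y z"] nN[of y] that by simp
  have vL2: "\<not> in_L2 a (v z)"
  proof
    assume "in_L2 a (v z)"
    then obtain V where V: "\<And>x. x \<ge> a \<Longrightarrow> L2_sq (v z) x \<le> V" using in_L2_iff_L2_sq_bounded[OF v_cont] by blast
    have ub: "L2_sq (u z) x \<le> 2 * N + 2 * M\<^sup>2 * V" if "x \<ge> a" for x
    proof -
      let ?x = "max x (a+1)"
      have "L2_sq (u z) x \<le> L2_sq (u z) ?x" by (rule L2_sq_mono[OF u_cont]) auto
      also have "\<dots> = L2_sq (\<lambda>t. (u z t + m_fin ?x z * v z t) + (- m_fin ?x z) * v z t) ?x" by simp
      also have "\<dots> \<le> 2 * L2_sq (\<lambda>t. u z t + m_fin ?x z * v z t) ?x + 2 * (cmod (- m_fin ?x z))\<^sup>2 * L2_sq (v z) ?x"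
        by (rule L2_sq_lincomb_le[OF c v_cont])
      also have "\<dots> \<le> 2 * N + 2 * M\<^sup>2 * V"
        using that nN[of ?x] mM[of ?x] V[of ?x] L2_sq_nonneg[of _ ?x]
        by (intro add_mono mult_mono power_mono) auto
      finally show ?thesis .
    qed
    have "in_L2 a y" if y: "sol z y y'" for y y'
    proof -
      have "L2_sq y x \<le> 2 * ((cmod (y a))\<^sup>2 * (2 * N + 2 * M\<^sup>2 * V)) + 2 * (cmod (y' a))\<^sup>2 * V" if x: "x \<ge> a" for x
      proof -
        have "L2_sq y x = L2_sq (\<lambda>t. y a * u z t + y' a * v z t) x"
          unfolding L2_sq_def
            by (intro integral_cong arg_cong[where f = "\<lambda>w. (cmod w)\<^sup>2"] sol_eq_uv[OF y]) simp
        also have "\<dots> \<le> 2 * L2_sq (\<lambda>t. y a * u z t) x + 2 * (cmod (y' a))\<^sup>2 * L2_sq (v z) x"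
          by (rule L2_sq_lincomb_le) (intro continuous_intros u_cont v_cont)+
        also have "\<dots> \<le> 2 * ((cmod (y a))\<^sup>2 * (2 * N + 2 * M\<^sup>2 * V)) + 2 * (cmod (y' a))\<^sup>2 * V"
          unfolding L2_sq_cmult using ub[OF x] V[OF x] by (intro add_mono mult_left_mono) auto
        finally show ?thesis .
      qed
      thus ?thesis using in_L2_iff_L2_sq_bounded[OF sol_cont(1)[OF y]] by blast
    qed
    thus False using lp unfolding limit_point_at_infinity_def by blast
  qed
  have vbig: "\<forall>\<^sub>F x in at_top. L2_sq (v z) x \<ge> B" for B
  proof -
    obtain x0 where x0: "x0 \<ge> a" "L2_sq (v z) x0 > B"
      using vL2 in_L2_iff_L2_sq_bounded[OF v_cont] by (meson not_le)
    show ?thesis using eventually_ge_at_top[of x0]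
    proof eventually_elim
      case (elim x)
      show ?case using L2_sq_mono[OF v_cont elim, of z] x0(2) by linarith
    qed
  qed
  have close: "(cmod (m - l))\<^sup>2 * L2_sq (v z) x \<le> 4 * N"
    if "L2_sq (\<lambda>t. u z t + m * v z t) x \<le> N" "L2_sq (\<lambda>t. u z t + l * v z t) x \<le> N" for m l x
  proof -
    have "(cmod (m - l))\<^sup>2 * L2_sq (v z) x = L2_sq (\<lambda>t. (u z t + m * v z t) + (-1) * (u z t + l * v z t)) x"
      by (subst L2_sq_cmult[symmetric]) (simp add: algebra_simps)
    also have "\<dots> \<le> 2 * L2_sq (\<lambda>t. u z t + m * v z t) x + 2 * (cmod (-1))\<^sup>2 * L2_sq (\<lambda>t. u z t + l * v z t) x"
      by (rule L2_sq_lincomb_le[OF c c])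
    finally show ?thesis using that by simp
  qed
  have closeD: "cmod (m - l) < e"
    if "(cmod (m - l))\<^sup>2 * L2_sq (v z) x \<le> 4 * N" "L2_sq (v z) x \<ge> 5 * N / e\<^sup>2" "e > 0" for m l x e
  proof (rule ccontr)
    assume "\<not> cmod (m - l) < e"
    hence "e\<^sup>2 \<le> (cmod (m - l))\<^sup>2" using that by (intro power_mono) auto
    hence "e\<^sup>2 * (5 * N / e\<^sup>2) \<le> (cmod (m - l))\<^sup>2 * L2_sq (v z) x"
      using that N0 by (intro mult_mono) auto
    thus False using that N0 by simp
  qed
  have "Cauchy (\<lambda>n. m_fin (a + 1 + real n) z)"
  proof (rule metric_CauchyI)
    fix e :: real assume e: "e > 0"
    have "\<forall>\<^sub>F x in at_top. L2_sq (v z) x \<ge> 5 * N / e\<^sup>2" by (rule vbig)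
    then obtain x0 where x0: "\<And>x. x \<ge> x0 \<Longrightarrow> L2_sq (v z) x \<ge> 5 * N / e\<^sup>2" by (auto simp: eventually_at_top_linorder)
    obtain n0 where n0: "x0 - a - 1 \<le> real n0" using real_arch_simple by blast
    have "dist (m_fin (a + 1 + real m) z) (m_fin (a + 1 + real n) z) < e" if "m \<ge> n0" "n \<ge> n0" for m n
    proof -
      let ?x = "a + 1 + real n0"
      show ?thesis unfolding dist_norm
        by (rule closeD[where x = ?x, OF close[OF nN' nN'] x0 e]) (use that n0 in auto)
    qed
    thus "\<exists>M. \<forall>m\<ge>M. \<forall>n\<ge>M. dist (m_fin (a + 1 + real m) z) (m_fin (a + 1 + real n) z) < e" by blast
  qed
  then obtain l where l: "(\<lambda>n. m_fin (a + 1 + real n) z) \<longlonglongrightarrow> l"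
    using Cauchy_convergent_iff convergent_def by blast
  have lx: "(cmod (m_fin x z - l))\<^sup>2 * L2_sq (v z) x \<le> 4 * N" if x: "x \<ge> a + 1" for x
  proof (rule tendsto_upperbound)
    show "(\<lambda>n. (cmod (m_fin x z - m_fin (a + 1 + real n) z))\<^sup>2 * L2_sq (v z) x) \<longlonglongrightarrow> (cmod (m_fin x z - l))\<^sup>2 * L2_sq (v z) x"
      by (intro tendsto_intros l)
    obtain n0 where n0: "x - a - 1 \<le> real n0" using real_arch_simple by blast
    show "\<forall>\<^sub>F n in sequentially. (cmod (m_fin x z - m_fin (a + 1 + real n) z))\<^sup>2 * L2_sq (v z) x \<le> 4 * N"
      using eventually_ge_at_top[of n0]
    proof eventually_elim
      case (elim n)
      hence "real n0 \<le> real n" by simp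
      hence "x \<le> a + 1 + real n" using n0 by linarith
      thus ?case by (intro close nN nN' x)
    qed
  qed simp
  have lim: "((\<lambda>x. m_fin x z) \<longlongrightarrow> l) at_top"
  proof (rule tendstoI)
    fix e :: real assume e: "e > 0"
    show "\<forall>\<^sub>F x in at_top. dist (m_fin x z) l < e"
      using vbig[of "5 * N / e\<^sup>2"] eventually_ge_at_top[of "a+1"]
      by eventually_elim (auto simp: dist_norm intro!: closeD[OF lx] e)
  qed
  have lL2: "in_L2 a (\<lambda>t. u z t + l * v z t)"
  proof -
    have "L2_sq (\<lambda>t. u z t + l * v z t) x \<le> 10 * N" if "x \<ge> a" for x
    proof -
      let ?x = "max x (a+1)"
      have "L2_sq (\<lambda>t. u z t + l * v z t) x \<le> L2_sq (\<lambda>t. u z t + l * v z t) ?x" by (rule L2_sq_mono[OF c]) auto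
      also have "\<dots> = L2_sq (\<lambda>t. (u z t + m_fin ?x z * v z t) + (l - m_fin ?x z) * v z t) ?x" by (simp add: algebra_simps)
      also have "\<dots> \<le> 2 * L2_sq (\<lambda>t. u z t + m_fin ?x z * v z t) ?x + 2 * (cmod (l - m_fin ?x z))\<^sup>2 * L2_sq (v z) ?x"
        by (rule L2_sq_lincomb_le[OF c v_cont])
      also have "\<dots> \<le> 2 * N + 2 * (4 * N)"
        using nN[of ?x] lx[of ?x, unfolded norm_minus_commute[of _ l]] unfolding mult.assoc
        by (intro add_mono mult_left_mono) auto
      finally show ?thesis by simp
    qed
    thus ?thesis using in_L2_iff_L2_sq_bounded[OF c] by blast
  qed
  have "weyl_m q a z = l" unfolding weyl_m_def
  proof (rule the_equality)
    show "in_L2 a (\<lambda>t. u z t + l * v z t)" by (fact lL2)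
    fix m assume mL2: "in_L2 a (\<lambda>t. u z t + m * v z t)"
    show "m = l"
    proof (rule ccontr)
      assume ne: "m \<noteq> l"
      obtain K1 K2 where K: "\<And>x. x \<ge> a \<Longrightarrow> L2_sq (\<lambda>t. u z t + m * v z t) x \<le> K1"
        "\<And>x. x \<ge> a \<Longrightarrow> L2_sq (\<lambda>t. u z t + l * v z t) x \<le> K2"
        using mL2 lL2 in_L2_iff_L2_sq_bounded[OF c] by metis
      have "L2_sq (v z) x \<le> (2 * K1 + 2 * K2) / (cmod (m - l))\<^sup>2" if "x \<ge> a" for x
      proof -
        have "(cmod (m - l))\<^sup>2 * L2_sq (v z) x = L2_sq (\<lambda>t. (u z t + m * v z t) + (-1) * (u z t + l * v z t)) x"
          by (subst L2_sq_cmult[symmetric]) (simp add: algebra_simps)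
        also have "\<dots> \<le> 2 * L2_sq (\<lambda>t. u z t + m * v z t) x + 2 * (cmod (-1))\<^sup>2 * L2_sq (\<lambda>t. u z t + l * v z t) x"
          by (rule L2_sq_lincomb_le[OF c c])
        also have "\<dots> \<le> 2 * K1 + 2 * K2" using K[OF that] by simp
        finally show ?thesis using ne by (simp add: field_simps)
      qed
      thus False using vL2 in_L2_iff_L2_sq_bounded[OF v_cont] by blast
    qed
  qed
  with lim show "((\<lambda>x. m_fin x z) \<longlongrightarrow> weyl_m q a z) at_top" by simp
  have "\<kappa> * Im z \<le> Im (weyl_m q a z)"
  proof (rule tendsto_lowerbound)
    show "((\<lambda>x. Im (m_fin x z)) \<longlongrightarrow> Im (weyl_m q a z)) at_top" by (intro tendsto_intros) fact
    show "\<forall>\<^sub>F x in at_top. \<kappa> * Im z \<le> Im (m_fin x z)"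
      using eventually_ge_at_top[of "a+1"]
      by eventually_elim (rule m_fin_bounds(1)[OF k(1) z k(2)])
  qed simp
  thus "Im (weyl_m q a z) > 0" using k z by (meson less_le_trans mult_pos_pos)
qed

lemma m_fin_holomorphic:
  assumes "x \<ge> a + 1" shows "m_fin x holomorphic_on {z. Im z > 0}"
  unfolding m_fin_def
  by (intro holomorphic_intros uv_holomorphic) (use assms v_nonzero in auto)

end

section \<open>The argument of points in the closed upper half-plane\<close>

text \<open>
  On the closed upper half-plane without \<open>0\<close> this is the principal argument.  The formula with
  \<open>arccos\<close> makes it continuous up to the negative real axis and measurable on the whole plane.
\<close>
definition ang :: "complex \<Rightarrow> real" where "ang z = arccos (Re z / cmod z)"

lemma Re_div_cmod_bounds: "-1 \<le> Re z / cmod z" "Re z / cmod z \<le> 1"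
proof -
  have "\<bar>Re z / cmod z\<bar> \<le> 1"
    using abs_Re_le_cmod[of z] by (cases "z = 0") (auto simp: abs_divide divide_le_eq)
  thus "-1 \<le> Re z / cmod z" "Re z / cmod z \<le> 1" by linarith+
qed

lemma ang_bounds: "0 \<le> ang z" "ang z \<le> pi"
  unfolding ang_def by (intro arccos_lbound arccos_ubound Re_div_cmod_bounds)+

lemma ang_continuous: "continuous_on (- {0}) ang"
  unfolding ang_def
  by (intro continuous_on_arccos continuous_intros) (use Re_div_cmod_bounds in \<open>auto simp: minus_divide_left\<close>)

lemma isCont_ang: "z \<noteq> 0 \<Longrightarrow> isCont ang z"
  using ang_continuous by (simp add: continuous_on_eq_continuous_at open_Compl)

lemma ang_measurable [measurable]: "ang \<in> borel_measurable borel"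
proof -
  have "(\<lambda>z. if z \<in> {0} then ang 0 else ang z) \<in> borel_measurable borel"
    by (rule borel_measurable_continuous_on_if[OF _ _ ang_continuous]) auto
  moreover have "(\<lambda>z. if z \<in> {0} then ang 0 else ang z) = ang" by auto
  ultimately show ?thesis by simp
qed

lemma cos_ang: "cos (ang z) = Re z / cmod z"
  unfolding ang_def by (intro cos_arccos Re_div_cmod_bounds)

lemma sin_ang: assumes "Im z \<ge> 0" "z \<noteq> 0" shows "sin (ang z) = Im z / cmod z"
proof -
  have "(Re z)\<^sup>2 + (Im z)\<^sup>2 \<noteq> 0" using assms by (simp add: complex_eq_iff sum_power2_eq_zero_iff)
  hence "1 - (Re z / cmod z)\<^sup>2 = (Im z / cmod z)\<^sup>2"
    by (simp add: power_divide cmod_power2 field_simps)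
  thus ?thesis unfolding ang_def using assms by (simp add: sin_arccos Re_div_cmod_bounds)
qed

lemma ang_polar: "Im z \<ge> 0 \<Longrightarrow> z = of_real (cmod z) * cis (ang z)"
  by (cases "z = 0") (auto simp: complex_eq_iff cos_ang sin_ang)

lemma ang_rcis: assumes "r > 0" "0 \<le> t" "t \<le> pi" shows "ang (of_real r * cis t) = t"
  using assms by (simp add: ang_def norm_mult arccos_cos)

lemma ang_of_real: "r \<noteq> 0 \<Longrightarrow> ang (of_real r) = (if r < 0 then pi else 0)"
  by (auto simp: ang_def)

lemma ang_pos_lt_pi:
  assumes "Im z > 0" shows "0 < ang z" "ang z < pi"
proof -
  have "z \<noteq> 0" using assms by auto
  hence "sin (ang z) > 0" using assms by (simp add: sin_ang)
  hence "ang z \<noteq> 0" "ang z \<noteq> pi" by auto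
  thus "0 < ang z" "ang z < pi" using ang_bounds[of z] by auto
qed

lemma Im_Ln_eq_ang:
  assumes "Im z > 0" shows "Im (Ln z) = ang z"
proof -
  have z: "z \<noteq> 0" using assms by auto
  have "Ln z = Complex (ln (cmod z)) (ang z)"
  proof (rule Ln_unique)
    show "exp (Complex (ln (cmod z)) (ang z)) = z"
      using z ang_polar[of z] assms by (simp add: exp_eq_polar)
  qed (use ang_pos_lt_pi[OF assms] in auto)
  thus ?thesis by simp
qed

lemma sin_diff_ang:
  assumes "Im p > 0"
  shows "cmod p * sin (c - ang p) = sin c * Re p - cos c * Im p"
proof -
  have "p \<noteq> 0" using assms by auto
  thus ?thesis using assms by (simp add: sin_diff cos_ang sin_ang field_simps)
qed

text \<open>Comparing an argument with a constant is a linear condition on the point.\<close>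
lemma ang_less_iff:
  assumes p: "Im p > 0" and c: "0 \<le> c" "c \<le> pi"
  shows "ang p < c \<longleftrightarrow> sin c * Re p - cos c * Im p > 0"
    and "ang p \<le> c \<longleftrightarrow> sin c * Re p - cos c * Im p \<ge> 0"
proof -
  have p0: "cmod p > 0" using p by auto
  note b = ang_pos_lt_pi[OF p]
  have 1: "sin (c - ang p) > 0" if "ang p < c" using that b c by (intro sin_gt_zero) auto
  have 2: "sin (c - ang p) < 0" if "ang p > c"
    using sin_gt_zero[of "ang p - c"] that b c by (simp add: sin_diff mult.commute)
  have 3: "sin (c - ang p) = 0" if "ang p = c" using that by simp
  show "ang p < c \<longleftrightarrow> sin c * Re p - cos c * Im p > 0"
    unfolding sin_diff_ang[OF p, symmetric] using 1 2 3 p0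
    by (metis linorder_neqE_linordered_idom mult_pos_pos not_less_iff_gr_or_eq zero_less_mult_pos)
  show "ang p \<le> c \<longleftrightarrow> sin c * Re p - cos c * Im p \<ge> 0"
    unfolding sin_diff_ang[OF p, symmetric] using 1 2 3 p0
    by (smt (verit) mult_pos_pos mult_nonneg_nonneg mult_pos_neg)
qed

section \<open>Boundary values of Herglotz functions\<close>

lemma dominated_convergence_ae:
  fixes f :: "nat \<Rightarrow> real \<Rightarrow> real"
  assumes f: "\<And>k. f k integrable_on {\<alpha>..\<beta>}" and B: "\<And>k x. \<bar>f k x\<bar> \<le> B" and N: "negligible N"
    and lim: "\<And>x. x \<in> {\<alpha>..\<beta>} - N \<Longrightarrow> (\<lambda>k. f k x) \<longlonglongrightarrow> g x"
  shows "g integrable_on {\<alpha>..\<beta>}" "(\<lambda>k. integral {\<alpha>..\<beta>} (f k)) \<longlonglongrightarrow> integral {\<alpha>..\<beta>} g"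
proof -
  define f' where "f' k x = (if x \<in> N then 0 else f k x)" for k x
  define g' where "g' x = (if x \<in> N then 0 else g x)" for x
  have B0: "B \<ge> 0" using B[of 0 0] by linarith
  have f': "f' k integrable_on {\<alpha>..\<beta>}" "integral {\<alpha>..\<beta>} (f' k) = integral {\<alpha>..\<beta>} (f k)" for k
    by (rule integrable_spike[OF f N]; simp add: f'_def) (rule integral_spike[OF N]; simp add: f'_def)
  have 1: "g' integrable_on {\<alpha>..\<beta>}" and 2: "(\<lambda>k. integral {\<alpha>..\<beta>} (f' k)) \<longlonglongrightarrow> integral {\<alpha>..\<beta>} g'"
    by (rule dominated_convergence[of f' _ "\<lambda>_. B"];
        use f' B B0 lim in \<open>auto simp: f'_def g'_def\<close>)+
  show "g integrable_on {\<alpha>..\<beta>}" by (rule integrable_spike[OF 1 N]) (simp add: g'_def)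
  have "integral {\<alpha>..\<beta>} g' = integral {\<alpha>..\<beta>} g" by (rule integral_spike[OF N]) (simp add: g'_def)
  thus "(\<lambda>k. integral {\<alpha>..\<beta>} (f k)) \<longlonglongrightarrow> integral {\<alpha>..\<beta>} g" using 2 by (simp add: f'(2))
qed

text \<open>
  For a primitive \<open>\<Phi>\<close> of \<open>Ln F\<close>, the integral of \<open>arg F\<close> over a horizontal segment is the increment
  of \<open>Im \<Phi>\<close>.  Moving the segment from height \<open>s\<close> to height \<open>e\<close> changes it by increments of \<open>Im \<Phi>\<close>
  along two vertical segments, and there \<open>Im \<Phi>\<close> has derivative \<open>ln |F|\<close>.  A logarithmic bound on
  \<open>ln |F|\<close> is integrable down to the real axis, and the estimate involves \<open>F\<close> only through the
  constant \<open>L\<close>.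
\<close>
lemma boundary_layer:
  fixes F :: "complex \<Rightarrow> complex"
  assumes F: "F holomorphic_on {z. Im z > 0}" and Fpos: "\<And>z. Im z > 0 \<Longrightarrow> Im (F z) > 0"
    and ab: "\<alpha> \<le> \<beta>"
    and L: "\<And>\<sigma> t. \<sigma> \<in> {\<alpha>, \<beta>} \<Longrightarrow> 0 < t \<Longrightarrow> t \<le> 1 \<Longrightarrow> \<bar>ln (cmod (F (Complex \<sigma> t)))\<bar> \<le> L - ln t"
    and s: "0 < s" "s \<le> e" "e \<le> 1"
  shows "\<bar>integral {\<alpha>..\<beta>} (\<lambda>x. ang (F (Complex x s))) - integral {\<alpha>..\<beta>} (\<lambda>x. ang (F (Complex x e)))\<bar>
           \<le> 2 * (e * (L + 1 - ln e))"
proof -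
  define S where "S = {z. Im z > 0}"
  have S: "open S" "convex S" by (auto simp: S_def open_halfspace_Im_gt convex_halfspace_Im_gt)
  have "(\<lambda>z. Ln (F z)) holomorphic_on S"
    using F Fpos by (intro holomorphic_intros) (force simp: S_def complex_nonpos_Reals_iff)+
  then obtain \<Phi> where "\<And>z. z \<in> S \<Longrightarrow> (\<Phi> has_field_derivative Ln (F z)) (at z within S)"
    using holomorphic_convex_primitive'[OF S(2,1)] by blast
  hence \<Phi>: "(\<Phi> has_field_derivative Ln (F z)) (at z)" if "Im z > 0" for z
    using that S(1) at_within_open[of z S] by (metis S_def mem_Collect_eq)
  have chain: "((\<lambda>x. Im (\<Phi> (g x))) has_real_derivative Im (g' * Ln (F (g x)))) (at x)"
    if "(g has_vector_derivative g') (at x)" "Im (g x) > 0" for g g' x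
    using bounded_linear.has_vector_derivative[OF bounded_linear_Im
        field_vector_diff_chain_at[OF that(1) \<Phi>[OF that(2)]]]
    by (simp add: has_real_derivative_iff_has_vector_derivative o_def)
  have hor: "integral {\<alpha>..\<beta>} (\<lambda>x. ang (F (Complex x t))) = Im (\<Phi> (Complex \<beta> t)) - Im (\<Phi> (Complex \<alpha> t))"
    if t: "t > 0" for t
  proof (rule integral_unique, rule fundamental_theorem_of_calculus[OF ab])
    fix x
    have "((\<lambda>x. Complex x t) has_vector_derivative 1) (at x)"
      unfolding Complex_eq by (auto intro!: derivative_eq_intros)
    from chain[OF this] t have "((\<lambda>x. Im (\<Phi> (Complex x t))) has_real_derivative ang (F (Complex x t))) (at x)"
      by (simp add: Im_Ln_eq_ang Fpos)
    thus "((\<lambda>x. Im (\<Phi> (Complex x t))) has_vector_derivative ang (F (Complex x t))) (at x within {\<alpha>..\<beta>})"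
      by (simp add: has_real_derivative_iff_has_vector_derivative has_vector_derivative_at_within)
  qed
  \<comment> \<open>the antiderivative of \<open>L - ln t\<close> that vanishes at \<open>0\<close>\<close>
  define b where "b t = t * (L + 1 - ln t)" for t
  have b': "(b has_real_derivative (L - ln t)) (at t)" if "t > 0" for t
    unfolding b_def using that by (auto intro!: derivative_eq_intros simp: field_simps)
  have ver: "\<bar>Im (\<Phi> (Complex \<sigma> e)) - Im (\<Phi> (Complex \<sigma> s))\<bar> \<le> b e" if \<sigma>: "\<sigma> \<in> {\<alpha>, \<beta>}" for \<sigma>
  proof -
    have d: "((\<lambda>t. Im (\<Phi> (Complex \<sigma> t))) has_real_derivative ln (cmod (F (Complex \<sigma> t)))) (at t)"
      if t: "t > 0" for t
    proof -
      have "((\<lambda>t. Complex \<sigma> t) has_vector_derivative \<i>) (at t)"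
        unfolding Complex_eq by (auto intro!: derivative_eq_intros)
      moreover have "F (Complex \<sigma> t) \<noteq> 0" using Fpos[of "Complex \<sigma> t"] t by auto
      ultimately show ?thesis using chain[of "\<lambda>t. Complex \<sigma> t" \<i> t] t by simp
    qed
    have m: "b s + r * Im (\<Phi> (Complex \<sigma> s)) \<le> b e + r * Im (\<Phi> (Complex \<sigma> e))" if r: "r = 1 \<or> r = -1" for r
    proof (rule DERIV_nonneg_imp_nondecreasing[OF s(2)])
      fix t assume "s \<le> t" "t \<le> e"
      hence t: "t > 0" "t \<le> 1" using s by auto
      have "((\<lambda>t. b t + r * Im (\<Phi> (Complex \<sigma> t))) has_real_derivative
          (L - ln t) + r * ln (cmod (F (Complex \<sigma> t)))) (at t)"
        by (intro DERIV_add DERIV_cmult b' d t)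
      moreover have "(L - ln t) + r * ln (cmod (F (Complex \<sigma> t))) \<ge> 0"
        using L[OF \<sigma> t] r by auto
      ultimately show "\<exists>y. ((\<lambda>t. b t + r * Im (\<Phi> (Complex \<sigma> t))) has_real_derivative y) (at t) \<and> 0 \<le> y"
        by blast
    qed
    have "L - ln s \<ge> 0" using L[OF \<sigma> s(1)] s by linarith
    hence "b s \<ge> 0" using s by (simp add: b_def)
    thus ?thesis using m[of 1] m[of "-1"] by (simp add: abs_le_iff)
  qed
  show ?thesis
    using ver[of \<alpha>] ver[of \<beta>] s by (simp add: hor b_def)
qed

section \<open>The distribution of the solution angle for constant thresholds\<close>

context sturm_liouville begin

text \<open>
  The angle of the line through \<open>(u, v)\<close>, that is, the \<open>t\<close> between \<open>0\<close> and \<open>pi\<close> with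
  \<open>cot t = u / v\<close>.  Where \<open>v = 0\<close> the quotient defaults to \<open>0\<close> and the value is meaningless; for
  each \<open>x > a\<close> this concerns only a null set of spectral parameters.
\<close>
definition phi :: "real \<Rightarrow> real \<Rightarrow> real" where
  "phi x lam = ang (Complex (Re (u (of_real lam) x) / Re (v (of_real lam) x)) 1)"

text \<open>
  On the real axis, where \<open>v \<noteq> 0\<close>, one has \<open>m_fin x = - cot (phi x)\<close>.  So for \<open>0 < c < pi\<close> this function is
  negative there exactly where \<open>phi x < c\<close>, and off its zeros its argument is \<open>pi\<close> times the
  indicator of that set.
\<close>
definition m_rot :: "real \<Rightarrow> real \<Rightarrow> complex \<Rightarrow> complex" where
  "m_rot c x z = of_real (cos c) + m_fin x z * of_real (sin c)"

lemma m_rot_Im_pos: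
  assumes "0 < c" "c < pi" "x \<ge> a + 1" "Im z > 0"
  shows "Im (m_rot c x z) > 0"
proof -
  obtain \<kappa> where "\<kappa> > 0" "\<kappa> * Im z * (1 + (cmod (m_fin x z))\<^sup>2) \<le> Im (m_fin x z)"
    using m_fin_coercive[of "cmod z"] assms order_refl by metis
  hence "Im (m_fin x z) > 0" using m_fin_bounds(1)[of \<kappa> z "m_fin x z"] assms
    by (meson less_le_trans mult_pos_pos)
  thus ?thesis using sin_gt_zero assms by (simp add: m_rot_def)
qed

lemma m_rot_holomorphic: "x \<ge> a + 1 \<Longrightarrow> m_rot c x holomorphic_on {z. Im z > 0}"
  unfolding m_rot_def by (intro holomorphic_intros m_fin_holomorphic)

text \<open>The coercivity of \<open>m_fin\<close> gives \<open>const * t \<le> |m_rot| \<le> const / t\<close> at height \<open>t\<close>, uniformly in \<open>x\<close>.\<close>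
lemma m_rot_log_bound:
  assumes c: "0 < c" "c < pi"
  obtains L where "\<And>x lam t. x \<ge> a + 1 \<Longrightarrow> \<bar>lam\<bar> \<le> R \<Longrightarrow> 0 < t \<Longrightarrow> t \<le> 1 \<Longrightarrow>
     \<bar>ln (cmod (m_rot c x (Complex lam t)))\<bar> \<le> L - ln t"
proof -
  have sc: "sin c > 0" using c by (rule sin_gt_zero)
  obtain \<kappa> where k: "\<kappa> > 0"
    "\<And>x z. cmod z \<le> R + 1 \<Longrightarrow> Im z > 0 \<Longrightarrow> x \<ge> a + 1 \<Longrightarrow> \<kappa> * Im z * (1 + (cmod (m_fin x z))\<^sup>2) \<le> Im (m_fin x z)"
    using m_fin_coercive by blast
  define L where "L = max \<bar>ln (sin c * \<kappa>)\<bar> (ln (1 + 1 / \<kappa>))"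
  show ?thesis
  proof (rule that[of L])
    fix x lam t assume x: "x \<ge> a + 1" and lam: "\<bar>lam\<bar> \<le> R" and t: "0 < t" "t \<le> (1::real)"
    define z where "z = Complex lam t"
    have z: "cmod z \<le> R + 1" "Im z > 0"
      using cmod_le[of z] lam t by (auto simp: z_def)
    note b = m_fin_bounds[OF k(1) z(2) k(2)[OF z x]]
    have "sin c * \<kappa> * t \<le> Im (m_rot c x z)"
      using mult_left_mono[OF b(1), of "sin c"] sc by (simp add: m_rot_def z_def mult_ac)
    also have "\<dots> \<le> cmod (m_rot c x z)" using abs_Im_le_cmod[of "m_rot c x z"] by linarith
    finally have lo: "sin c * \<kappa> * t \<le> cmod (m_rot c x z)" .
    have pos: "sin c * \<kappa> * t > 0" using sc k t by simp
    have "cmod (m_rot c x z) \<le> \<bar>cos c\<bar> + cmod (m_fin x z) * \<bar>sin c\<bar>"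
      unfolding m_rot_def by (rule order_trans[OF norm_triangle_ineq]) (simp add: norm_mult)
    also have "\<dots> \<le> 1 + 1 / (\<kappa> * t) * 1"
      using b(2) k t by (intro add_mono mult_mono) (auto simp: z_def)
    also have "\<dots> \<le> 1 / t + 1 / (\<kappa> * t)" using t by simp
    also have "\<dots> = (1 + 1 / \<kappa>) / t" using t k by (simp add: field_simps)
    finally have up: "cmod (m_rot c x z) \<le> (1 + 1 / \<kappa>) / t" .
    have hp: "cmod (m_rot c x z) > 0" using lo pos by linarith
    have "ln (cmod (m_rot c x z)) \<le> ln ((1 + 1 / \<kappa>) / t)" using up hp by (simp add: ln_mono)
    also have "\<dots> = ln (1 + 1 / \<kappa>) - ln t" using k t by (subst ln_divide_pos) (auto intro: add_pos_pos)
    finally have 1: "ln (cmod (m_rot c x z)) \<le> L - ln t" by (simp add: L_def)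
    have "ln (sin c * \<kappa>) + ln t = ln (sin c * \<kappa> * t)" using sc k t by (simp add: ln_mult)
    also have "\<dots> \<le> ln (cmod (m_rot c x z))" using lo pos hp by (simp add: ln_mono)
    finally have "ln (cmod (m_rot c x z)) \<ge> - L + ln t" by (simp add: L_def)
    with 1 show "\<bar>ln (cmod (m_rot c x (Complex lam t)))\<bar> \<le> L - ln t" by (simp add: z_def)
  qed
qed

text \<open>An entire function that is not identically zero has countably many zeros.\<close>
lemma negligible_real_zeros:
  assumes f: "f holomorphic_on UNIV" and z0: "f z0 \<noteq> 0"
  shows "negligible {lam :: real. f (of_real lam) = 0}"
proof -
  have "countable {z. f z = 0}"
  proof (cases "f constant_on UNIV")
    case True
    hence "{z. f z = 0} = {}" using z0 by (auto simp: constant_on_def)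
    thus ?thesis by simp
  next
    case False
    thus ?thesis using holomorphic_countable_zeros[OF f] by auto
  qed
  hence "countable {lam :: real. f (of_real lam) = 0}"
    by (intro countable_image_inj_on[of complex_of_real] countable_subset[of "of_real ` _" "{z. f z = 0}"])
       (auto simp: inj_on_def)
  thus ?thesis by (simp add: negligible_iff_null_sets countable_imp_null_set_lborel null_sets_completionI)
qed

lemma v_zeros_negligible: "x \<ge> a + 1 \<Longrightarrow> negligible {lam. v (of_real lam) x = 0}"
  by (rule negligible_real_zeros[OF uv_holomorphic(2), of x \<i>]) (use v_nonzero in auto)

lemma phi_indicator_limit:
  assumes c: "0 < c" "c < pi" and x: "x \<ge> a + 1"
  obtains N where "negligible N"
    "\<And>lam. lam \<notin> N \<Longrightarrow> ((\<lambda>s. ang (m_rot c x (Complex lam s))) \<longlongrightarrow> pi * (if phi x lam < c then 1 else 0)) (at_right 0)"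
proof (rule that)
  let ?N1 = "{lam :: real. v (of_real lam) x = 0}"
  let ?g = "\<lambda>z. of_real (cos c) * v z x - of_real (sin c) * u z x"
  let ?N2 = "{lam :: real. ?g (of_real lam) = 0}"
  have ax: "a \<le> x" using x by simp
  have "?g \<i> = v \<i> x * m_rot c x \<i>" using v_nonzero[of \<i> x] x by (simp add: m_rot_def m_fin_def field_simps)
  hence "?g \<i> \<noteq> 0" using v_nonzero[of \<i> x] x m_rot_Im_pos[OF c x, of \<i>] by auto
  hence "negligible ?N2" by (intro negligible_real_zeros holomorphic_intros uv_holomorphic ax)
  thus "negligible (?N1 \<union> ?N2)" using v_zeros_negligible[OF x] by simp
  fix lam assume "lam \<notin> ?N1 \<union> ?N2"
  hence v0: "v (of_real lam) x \<noteq> 0" and g0: "?g (of_real lam) \<noteq> 0" by auto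
  define U V where "U = Re (u (of_real lam) x)" and "V = Re (v (of_real lam) x)"
  have UV: "u (of_real lam) x = of_real U" "v (of_real lam) x = of_real V"
    using uv_real[OF ax, of lam] by (simp_all add: U_def V_def)
  have V0: "V \<noteq> 0" using v0 UV by auto
  define h where "h = cos c - sin c * (U / V)"
  have hxl: "m_rot c x (of_real lam) = of_real h" by (simp add: m_rot_def m_fin_def UV h_def)
  have "?g (of_real lam) = of_real (V * h)" using V0 by (simp add: UV h_def field_simps)
  hence h0: "h \<noteq> 0" using g0 by auto
  have ch: "isCont (m_rot c x) (of_real lam)"
    unfolding m_rot_def m_fin_def using v0 uv_holomorphic[OF ax, of UNIV]
    by (intro continuous_intros) (auto dest!: holomorphic_on_imp_continuous_on simp: continuous_on_eq_continuous_at)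
  have "((\<lambda>s. Complex lam s) \<longlongrightarrow> of_real lam) (at_right 0)"
    unfolding Complex_eq by (auto intro!: tendsto_eq_intros)
  from isCont_tendsto_compose[OF ch this]
  have "((\<lambda>s. m_rot c x (Complex lam s)) \<longlongrightarrow> of_real h) (at_right 0)" by (simp add: hxl)
  moreover have "isCont ang (of_real h)" using h0 by (intro isCont_ang) simp
  ultimately have "((\<lambda>s. ang (m_rot c x (Complex lam s))) \<longlongrightarrow> ang (of_real h)) (at_right 0)"
    by (rule isCont_tendsto_compose[rotated])
  moreover have "phi x lam < c \<longleftrightarrow> h < 0"
    using ang_less_iff(1)[of "Complex (U/V) 1" c] c by (simp add: phi_def U_def V_def h_def)
  ultimately show "((\<lambda>s. ang (m_rot c x (Complex lam s))) \<longlongrightarrow> pi * (if phi x lam < c then 1 else 0)) (at_right 0)"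
    using h0 by (cases "h < 0") (simp_all add: ang_of_real)
qed

lemma abs_ang_le: "\<bar>ang z\<bar> \<le> pi" using ang_bounds[of z] by simp

lemma ang_m_rot_integrable:
  assumes c: "0 < c" "c < pi" and x: "x \<ge> a + 1" and e: "e > 0"
  shows "(\<lambda>lam. ang (m_rot c x (Complex lam e))) integrable_on {\<alpha>..\<beta>}"
proof (rule integrable_continuous_real, rule continuous_on_compose2[OF ang_continuous])
  show "continuous_on {\<alpha>..\<beta>} (\<lambda>lam. m_rot c x (Complex lam e))"
  proof (rule continuous_on_compose2[OF holomorphic_on_imp_continuous_on[OF m_rot_holomorphic[OF x]]])
    show "continuous_on {\<alpha>..\<beta>} (\<lambda>lam. Complex lam e)" unfolding Complex_eq by (intro continuous_intros)
  qed (use e in auto)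
  show "(\<lambda>lam. m_rot c x (Complex lam e)) ` {\<alpha>..\<beta>} \<subseteq> - {0}"
    using m_rot_Im_pos[OF c x, of "Complex _ e"] e by (auto simp: image_iff) (metis complex.sel(2) less_irrefl zero_complex.sel(2))
qed

text \<open>The lower side of the rectangle descends to the real axis for fixed \<open>x\<close>; \<open>L\<close> does not depend on \<open>x\<close>.\<close>
lemma phi_boundary_layer:
  assumes c: "0 < c" "c < pi" and ab: "\<alpha> \<le> \<beta>"
  obtains L where "\<And>x e. x \<ge> a + 1 \<Longrightarrow> 0 < e \<Longrightarrow> e \<le> 1 \<Longrightarrow>
     (\<lambda>lam. if phi x lam < c then 1 else 0 :: real) integrable_on {\<alpha>..\<beta>} \<and>
     \<bar>pi * integral {\<alpha>..\<beta>} (\<lambda>lam. if phi x lam < c then 1 else 0) -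
        integral {\<alpha>..\<beta>} (\<lambda>lam. ang (m_rot c x (Complex lam e)))\<bar> \<le> 2 * (e * (L + 1 - ln e))"
proof -
  obtain L where L: "\<And>x lam t. x \<ge> a + 1 \<Longrightarrow> \<bar>lam\<bar> \<le> max \<bar>\<alpha>\<bar> \<bar>\<beta>\<bar> \<Longrightarrow> 0 < t \<Longrightarrow> t \<le> 1 \<Longrightarrow>
     \<bar>ln (cmod (m_rot c x (Complex lam t)))\<bar> \<le> L - ln t"
    using m_rot_log_bound[OF c] by blast
  show ?thesis
  proof (rule that[of L])
    fix x e assume x: "x \<ge> a + 1" and e: "0 < e" "e \<le> (1::real)"
    let ?f = "\<lambda>s lam. ang (m_rot c x (Complex lam s))"
    let ?g = "\<lambda>lam. if phi x lam < c then 1 else 0 :: real"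
    define s where "s n = e * inverse (real (Suc n))" for n
    have s: "s n > 0" "s n \<le> e" for n using e by (auto simp: s_def field_simps)
    have s0: "filterlim s (at_right 0) sequentially"
      unfolding filterlim_at using s(1) LIMSEQ_inverse_real_of_nat
      by (auto simp: s_def[abs_def] intro!: tendsto_mult_right_zero always_eventually)
    obtain N where N: "negligible N"
      "\<And>lam. lam \<notin> N \<Longrightarrow> ((\<lambda>s. ?f s lam) \<longlongrightarrow> pi * ?g lam) (at_right 0)"
      using phi_indicator_limit[OF c x] by blast
    have dc: "(\<lambda>lam. pi * ?g lam) integrable_on {\<alpha>..\<beta>}"
      "(\<lambda>n. integral {\<alpha>..\<beta>} (?f (s n))) \<longlonglongrightarrow> integral {\<alpha>..\<beta>} (\<lambda>lam. pi * ?g lam)"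
      by (rule dominated_convergence_ae[OF ang_m_rot_integrable[OF c x s(1)] abs_ang_le N(1)];
          rule filterlim_compose[OF N(2) s0]; simp)+
    have gi: "?g integrable_on {\<alpha>..\<beta>}"
      using integrable_on_cmult_left[OF dc(1), of "1 / pi"] by simp
    have "\<bar>integral {\<alpha>..\<beta>} (\<lambda>lam. pi * ?g lam) - integral {\<alpha>..\<beta>} (?f e)\<bar> \<le> 2 * (e * (L + 1 - ln e))"
    proof (rule tendsto_upperbound)
      show "(\<lambda>n. \<bar>integral {\<alpha>..\<beta>} (?f (s n)) - integral {\<alpha>..\<beta>} (?f e)\<bar>) \<longlonglongrightarrow>
        \<bar>integral {\<alpha>..\<beta>} (\<lambda>lam. pi * ?g lam) - integral {\<alpha>..\<beta>} (?f e)\<bar>"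
        by (intro tendsto_intros dc(2))
      show "\<forall>\<^sub>F n in sequentially. \<bar>integral {\<alpha>..\<beta>} (?f (s n)) - integral {\<alpha>..\<beta>} (?f e)\<bar> \<le> 2 * (e * (L + 1 - ln e))"
      proof (rule always_eventually, rule allI, rule boundary_layer[OF m_rot_holomorphic[OF x] _ ab _ s e(2)])
        show "Im (m_rot c x z) > 0" if "Im z > 0" for z by (rule m_rot_Im_pos[OF c x that])
        show "\<bar>ln (cmod (m_rot c x (Complex \<sigma> t)))\<bar> \<le> L - ln t" if "\<sigma> \<in> {\<alpha>, \<beta>}" "0 < t" "t \<le> 1" for \<sigma> t
          by (rule L[OF x _ that(2,3)]) (use that in auto)
      qed
    qed simp
    moreover have "integral {\<alpha>..\<beta>} (\<lambda>lam. pi * ?g lam) = pi * integral {\<alpha>..\<beta>} ?g" by (rule integral_mult_right)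
    ultimately show "?g integrable_on {\<alpha>..\<beta>} \<and>
     \<bar>pi * integral {\<alpha>..\<beta>} ?g - integral {\<alpha>..\<beta>} (\<lambda>lam. ang (m_rot c x (Complex lam e)))\<bar> \<le> 2 * (e * (L + 1 - ln e))"
      using gi by simp
  qed
qed

text \<open>
  At a fixed height \<open>e\<close> the arguments converge as \<open>x \<rightarrow> \<infinity>\<close> by Weyl's theory, and the limit converges as
  \<open>e \<rightarrow> 0\<close> because the boundary values \<open>M\<close> exist.  The two limits may be interchanged because
  the boundary layer estimate is uniform in \<open>x\<close>.
\<close>
lemma phi_distribution_limit:
  assumes lp: "limit_point_at_infinity q a" and c: "0 < c" "c < pi" and ab: "\<alpha> \<le> \<beta>"
    and M: "\<And>lam. \<alpha> < lam \<Longrightarrow> lam < \<beta> \<Longrightarrow> ((\<lambda>e. weyl_m q a (Complex lam e)) \<longlongrightarrow> M lam) (at_right 0)"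
    and Mpos: "\<And>lam. \<alpha> < lam \<Longrightarrow> lam < \<beta> \<Longrightarrow> Im (M lam) > 0"
  shows "((\<lambda>x. integral {\<alpha>..\<beta>} (\<lambda>lam. if phi x lam < c then 1 else 0)) \<longlongrightarrow>
           integral {\<alpha>..\<beta>} (\<lambda>lam. ang (of_real (cos c) + M lam * of_real (sin c)) / pi)) at_top"
proof -
  have sc: "sin c > 0" using c by (rule sin_gt_zero)
  obtain L where L: "\<And>x e. x \<ge> a + 1 \<Longrightarrow> 0 < e \<Longrightarrow> e \<le> 1 \<Longrightarrow>
     (\<lambda>lam. if phi x lam < c then 1 else 0 :: real) integrable_on {\<alpha>..\<beta>} \<and>
     \<bar>pi * integral {\<alpha>..\<beta>} (\<lambda>lam. if phi x lam < c then 1 else 0) -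
        integral {\<alpha>..\<beta>} (\<lambda>lam. ang (m_rot c x (Complex lam e)))\<bar> \<le> 2 * (e * (L + 1 - ln e))"
    using phi_boundary_layer[OF c ab] by blast
  let ?w = "\<lambda>e lam. ang (of_real (cos c) + weyl_m q a (Complex lam e) * of_real (sin c))"
  let ?m = "\<lambda>lam. ang (of_real (cos c) + M lam * of_real (sin c))"
  let ?h = "\<lambda>e x lam. ang (m_rot c x (Complex lam e))"
  define P where "P x = pi * integral {\<alpha>..\<beta>} (\<lambda>lam. if phi x lam < c then 1 else 0)" for x
  have w: "?w e integrable_on {\<alpha>..\<beta>} \<and> ((\<lambda>x. integral {\<alpha>..\<beta>} (?h e x)) \<longlongrightarrow> integral {\<alpha>..\<beta>} (?w e)) at_top"
    if e: "e > 0" for e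
  proof -
    have pt: "((\<lambda>x. ?h e x lam) \<longlongrightarrow> ?w e lam) at_top" for lam
    proof (rule isCont_tendsto_compose[OF isCont_ang])
      have "Im (of_real (cos c) + weyl_m q a (Complex lam e) * of_real (sin c)) \<noteq> 0"
        using m_fin_tendsto_weyl_m(2)[OF lp, of "Complex lam e"] e sc by simp
      thus "of_real (cos c) + weyl_m q a (Complex lam e) * of_real (sin c) \<noteq> 0" by (metis zero_complex.sel(2))
      show "((\<lambda>x. m_rot c x (Complex lam e)) \<longlongrightarrow> of_real (cos c) + weyl_m q a (Complex lam e) * of_real (sin c)) at_top"
        unfolding m_rot_def by (intro tendsto_intros m_fin_tendsto_weyl_m lp) (simp add: e)
    qed
    have seq: "?w e integrable_on {\<alpha>..\<beta>}"
      "(\<lambda>n. integral {\<alpha>..\<beta>} (?h e (max (a+1) (X n)))) \<longlonglongrightarrow> integral {\<alpha>..\<beta>} (?w e)"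
      if X: "filterlim X at_top sequentially" for X
    proof -
      have X': "filterlim (\<lambda>n. max (a+1) (X n)) at_top sequentially"
        by (rule filterlim_at_top_mono[OF X]) auto
      show "?w e integrable_on {\<alpha>..\<beta>}"
        "(\<lambda>n. integral {\<alpha>..\<beta>} (?h e (max (a+1) (X n)))) \<longlonglongrightarrow> integral {\<alpha>..\<beta>} (?w e)"
        by (rule dominated_convergence_ae[where f = "\<lambda>n. ?h e (max (a+1) (X n))",
              OF ang_m_rot_integrable[OF c _ e] abs_ang_le negligible_empty];
            use filterlim_compose[OF pt X'] in simp)+
    qed
    have "((\<lambda>x. integral {\<alpha>..\<beta>} (?h e (max (a+1) x))) \<longlongrightarrow> integral {\<alpha>..\<beta>} (?w e)) at_top"
      by (rule tendsto_at_topI_sequentially) (rule seq(2))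
    moreover have "\<forall>\<^sub>F x in at_top. integral {\<alpha>..\<beta>} (?h e (max (a+1) x)) = integral {\<alpha>..\<beta>} (?h e x)"
      using eventually_ge_at_top[of "a+1"] by eventually_elim (simp add: max_def)
    ultimately have "((\<lambda>x. integral {\<alpha>..\<beta>} (?h e x)) \<longlongrightarrow> integral {\<alpha>..\<beta>} (?w e)) at_top"
      by (rule Lim_transform_eventually)
    thus ?thesis using seq(1)[OF filterlim_real_sequentially] by blast
  qed
  define e where "e n = inverse (real (Suc n))" for n
  have e: "e n > 0" "e n \<le> 1" for n by (auto simp: e_def field_simps)
  have e0: "filterlim e (at_right 0) sequentially"
    unfolding filterlim_at using e(1) LIMSEQ_inverse_real_of_nat
    by (auto simp: e_def[abs_def] intro!: always_eventually)
  have m: "(\<lambda>n. integral {\<alpha>..\<beta>} (?w (e n))) \<longlonglongrightarrow> integral {\<alpha>..\<beta>} ?m"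
  proof (rule dominated_convergence_ae[where N = "{\<alpha>, \<beta>}", OF _ abs_ang_le])
    show "?w (e n) integrable_on {\<alpha>..\<beta>}" for n using w[OF e(1)] by blast
    fix lam assume lam: "lam \<in> {\<alpha>..\<beta>} - {\<alpha>, \<beta>}"
    hence lam': "\<alpha> < lam" "lam < \<beta>" by auto
    show "(\<lambda>n. ?w (e n) lam) \<longlonglongrightarrow> ?m lam"
    proof (rule isCont_tendsto_compose[OF isCont_ang])
      have "Im (of_real (cos c) + M lam * of_real (sin c)) \<noteq> 0" using Mpos[OF lam'] sc by simp
      thus "of_real (cos c) + M lam * of_real (sin c) \<noteq> 0" by (metis zero_complex.sel(2))
      show "(\<lambda>n. of_real (cos c) + weyl_m q a (Complex lam (e n)) * of_real (sin c))
          \<longlonglongrightarrow> of_real (cos c) + M lam * of_real (sin c)"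
        by (intro tendsto_intros filterlim_compose[OF M[OF lam'] e0])
    qed
  qed simp
  have b0: "(\<lambda>n. 2 * (e n * (L + 1 - ln (e n)))) \<longlonglongrightarrow> 0"
  proof -
    have "(\<lambda>n. 2 * (e n * (L + 1) + ln (real (Suc n)) / real (Suc n))) \<longlonglongrightarrow> 2 * (0 * (L + 1) + 0)"
      unfolding e_def
      by (intro tendsto_intros LIMSEQ_inverse_real_of_nat LIMSEQ_Suc[OF lim_ln_over_n])
    moreover have "e n * (L + 1 - ln (e n)) = e n * (L + 1) + ln (real (Suc n)) / real (Suc n)" for n
      by (simp add: e_def ln_inverse divide_inverse algebra_simps del: of_nat_Suc)
    ultimately show ?thesis by simp
  qed
  have "(P \<longlongrightarrow> integral {\<alpha>..\<beta>} ?m) at_top"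
  proof (rule tendstoI)
    fix r :: real assume r: "r > 0"
    have "\<forall>\<^sub>F n in sequentially. dist (integral {\<alpha>..\<beta>} (?w (e n))) (integral {\<alpha>..\<beta>} ?m) < r / 3"
      "\<forall>\<^sub>F n in sequentially. 2 * (e n * (L + 1 - ln (e n))) < r / 3"
      using r tendstoD[OF m, of "r/3"] order_tendstoD(2)[OF b0, of "r/3"] by auto
    hence "\<forall>\<^sub>F n in sequentially. dist (integral {\<alpha>..\<beta>} (?w (e n))) (integral {\<alpha>..\<beta>} ?m) < r / 3 \<and>
        2 * (e n * (L + 1 - ln (e n))) < r / 3" by (rule eventually_conj)
    then obtain n where n: "dist (integral {\<alpha>..\<beta>} (?w (e n))) (integral {\<alpha>..\<beta>} ?m) < r / 3"
       "2 * (e n * (L + 1 - ln (e n))) < r / 3" by (auto simp: eventually_sequentially)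
    have "\<forall>\<^sub>F x in at_top. dist (integral {\<alpha>..\<beta>} (?h (e n) x)) (integral {\<alpha>..\<beta>} (?w (e n))) < r / 3"
      using w[OF e(1), of n] r tendstoD[of _ _ at_top "r/3"] by auto
    thus "\<forall>\<^sub>F x in at_top. dist (P x) (integral {\<alpha>..\<beta>} ?m) < r"
      using eventually_ge_at_top[of "a+1"]
    proof eventually_elim
      case (elim x)
      have "\<bar>P x - integral {\<alpha>..\<beta>} (?h (e n) x)\<bar> \<le> 2 * (e n * (L + 1 - ln (e n)))"
        unfolding P_def using L[OF elim(2) e] by blast
      thus ?case using n elim(1) unfolding dist_real_def by linarith
    qed
  qed
  hence "((\<lambda>x. P x / pi) \<longlongrightarrow> integral {\<alpha>..\<beta>} ?m / pi) at_top" by (intro tendsto_intros) auto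
  thus ?thesis by (simp add: P_def)
qed

end

section \<open>From constant to measurable thresholds\<close>

lemma bounded_measurable_integrable:
  fixes f :: "real \<Rightarrow> real"
  assumes "f \<in> borel_measurable lebesgue" "\<And>l. \<bar>f l\<bar> \<le> K"
  shows "f integrable_on {s..t}"
  by (rule measurable_bounded_by_integrable_imp_integrable[where g = "\<lambda>_. K"])
     (use assms in \<open>auto intro: measurable_restrict_space1\<close>)


text \<open>
  The estimate is additive in the interval.  On short intervals \<open>g\<close> is within \<open>\<delta> / 2\<close> of a constant,
  and there it follows from the monotonicity of \<open>G\<close>; bisection does the rest.
\<close>
lemma distribution_limit_continuous_threshold:
  fixes \<phi> :: "'i \<Rightarrow> real \<Rightarrow> real" and G :: "real \<Rightarrow> real \<Rightarrow> real"
  assumes conv: "\<And>c s t. \<alpha> \<le> s \<Longrightarrow> s \<le> t \<Longrightarrow> t \<le> \<beta> \<Longrightarrow>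
       ((\<lambda>x. integral {s..t} (\<lambda>l. if \<phi> x l < c then 1 else 0)) \<longlongrightarrow> integral {s..t} (\<lambda>l. G l c)) F"
    and meas: "\<forall>\<^sub>F x in F. \<phi> x \<in> borel_measurable lebesgue"
    and Gb: "\<And>l c. 0 \<le> G l c \<and> G l c \<le> 1" and Gmono: "\<And>l c d. c \<le> d \<Longrightarrow> G l c \<le> G l d"
    and Gmeas: "\<And>h. h \<in> borel_measurable lebesgue \<Longrightarrow> (\<lambda>l. G l (h l)) \<in> borel_measurable lebesgue"
    and g: "continuous_on UNIV g" and \<delta>: "\<delta> > 0" and \<epsilon>: "\<epsilon> > 0" and ab: "\<alpha> \<le> \<beta>"
  shows "\<forall>\<^sub>F x in F.
      integral {\<alpha>..\<beta>} (\<lambda>l. if \<phi> x l < g l then 1 else 0) \<le> integral {\<alpha>..\<beta>} (\<lambda>l. G l (g l + \<delta>)) + \<epsilon> * (\<beta> - \<alpha>) \<and>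
      integral {\<alpha>..\<beta>} (\<lambda>l. G l (g l - \<delta>)) - \<epsilon> * (\<beta> - \<alpha>) \<le> integral {\<alpha>..\<beta>} (\<lambda>l. if \<phi> x l < g l then 1 else 0)"
proof -
  let ?i = "\<lambda>x g l. if \<phi> x l < g l then 1 else 0 :: real"
  have gm: "g \<in> borel_measurable lebesgue"
    using borel_measurable_continuous_onI[OF g] by (simp add: measurable_completion)
  have Gi: "(\<lambda>l. G l (h l)) integrable_on {s..t}" if "h \<in> borel_measurable lebesgue" for h s t
    by (rule bounded_measurable_integrable[OF Gmeas[OF that], of 1]) (use Gb in \<open>auto simp: abs_le_iff intro: order_trans[of _ 0]\<close>)
  have \<phi>i: "(?i x h) integrable_on {s..t}"
    if [measurable]: "\<phi> x \<in> borel_measurable lebesgue" "h \<in> borel_measurable lebesgue" for x h s t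
    by (rule bounded_measurable_integrable[of _ 1]) auto
  define P where "P s t \<longleftrightarrow> (\<alpha> \<le> s \<and> s \<le> t \<and> t \<le> \<beta> \<longrightarrow> (\<forall>\<^sub>F x in F.
      integral {s..t} (?i x g) \<le> integral {s..t} (\<lambda>l. G l (g l + \<delta>)) + \<epsilon> * (t - s) \<and>
      integral {s..t} (\<lambda>l. G l (g l - \<delta>)) - \<epsilon> * (t - s) \<le> integral {s..t} (?i x g)))" for s t
  have gm': "(\<lambda>l. g l + \<delta>) \<in> borel_measurable lebesgue" "(\<lambda>l. g l - \<delta>) \<in> borel_measurable lebesgue"
    using gm by measurable
  have "P \<alpha> \<beta>" using ab
  proof (induction rule: Bolzano)
    case (trans r s t)
    show ?case unfolding P_def
    proof
      assume *: "\<alpha> \<le> r \<and> r \<le> t \<and> t \<le> \<beta>"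
      have "\<forall>\<^sub>F x in F. integral {r..s} (?i x g) \<le> integral {r..s} (\<lambda>l. G l (g l + \<delta>)) + \<epsilon> * (s - r) \<and>
          integral {r..s} (\<lambda>l. G l (g l - \<delta>)) - \<epsilon> * (s - r) \<le> integral {r..s} (?i x g)"
        "\<forall>\<^sub>F x in F. integral {s..t} (?i x g) \<le> integral {s..t} (\<lambda>l. G l (g l + \<delta>)) + \<epsilon> * (t - s) \<and>
          integral {s..t} (\<lambda>l. G l (g l - \<delta>)) - \<epsilon> * (t - s) \<le> integral {s..t} (?i x g)"
        using trans * by (auto simp: P_def)
      thus "\<forall>\<^sub>F x in F. integral {r..t} (?i x g) \<le> integral {r..t} (\<lambda>l. G l (g l + \<delta>)) + \<epsilon> * (t - r) \<and>
          integral {r..t} (\<lambda>l. G l (g l - \<delta>)) - \<epsilon> * (t - r) \<le> integral {r..t} (?i x g)"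
        using meas
      proof eventually_elim
        case (elim x)
        note c = Henstock_Kurzweil_Integration.integral_combine[OF trans(3,4), symmetric]
        have "integral {r..t} (?i x g) = integral {r..s} (?i x g) + integral {s..t} (?i x g)"
          by (rule c[OF \<phi>i[OF elim(3) gm]])
        moreover have "integral {r..t} (\<lambda>l. G l (g l + \<delta>)) = integral {r..s} (\<lambda>l. G l (g l + \<delta>)) + integral {s..t} (\<lambda>l. G l (g l + \<delta>))"
          by (rule c[OF Gi[OF gm'(1)]])
        moreover have "integral {r..t} (\<lambda>l. G l (g l - \<delta>)) = integral {r..s} (\<lambda>l. G l (g l - \<delta>)) + integral {s..t} (\<lambda>l. G l (g l - \<delta>))"
          by (rule c[OF Gi[OF gm'(2)]])
        ultimately show ?case using elim(1,2) by (auto simp: algebra_simps)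
      qed
    qed
  next
    case (local y)
    have "isCont g y" using g by (simp add: continuous_on_eq_continuous_at)
    then obtain d where d: "d > 0" "\<And>l. \<bar>l - y\<bar> < d \<Longrightarrow> \<bar>g l - g y\<bar> < \<delta> / 2"
      using \<delta> unfolding continuous_at_eps_delta by (metis half_gt_zero dist_real_def)
    show ?case
    proof (intro exI[of _ d] conjI allI impI d(1))
      fix s t assume st: "s \<le> y \<and> y \<le> t \<and> t - s < d"
      show "P s t" unfolding P_def
      proof
        assume *: "\<alpha> \<le> s \<and> s \<le> t \<and> t \<le> \<beta>"
        show "\<forall>\<^sub>F x in F. integral {s..t} (?i x g) \<le> integral {s..t} (\<lambda>l. G l (g l + \<delta>)) + \<epsilon> * (t - s) \<and>
          integral {s..t} (\<lambda>l. G l (g l - \<delta>)) - \<epsilon> * (t - s) \<le> integral {s..t} (?i x g)"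
        proof (cases "s = t")
          case False
          hence "s < t" using * by auto
          hence pos: "\<epsilon> * (t - s) > 0" using \<epsilon> by simp
          let ?c = "g y + \<delta> / 2" and ?d = "g y - \<delta> / 2"
          have near: "\<bar>g l - g y\<bar> < \<delta> / 2" if "l \<in> {s..t}" for l
            using that st by (intro d(2)) auto
          have "\<forall>\<^sub>F x in F. integral {s..t} (?i x (\<lambda>_. ?c)) < integral {s..t} (\<lambda>l. G l ?c) + \<epsilon> * (t - s)"
            by (rule order_tendstoD(2)[OF conv]) (use * pos in auto)
          moreover have "\<forall>\<^sub>F x in F. integral {s..t} (?i x (\<lambda>_. ?d)) > integral {s..t} (\<lambda>l. G l ?d) - \<epsilon> * (t - s)"
            by (rule order_tendstoD(1)[OF conv]) (use * pos in auto)
          ultimately show ?thesis using meas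
          proof eventually_elim
            case (elim x)
            have "integral {s..t} (?i x g) \<le> integral {s..t} (?i x (\<lambda>_. ?c))"
            proof (rule integral_le[OF \<phi>i[OF elim(3) gm] \<phi>i[OF elim(3)]])
              fix l assume "l \<in> {s..t}"
              hence "g l < ?c" using near[of l] by linarith
              thus "?i x g l \<le> ?i x (\<lambda>_. ?c) l" by auto
            qed simp
            moreover have "integral {s..t} (\<lambda>l. G l ?c) \<le> integral {s..t} (\<lambda>l. G l (g l + \<delta>))"
            proof (rule integral_le[OF Gi Gi[OF gm'(1)]])
              fix l assume "l \<in> {s..t}"
              hence "?c \<le> g l + \<delta>" using near[of l] by linarith
              thus "G l ?c \<le> G l (g l + \<delta>)" by (rule Gmono)
            qed simp
            moreover have "integral {s..t} (?i x (\<lambda>_. ?d)) \<le> integral {s..t} (?i x g)"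
            proof (rule integral_le[OF \<phi>i[OF elim(3)] \<phi>i[OF elim(3) gm]])
              fix l assume "l \<in> {s..t}"
              hence "?d < g l" using near[of l] by linarith
              thus "?i x (\<lambda>_. ?d) l \<le> ?i x g l" by auto
            qed simp
            moreover have "integral {s..t} (\<lambda>l. G l (g l - \<delta>)) \<le> integral {s..t} (\<lambda>l. G l ?d)"
            proof (rule integral_le[OF Gi[OF gm'(2)] Gi])
              fix l assume "l \<in> {s..t}"
              hence "g l - \<delta> \<le> ?d" using near[of l] by linarith
              thus "G l (g l - \<delta>) \<le> G l ?d" by (rule Gmono)
            qed simp
            ultimately show ?case using elim(1,2) by linarith
          qed
        qed simp
      qed
    qed
  qed
  thus ?thesis using ab by (simp add: P_def)
qed

text \<open>
  A measurable threshold \<open>h\<close> is an almost everywhere limit of continuous ones, \<open>g\<close>.  Replacing \<open>h\<close> by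
  \<open>g\<close> up to a shift by \<open>\<delta>\<close> costs at most \<open>min 1 (|h - g| / \<delta>)\<close>, whose integral is small.  The shift
  also absorbs the difference between strict and weak inequality, so that any \<open>E\<close> between the two
  indicators is admitted.
\<close>
lemma distribution_limit_measurable_threshold:
  fixes \<phi> :: "'i \<Rightarrow> real \<Rightarrow> real" and G :: "real \<Rightarrow> real \<Rightarrow> real"
  assumes conv: "\<And>c s t. \<alpha> \<le> s \<Longrightarrow> s \<le> t \<Longrightarrow> t \<le> \<beta> \<Longrightarrow>
       ((\<lambda>x. integral {s..t} (\<lambda>l. if \<phi> x l < c then 1 else 0)) \<longlongrightarrow> integral {s..t} (\<lambda>l. G l c)) F"
    and meas: "\<forall>\<^sub>F x in F. \<phi> x \<in> borel_measurable lebesgue"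
    and Gb: "\<And>l c. 0 \<le> G l c \<and> G l c \<le> 1" and Gmono: "\<And>l c d. c \<le> d \<Longrightarrow> G l c \<le> G l d"
    and Gmeas: "\<And>h. h \<in> borel_measurable lebesgue \<Longrightarrow> (\<lambda>l. G l (h l)) \<in> borel_measurable lebesgue"
    and Gcont: "\<And>l c. isCont (G l) c"
    and h: "h \<in> borel_measurable lebesgue" and ab: "\<alpha> \<le> \<beta>"
    and E: "\<forall>\<^sub>F x in F. E x \<in> borel_measurable lebesgue \<and>
       (\<forall>l. (if \<phi> x l < h l then 1 else 0) \<le> E x l \<and> E x l \<le> (if \<phi> x l \<le> h l then 1 else 0))"
  shows "((\<lambda>x. integral {\<alpha>..\<beta>} (E x)) \<longlongrightarrow> integral {\<alpha>..\<beta>} (\<lambda>l. G l (h l))) F"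
proof (rule tendstoI)
  fix r :: real assume r: "r > 0"
  let ?i = "\<lambda>x g l. if \<phi> x l < g l then 1 else 0 :: real"
  let ?I = "integral {\<alpha>..\<beta>}"
  have Gabs: "\<bar>G l c\<bar> \<le> 1" for l c using Gb[of l c] by simp
  have Gi: "(\<lambda>l. G l (k l)) integrable_on {\<alpha>..\<beta>}" if "k \<in> borel_measurable lebesgue" for k
    by (rule bounded_measurable_integrable[OF Gmeas[OF that] Gabs])
  \<comment> \<open>shifting the threshold by a small constant changes the limit only a little\<close>
  define d where "d n = inverse (real (Suc n))" for n
  have d0: "d \<longlonglongrightarrow> 0" unfolding d_def by (rule LIMSEQ_inverse_real_of_nat)
  have shift: "(\<lambda>n. ?I (\<lambda>l. G l (h l + k * d n))) \<longlonglongrightarrow> ?I (\<lambda>l. G l (h l))" for k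
  proof (rule dominated_convergence_ae(2)[OF Gi Gabs negligible_empty])
    show "(\<lambda>l. h l + k * d n) \<in> borel_measurable lebesgue" for n using h by measurable
    show "(\<lambda>n. G l (h l + k * d n)) \<longlonglongrightarrow> G l (h l)" for l
      by (rule isCont_tendsto_compose[OF Gcont]) (auto intro!: tendsto_eq_intros d0)
  qed
  have "\<forall>\<^sub>F n in sequentially. dist (?I (\<lambda>l. G l (h l + 3 * d n))) (?I (\<lambda>l. G l (h l))) < r / 4 \<and>
     dist (?I (\<lambda>l. G l (h l + (-3) * d n))) (?I (\<lambda>l. G l (h l))) < r / 4"
    using r by (intro eventually_conj tendstoD[OF shift]) auto
  then obtain n where n: "dist (?I (\<lambda>l. G l (h l + 3 * d n))) (?I (\<lambda>l. G l (h l))) < r / 4"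
     "dist (?I (\<lambda>l. G l (h l + (-3) * d n))) (?I (\<lambda>l. G l (h l))) < r / 4"
    by (auto simp: eventually_sequentially)
  define \<delta> where "\<delta> = d n"
  have \<delta>: "\<delta> > 0" by (simp add: \<delta>_def d_def)
  have "h measurable_on UNIV" using h by (simp add: measurable_on_iff_borel_measurable lebesgue_on_UNIV_eq)
  then obtain N g where N: "negligible N" and g: "\<And>n. continuous_on UNIV (g n)"
    and gh: "\<And>l. l \<notin> N \<Longrightarrow> (\<lambda>n. g n l) \<longlonglongrightarrow> h l" by (auto simp: measurable_on_def)
  have gm: "g n \<in> borel_measurable lebesgue" for n
    using g[of n] by (simp add: borel_measurable_continuous_onI measurable_completion)
  define \<rho> where "\<rho> n l = min 1 (\<bar>h l - g n l\<bar> / \<delta>)" for n l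
  have \<rho>m: "\<rho> n \<in> borel_measurable lebesgue" for n
    unfolding \<rho>_def[abs_def] using h gm[of n] by measurable
  have \<rho>b: "\<bar>\<rho> n l\<bar> \<le> 1" "0 \<le> \<rho> n l" for n l using \<delta> by (auto simp: \<rho>_def)
  have \<rho>i: "\<rho> n integrable_on {\<alpha>..\<beta>}" for n by (rule bounded_measurable_integrable[OF \<rho>m \<rho>b(1)])
  have "(\<lambda>n. ?I (\<rho> n)) \<longlonglongrightarrow> ?I (\<lambda>_. 0)"
  proof (rule dominated_convergence_ae(2)[OF \<rho>i \<rho>b(1) N])
    fix l assume "l \<in> {\<alpha>..\<beta>} - N"
    hence "(\<lambda>n. min 1 (\<bar>h l - g n l\<bar> / \<delta>)) \<longlonglongrightarrow> min 1 (\<bar>h l - h l\<bar> / \<delta>)"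
      using \<delta> by (intro tendsto_intros gh) auto
    thus "(\<lambda>n. \<rho> n l) \<longlonglongrightarrow> 0" by (simp add: \<rho>_def)
  qed
  from tendstoD[OF this, of "r/8"] r obtain m where "dist (?I (\<rho> m)) (?I (\<lambda>_. 0)) < r / 8"
    by (auto simp: eventually_sequentially)
  hence m: "?I (\<rho> m) < r / 8" by (simp add: dist_real_def)
  \<comment> \<open>the error \<open>r\<close> is spent on the shift of \<open>h\<close> (a quarter), on passing from \<open>h\<close> to \<open>g\<close> and back
    (two eighths) and on the limit for \<open>g\<close> (an eighth)\<close>
  define \<epsilon> where "\<epsilon> = r / (8 * (\<beta> - \<alpha> + 1))"
  have \<epsilon>: "\<epsilon> > 0" using r ab by (simp add: \<epsilon>_def)
  have \<epsilon>b: "\<epsilon> * (\<beta> - \<alpha>) < r / 8"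
  proof -
    have "\<epsilon> * (\<beta> - \<alpha>) < \<epsilon> * (\<beta> - \<alpha> + 1)" using \<epsilon> by simp
    also have "\<dots> = r / 8" using ab by (simp add: \<epsilon>_def field_simps)
    finally show ?thesis .
  qed
  have far: "\<rho> m l = 1" if "\<bar>h l - g m l\<bar> \<ge> \<delta>" for l using that \<delta> by (simp add: \<rho>_def)
  have up: "?I (\<lambda>l. G l (g m l + \<delta> + \<delta>)) \<le> ?I (\<lambda>l. G l (h l + 3 * d n)) + ?I (\<rho> m)"
  proof -
    have "?I (\<lambda>l. G l (g m l + \<delta> + \<delta>)) \<le> ?I (\<lambda>l. G l (h l + 3 * d n) + \<rho> m l)"
    proof (rule integral_le)
      show "(\<lambda>l. G l (g m l + \<delta> + \<delta>)) integrable_on {\<alpha>..\<beta>}"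
        "(\<lambda>l. G l (h l + 3 * d n) + \<rho> m l) integrable_on {\<alpha>..\<beta>}"
        by (intro integrable_add Gi \<rho>i borel_measurable_add gm h borel_measurable_const)+
      show "G l (g m l + \<delta> + \<delta>) \<le> G l (h l + 3 * d n) + \<rho> m l" for l
      proof (cases "\<bar>h l - g m l\<bar> \<ge> \<delta>")
        case True thus ?thesis using far[OF True] Gb[of l "g m l + \<delta> + \<delta>"] Gb[of l "h l + 3 * d n"] by linarith
      next
        case False
        hence "G l (g m l + \<delta> + \<delta>) \<le> G l (h l + 3 * d n)" by (intro Gmono) (auto simp: \<delta>_def)
        thus ?thesis using \<rho>b(2)[of m l] by linarith
      qed
    qed
    also have "\<dots> = ?I (\<lambda>l. G l (h l + 3 * d n)) + ?I (\<rho> m)"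
      by (intro integral_add Gi \<rho>i borel_measurable_add h borel_measurable_const)
    finally show ?thesis .
  qed
  have lo: "?I (\<lambda>l. G l (h l + (-3) * d n)) - ?I (\<rho> m) \<le> ?I (\<lambda>l. G l (g m l - \<delta> - \<delta>))"
  proof -
    have "?I (\<lambda>l. G l (h l + (-3) * d n)) - ?I (\<rho> m) = ?I (\<lambda>l. G l (h l + (-3) * d n) - \<rho> m l)"
      by (rule integral_diff[symmetric]) (intro Gi \<rho>i borel_measurable_add h borel_measurable_const)+
    also have "\<dots> \<le> ?I (\<lambda>l. G l (g m l - \<delta> - \<delta>))"
    proof (rule integral_le)
      show "(\<lambda>l. G l (g m l - \<delta> - \<delta>)) integrable_on {\<alpha>..\<beta>}"
        "(\<lambda>l. G l (h l + (-3) * d n) - \<rho> m l) integrable_on {\<alpha>..\<beta>}"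
        by (intro integrable_diff Gi \<rho>i borel_measurable_add borel_measurable_diff gm h borel_measurable_const)+
      show "G l (h l + (-3) * d n) - \<rho> m l \<le> G l (g m l - \<delta> - \<delta>)" for l
      proof (cases "\<bar>h l - g m l\<bar> \<ge> \<delta>")
        case True thus ?thesis using far[OF True] Gb[of l "g m l - \<delta> - \<delta>"] Gb[of l "h l + (-3) * d n"] by linarith
      next
        case False
        hence "G l (h l + (-3) * d n) \<le> G l (g m l - \<delta> - \<delta>)" by (intro Gmono) (auto simp: \<delta>_def)
        thus ?thesis using \<rho>b(2)[of m l] by linarith
      qed
    qed
    finally show ?thesis .
  qed
  have gc: "continuous_on UNIV (\<lambda>l. g m l + \<delta>)" "continuous_on UNIV (\<lambda>l. g m l - \<delta>)"
    by (intro continuous_intros g)+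
  have cont: "\<forall>\<^sub>F x in F.
      ?I (?i x k) \<le> ?I (\<lambda>l. G l (k l + \<delta>)) + \<epsilon> * (\<beta> - \<alpha>) \<and>
      ?I (\<lambda>l. G l (k l - \<delta>)) - \<epsilon> * (\<beta> - \<alpha>) \<le> ?I (?i x k)" if k: "continuous_on UNIV k" for k
    by (rule distribution_limit_continuous_threshold[where G = G and F = F])
       (fact k \<delta> \<epsilon> ab meas Gb | rule conv Gmono Gmeas; assumption)+
  show "\<forall>\<^sub>F x in F. dist (?I (E x)) (?I (\<lambda>l. G l (h l))) < r"
    using cont[OF gc(1)] cont[OF gc(2)] meas E
  proof eventually_elim
    case (elim x)
    have Em: "E x \<in> borel_measurable lebesgue" and
      Eb: "\<And>l. ?i x h l \<le> E x l \<and> E x l \<le> (if \<phi> x l \<le> h l then 1 else 0)" using elim(4) by auto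
    have "\<bar>E x l\<bar> \<le> 1" for l using Eb[of l] by (auto split: if_splits)
    hence Ei: "E x integrable_on {\<alpha>..\<beta>}" by (intro bounded_measurable_integrable[OF Em]) auto
    have ii: "?i x k integrable_on {\<alpha>..\<beta>}" if [measurable]: "k \<in> borel_measurable lebesgue" for k
      using elim(3) by (intro bounded_measurable_integrable[of _ 1]) auto
    have i1: "?i x (\<lambda>l. g m l + \<delta>) integrable_on {\<alpha>..\<beta>}" and i2: "?i x (\<lambda>l. g m l - \<delta>) integrable_on {\<alpha>..\<beta>}"
      by (intro ii borel_measurable_add borel_measurable_diff gm borel_measurable_const)+
    have "?I (E x) \<le> ?I (\<lambda>l. ?i x (\<lambda>l. g m l + \<delta>) l + \<rho> m l)"
    proof (rule integral_le[OF Ei integrable_add[OF i1 \<rho>i]])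
      show "E x l \<le> ?i x (\<lambda>l. g m l + \<delta>) l + \<rho> m l" for l
      proof (cases "\<bar>h l - g m l\<bar> \<ge> \<delta>")
        case True thus ?thesis using far[OF True] Eb[of l] by (auto split: if_splits)
      next
        case False thus ?thesis using \<rho>b(2)[of m l] Eb[of l] by (auto split: if_splits)
      qed
    qed
    also have "\<dots> = ?I (?i x (\<lambda>l. g m l + \<delta>)) + ?I (\<rho> m)" by (rule integral_add[OF i1 \<rho>i])
    finally have 1: "?I (E x) \<le> ?I (?i x (\<lambda>l. g m l + \<delta>)) + ?I (\<rho> m)" .
    have "?I (?i x (\<lambda>l. g m l - \<delta>)) - ?I (\<rho> m) = ?I (\<lambda>l. ?i x (\<lambda>l. g m l - \<delta>) l - \<rho> m l)"
      by (rule integral_diff[OF i2 \<rho>i, symmetric])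
    also have "\<dots> \<le> ?I (E x)"
    proof (rule integral_le[OF integrable_diff[OF i2 \<rho>i] Ei])
      show "?i x (\<lambda>l. g m l - \<delta>) l - \<rho> m l \<le> E x l" for l
      proof (cases "\<bar>h l - g m l\<bar> \<ge> \<delta>")
        case True thus ?thesis using far[OF True] Eb[of l] by (auto split: if_splits)
      next
        case False thus ?thesis using \<rho>b(2)[of m l] Eb[of l] by (auto split: if_splits)
      qed
    qed
    finally have 2: "?I (?i x (\<lambda>l. g m l - \<delta>)) - ?I (\<rho> m) \<le> ?I (E x)" .
    show ?case using 1 2 elim(1,2) up lo m n \<epsilon>b unfolding dist_real_def by linarith
  qed
qed

section \<open>The phase\<close>

context sturm_liouville begin

text \<open>
  Write \<open>f = u + A v + \<i> B v\<close>.  The imaginary part of \<open>f' cnj f\<close> is the constant \<open>B\<close>, so \<open>f\<close>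
  rotates at speed \<open>B / |f|\<^sup>2\<close>.
\<close>
lemma phase_integral:
  fixes lam A B :: real
  assumes B: "B > 0"
  defines "f \<equiv> \<lambda>t. u (of_real lam) t + Complex A B * v (of_real lam) t"
  defines "\<psi> \<equiv> \<lambda>x. integral {a..x} (\<lambda>t. B / (cmod (f t))\<^sup>2)"
  shows "\<And>x. a \<le> x \<Longrightarrow> f x \<noteq> 0"
    and "\<And>x. a \<le> x \<Longrightarrow> f x = of_real (cmod (f x)) * cis (\<psi> x)"
    and "\<And>x y. a \<le> x \<Longrightarrow> x < y \<Longrightarrow> \<psi> x < \<psi> y"
    and "continuous_on {a..} \<psi>" and "\<psi> a = 0"
proof -
  define f' where "f' = (\<lambda>t. 1 * u' (of_real lam) t + Complex A B * v' (of_real lam) t)"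
  have sf: "sol (of_real lam) f f'"
    using sol_lincomb[OF sol_u(1) sol_v(1), of "of_real lam" 1 "Complex A B"] by (simp add: f_def f'_def)
  have fa: "f a = 1" "f' a = Complex A B" by (simp_all add: f_def f'_def sol_u sol_v)
  have W: "Im (f' x * cnj (f x)) = B" if x: "a \<le> x" for x
    using energy_identity[OF sf x] by (simp add: fa)
  show f0: "f x \<noteq> 0" if "a \<le> x" for x using W[OF that] B by auto
  note fc = sol_cont(1)[OF sf]
  have pc: "continuous_on {a..} (\<lambda>t. B / (cmod (f t))\<^sup>2)"
    by (intro continuous_intros fc) (use f0 in auto)
  have \<psi>d: "(\<psi> has_vector_derivative B / (cmod (f x))\<^sup>2) (at x within {a..})" if "a \<le> x" for x
    unfolding \<psi>_def by (rule integral_ray_has_vector_derivative[OF pc that])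
  show \<psi>c: "continuous_on {a..} \<psi>"
    by (rule continuous_on_if_has_vector_derivative) (use \<psi>d in auto)
  show \<psi>a: "\<psi> a = 0" by (simp add: \<psi>_def)
  show "\<psi> x < \<psi> y" if xy: "a \<le> x" "x < y" for x y
  proof (rule DERIV_pos_imp_increasing_open[OF xy(2)])
    fix t assume t: "x < t" "t < y"
    have at: "at t within {a..} = at t" by (rule at_within_interior) (use t xy in auto)
    have "(\<psi> has_real_derivative B / (cmod (f t))\<^sup>2) (at t)"
      using \<psi>d[of t] t xy by (simp add: at has_real_derivative_iff_has_vector_derivative)
    moreover have "B / (cmod (f t))\<^sup>2 > 0" using B f0[of t] t xy by simp
    ultimately show "\<exists>d. (\<psi> has_real_derivative d) (at t) \<and> 0 < d" by blast
  next
    show "continuous_on {x..y} \<psi>" by (rule continuous_on_subset[OF \<psi>c]) (use xy in auto)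
  qed
  define k where "k t = f t * cis (- \<psi> t)" for t
  have kd: "(k has_vector_derivative (f' t - of_real (B / (cmod (f t))\<^sup>2) * \<i> * f t) * cis (- \<psi> t)) (at t within {a..})"
    if t: "a \<le> t" for t
  proof -
    have d: "((\<lambda>t. - \<psi> t) has_vector_derivative - (B / (cmod (f t))\<^sup>2)) (at t within {a..})"
      by (rule has_vector_derivative_minus[OF \<psi>d[OF t]])
    have "((\<lambda>t. cis (- \<psi> t)) has_vector_derivative (- (B / (cmod (f t))\<^sup>2)) *\<^sub>R (\<i> * cis (- \<psi> t))) (at t within {a..})"
      using has_derivative_cis[OF d[unfolded has_vector_derivative_def]]
      by (simp add: has_vector_derivative_def)
    from has_vector_derivative_mult[OF sol_deriv(1)[OF sf t] this]
    show ?thesis unfolding k_def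
      by (rule back_subst[where P="\<lambda>y. (_ has_vector_derivative y) _"]) (simp add: algebra_simps scaleR_conv_of_real)
  qed
  define \<rho> where "\<rho> t = inverse (cmod (f t))" for t
  have \<rho>d: "(\<rho> has_real_derivative - Re (f' t * cnj (f t)) / ((cmod (f t))\<^sup>2 * cmod (f t))) (at t within {a..})"
    if t: "a \<le> t" for t
  proof -
    have "((\<lambda>t. f t \<bullet> f t) has_vector_derivative f t \<bullet> f' t + f' t \<bullet> f t) (at t within {a..})"
      by (rule bounded_bilinear.has_vector_derivative[OF bounded_bilinear_inner sol_deriv(1)[OF sf t] sol_deriv(1)[OF sf t]])
    hence "((\<lambda>t. f t \<bullet> f t) has_real_derivative 2 * Re (f' t * cnj (f t))) (at t within {a..})"
      by (simp add: inner_complex_def mult.commute has_real_derivative_iff_has_vector_derivative)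
    moreover have "f t \<bullet> f t > 0" using f0[OF t] by simp
    ultimately have "((\<lambda>t. sqrt (f t \<bullet> f t)) has_real_derivative
        inverse (sqrt (f t \<bullet> f t)) / 2 * (2 * Re (f' t * cnj (f t)))) (at t within {a..})"
      by (intro DERIV_chain2[OF DERIV_real_sqrt])
    hence d: "((\<lambda>t. cmod (f t)) has_real_derivative inverse (cmod (f t)) * Re (f' t * cnj (f t))) (at t within {a..})"
      unfolding norm_eq_sqrt_inner by (rule DERIV_cong) simp
    have "cmod (f t) \<noteq> 0" using f0[OF t] by simp
    from DERIV_inverse_fun[OF d this] show ?thesis unfolding \<rho>_def
      by (rule DERIV_cong) (simp add: divide_inverse power2_eq_square algebra_simps)
  qed
  \<comment> \<open>\<open>f / |f| * cis (- \<psi>)\<close> does not vary, since \<open>|f|' = Re (f' cnj f) / |f|\<close>\<close>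
  have jd: "((\<lambda>t. of_real (\<rho> t) * k t) has_vector_derivative 0) (at t within {a..})" if t: "a \<le> t" for t
  proof -
    let ?R = "cmod (f t)"
    have R0: "?R \<noteq> 0" using f0[OF t] by simp
    have "((\<lambda>t. of_real (\<rho> t)) has_vector_derivative
        complex_of_real (- Re (f' t * cnj (f t)) / (?R\<^sup>2 * ?R))) (at t within {a..})"
      by (rule bounded_linear.has_vector_derivative[OF bounded_linear_of_real])
         (use \<rho>d[OF t] in \<open>simp add: has_real_derivative_iff_has_vector_derivative\<close>)
    from has_vector_derivative_mult[OF this kd[OF t]]
    have "((\<lambda>t. of_real (\<rho> t) * k t) has_vector_derivative
        of_real (\<rho> t) * ((f' t - of_real (B / ?R\<^sup>2) * \<i> * f t) * cis (- \<psi> t)) +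
        of_real (- Re (f' t * cnj (f t)) / (?R\<^sup>2 * ?R)) * k t) (at t within {a..})" .
    moreover have "of_real (\<rho> t) * ((f' t - of_real (B / ?R\<^sup>2) * \<i> * f t) * cis (- \<psi> t)) +
        of_real (- Re (f' t * cnj (f t)) / (?R\<^sup>2 * ?R)) * k t =
        cis (- \<psi> t) / (of_real ?R * (of_real ?R)\<^sup>2) *
         (f' t * (of_real ?R)\<^sup>2 - f t * (of_real (Re (f' t * cnj (f t))) + \<i> * of_real B))"
      using R0 by (simp add: \<rho>_def k_def field_simps power2_eq_square)
    moreover have "(of_real ?R)\<^sup>2 = f t * cnj (f t)" by (simp only: of_real_power[symmetric] complex_norm_square)
    moreover have "of_real (Re (f' t * cnj (f t))) + \<i> * of_real B = f' t * cnj (f t)"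
      using W[OF t] by (simp add: complex_eq_iff)
    ultimately show ?thesis by (simp add: mult_ac)
  qed
  show "f x = of_real (cmod (f x)) * cis (\<psi> x)" if x: "a \<le> x" for x
  proof -
    obtain c where c: "\<And>t. t \<in> {a..} \<Longrightarrow> of_real (\<rho> t) * k t = c"
      using has_vector_derivative_zero_constant[of "{a..}" "\<lambda>t. of_real (\<rho> t) * k t"] jd by (auto simp: convex_real_interval)
    have "c = 1" using c[of a] by (simp add: \<rho>_def k_def fa \<psi>a)
    hence "of_real (\<rho> x) * k x = 1" using c x by auto
    hence "k x = of_real (cmod (f x))" using f0[OF x] by (simp add: \<rho>_def field_simps)
    hence "f x * cis (- \<psi> x) * cis (\<psi> x) = of_real (cmod (f x)) * cis (\<psi> x)" by (simp add: k_def)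
    thus ?thesis by (simp add: mult.assoc cis_mult)
  qed
qed

lemma uv_combination_complex:
  assumes "a \<le> x"
  shows "u (of_real lam) x + Complex A B * v (of_real lam) x =
     Complex (Re (u (of_real lam) x) + A * Re (v (of_real lam) x)) (B * Re (v (of_real lam) x))"
  using uv_real[OF assms, of lam] by (simp add: complex_eq_iff)

text \<open>
  Two continuous phases differ by a constant multiple of \<open>2 pi\<close>, so \<open>theta0\<close> is the integral above.  It
  increases strictly and meets the multiples of \<open>pi\<close> exactly at the zeros of \<open>v\<close>; hence the
  zero count is the integer part of \<open>theta0 / pi\<close>.
\<close>
lemma theta0_tilde_polar:
  assumes B: "m_B q a lam > 0" and x: "a \<le> x"
  defines "A \<equiv> m_A q a lam" and "B \<equiv> m_B q a lam"
    and "U \<equiv> Re (u (of_real lam) x)" and "V \<equiv> Re (v (of_real lam) x)" and "\<tau> \<equiv> theta0_tilde q a x lam"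
  shows "0 \<le> \<tau>" "\<tau> < pi" "\<exists>r. r \<noteq> 0 \<and> U + A * V = r * cos \<tau> \<and> B * V = r * sin \<tau>"
proof -
  define f where "f t = u (of_real lam) t + Complex A B * v (of_real lam) t" for t
  define \<psi> where "\<psi> x = integral {a..x} (\<lambda>t. B / (cmod (f t))\<^sup>2)" for x
  have B0: "B > 0" using B by (simp add: B_def)
  note ph = phase_integral[OF B0, where A = A and lam = lam, folded f_def, folded \<psi>_def]
  have fC: "f t = Complex (Re (u (of_real lam) t) + A * Re (v (of_real lam) t)) (B * Re (v (of_real lam) t))"
    if "a \<le> t" for t unfolding f_def by (rule uv_combination_complex[OF that])
  have real_eq: "(sl_u q a t (of_real lam) + of_real A * sl_v q a t (of_real lam) = of_real (r * cos (th t)) \<and>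
        of_real B * sl_v q a t (of_real lam) = of_real (r * sin (th t))) \<longleftrightarrow> f t = of_real r * cis (th t)"
    if t: "a \<le> t" for t r and th :: "real \<Rightarrow> real"
  proof -
    have "Im (u (of_real lam) t) = 0" "Im (v (of_real lam) t) = 0"
      using uv_real[OF t, of lam] by (metis Im_complex_of_real)+
    thus ?thesis unfolding fC[OF t] by (auto simp: complex_eq_iff)
  qed
  have isph: "is_phase q a lam th \<longleftrightarrow> continuous_on {a..} th \<and> th a = 0 \<and> (\<forall>t\<ge>a. \<exists>r>0. f t = of_real r * cis (th t))" for th
    unfolding is_phase_def A_def[symmetric] B_def[symmetric] using real_eq by blast
  have "is_phase q a lam \<psi>" unfolding isph
  proof (intro conjI allI impI ph(4,5))
    fix t assume t: "a \<le> t"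
    show "\<exists>r>0. f t = of_real r * cis (\<psi> t)" using ph(1,2)[OF t] by (intro exI[of _ "cmod (f t)"]) auto
  qed
  hence "is_phase q a lam (SOME th. is_phase q a lam th)" by (rule someI[where P = "is_phase q a lam"])
  then obtain th where th: "theta0 q a t lam = th t" "continuous_on {a..} th" "th a = 0"
    "\<And>t. a \<le> t \<Longrightarrow> \<exists>r>0. f t = of_real r * cis (th t)" for t
    unfolding isph theta0_def by blast
  define d where "d t = (th t - \<psi> t) / (2 * pi)" for t
  have dZ: "d t \<in> \<int>" if t: "a \<le> t" for t
  proof -
    obtain r where r: "r > 0" "f t = of_real r * cis (th t)" using th(4)[OF t] by blast
    have "cmod (f t) = r" using r by (simp add: norm_mult)
    hence "cis (th t) = cis (\<psi> t)" using r ph(2)[OF t] by simp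
    hence "cis (th t - \<psi> t) = 1" by (simp add: cis_divide[symmetric])
    hence "cos (th t - \<psi> t) = 1" by (simp add: complex_eq_iff)
    then obtain n :: int where "th t - \<psi> t = of_int n * 2 * pi" by (auto simp: cos_one_2pi_int)
    thus ?thesis by (simp add: d_def)
  qed
  have "d constant_on {a..}"
  proof (rule continuous_discrete_range_constant)
    show "connected {a..}" by simp
    show "continuous_on {a..} d" unfolding d_def by (intro continuous_intros th ph(4)) auto
    fix s assume s: "s \<in> {a..}"
    show "\<exists>e>0. \<forall>t. t \<in> {a..} \<and> d t \<noteq> d s \<longrightarrow> e \<le> norm (d t - d s)"
    proof (intro exI[of _ 1] conjI allI impI)
      fix t assume t: "t \<in> {a..} \<and> d t \<noteq> d s"
      have "d t - d s \<in> \<int>" "d t - d s \<noteq> 0" using dZ[of t] dZ[of s] s t by auto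
      thus "1 \<le> norm (d t - d s)" by (simp add: Ints_nonzero_abs_ge1)
    qed simp
  qed
  moreover have "d a = 0" by (simp add: d_def th ph(5))
  ultimately have "d x = 0" using x by (auto simp: constant_on_def)
  hence \<theta>: "theta0 q a x lam = \<psi> x" by (simp add: th(1) d_def)
  define n where "n = nat \<lfloor>\<psi> x / pi\<rfloor>"
  have \<psi>mono: "\<psi> s \<le> \<psi> t" if "a \<le> s" "s \<le> t" for s t using ph(3)[of s t] that by (cases "s = t") auto
  have \<psi>0: "\<psi> x \<ge> 0" using \<psi>mono[of a x] x ph(5) by simp
  have n: "real n * pi \<le> \<psi> x" "\<psi> x < (real n + 1) * pi"
  proof -
    have "real n = of_int \<lfloor>\<psi> x / pi\<rfloor>" using \<psi>0 by (simp add: n_def)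
    hence "real n \<le> \<psi> x / pi" "\<psi> x / pi < real n + 1" by linarith+
    thus "real n * pi \<le> \<psi> x" "\<psi> x < (real n + 1) * pi" by (simp_all add: field_simps)
  qed
  let ?Z = "{t. a < t \<and> t \<le> x \<and> sl_v q a t (of_real lam) = 0}"
  have zero_iff: "sl_v q a t (of_real lam) = 0 \<longleftrightarrow> sin (\<psi> t) = 0" if t: "a \<le> t" for t
  proof -
    have "Im (f t) = cmod (f t) * sin (\<psi> t)" by (subst ph(2)[OF t]) simp
    hence "B * Re (v (of_real lam) t) = cmod (f t) * sin (\<psi> t)" by (simp add: fC[OF t])
    thus ?thesis using B0 ph(1)[OF t] uv_real(2)[OF t, of lam]
      by (metis Re_complex_of_real mult_eq_0_iff norm_eq_zero of_real_0 order_less_irrefl)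
  qed
  have "\<psi> ` ?Z = (\<lambda>k. real k * pi) ` {1..n}"
  proof (intro equalityI subsetI)
    fix y assume "y \<in> \<psi> ` ?Z"
    then obtain t where t: "a < t" "t \<le> x" "sl_v q a t (of_real lam) = 0" "y = \<psi> t" by auto
    have p: "\<psi> t > 0" using ph(3)[of a t] t ph(5) by simp
    have "sin (\<psi> t) = 0" using zero_iff[of t] t by simp
    then obtain i :: int where i: "\<psi> t = of_int i * pi" by (auto simp: sin_zero_iff_int2)
    hence "i > 0" using p by (simp add: zero_less_mult_iff)
    then obtain k where k: "i = int k" "k \<ge> 1" by (metis zero_less_imp_eq_int of_nat_0_less_iff One_nat_def Suc_leI)
    have "\<psi> t \<le> \<psi> x" using \<psi>mono[of t x] t by simp
    hence "\<psi> t < (real n + 1) * pi" using n(2) by linarith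
    hence "real k * pi < (real n + 1) * pi" using i k by simp
    hence "real k < real n + 1" by (rule mult_right_less_imp_less) simp
    hence "k \<le> n" by linarith
    thus "y \<in> (\<lambda>k. real k * pi) ` {1..n}" using t i k by auto
  next
    fix y assume "y \<in> (\<lambda>k. real k * pi) ` {1..n}"
    then obtain k where k: "1 \<le> k" "k \<le> n" "y = real k * pi" by auto
    have "real k * pi \<le> real n * pi" using k by simp
    hence "y \<le> \<psi> x" using k(3) n(1) by linarith
    moreover have "\<psi> a \<le> y" using k(3) ph(5) by simp
    ultimately have y: "\<psi> a \<le> y" "y \<le> \<psi> x" by blast+
    obtain t where t: "a \<le> t" "t \<le> x" "\<psi> t = y"
      using IVT'[of \<psi> a y x, OF y x continuous_on_subset[OF ph(4)]] by auto
    have "t \<noteq> a" using t k ph(5) by auto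
    moreover have "sin (\<psi> t) = 0" using t k by (simp add: sin_zero_iff_int2)
    ultimately show "y \<in> \<psi> ` ?Z" using t zero_iff[of t] by auto
  qed
  moreover have "inj_on \<psi> ?Z"
  proof (rule linorder_inj_onI')
    fix s t assume "s \<in> ?Z" "t \<in> ?Z" "s < t"
    thus "\<psi> s \<noteq> \<psi> t" using ph(3)[of s t] by auto
  qed
  moreover have "inj_on (\<lambda>k. real k * pi) {1..n}" by (auto simp: inj_on_def)
  ultimately have "card ?Z = card {1..n}" by (metis (no_types, lifting) card_image)
  hence "card ?Z = n" by simp
  hence \<tau>: "\<tau> = \<psi> x - real n * pi" by (simp add: \<tau>_def theta0_tilde_def \<theta> num_zeros_v_def)
  show "0 \<le> \<tau>" "\<tau> < pi" using n by (auto simp: \<tau> algebra_simps)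
  have cs: "cos (\<psi> x) = (-1)^n * cos \<tau>" "sin (\<psi> x) = (-1)^n * sin \<tau>"
  proof -
    have "\<psi> x = \<tau> + real n * pi" by (simp add: \<tau>)
    thus "cos (\<psi> x) = (-1)^n * cos \<tau>" "sin (\<psi> x) = (-1)^n * sin \<tau>"
      by (simp_all add: cos_add sin_add)
  qed
  have "f x = of_real (cmod (f x)) * cis (\<psi> x)" by (rule ph(2)[OF x])
  hence "U + A * V = cmod (f x) * cos (\<psi> x)" "B * V = cmod (f x) * sin (\<psi> x)"
    unfolding fC[OF x] by (simp_all add: complex_eq_iff U_def V_def)
  thus "\<exists>r. r \<noteq> 0 \<and> U + A * V = r * cos \<tau> \<and> B * V = r * sin \<tau>"
    using ph(1)[OF x] by (intro exI[of _ "cmod (f x) * (-1)^n"]) (simp add: cs)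
qed

end

section \<open>Equidistribution of the reduced phase\<close>

lemma moebius_nonzero:
  assumes M: "Im M > 0" and c: "0 \<le> c" "c \<le> pi"
  shows "of_real (cos c) + M * of_real (sin c) \<noteq> 0"
proof
  assume *: "of_real (cos c) + M * of_real (sin c) = 0"
  have "Im (of_real (cos c) + M * of_real (sin c)) = Im M * sin c" by simp
  hence "sin c = 0" using * M by simp
  moreover have "Re (of_real (cos c) + M * of_real (sin c)) = 0" using * by simp
  ultimately have "cos c = 0" by simp
  thus False using \<open>sin c = 0\<close> sin_cos_squared_add[of c] by simp
qed

text \<open>
  The point \<open>cos c + M sin c\<close> runs through half of an ellipse from \<open>1\<close> to \<open>-1\<close>, counterclockwise.
\<close>
lemma ang_moebius_mono:
  assumes M: "Im M > 0" and c: "0 \<le> c" "c \<le> d" "d \<le> pi"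
  shows "ang (of_real (cos c) + M * of_real (sin c)) \<le> ang (of_real (cos d) + M * of_real (sin d))"
proof -
  let ?p = "of_real (cos c) + M * of_real (sin c)" and ?r = "of_real (cos d) + M * of_real (sin d)"
  consider "c = 0" | "c = pi" | "0 < c" "c < pi" using c by linarith
  thus ?thesis
  proof cases
    case 1 thus ?thesis using ang_bounds[of ?r] ang_of_real[of 1] by simp
  next
    case 2 thus ?thesis using c by simp
  next
    case 3
    have p: "Im ?p > 0" using M sin_gt_zero[OF 3] by simp
    have r: "Im ?r \<ge> 0" "?r \<noteq> 0" using M sin_ge_zero[of d] moebius_nonzero[OF M, of d] c by auto
    have "Im ?r * Re ?p - Re ?r * Im ?p = Im M * sin (d - c)" by (simp add: sin_diff algebra_simps)
    also have "\<dots> \<ge> 0" using M c by (intro mult_nonneg_nonneg sin_ge_zero) auto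
    finally have "Im ?r * Re ?p - Re ?r * Im ?p \<ge> 0" .
    hence "(Im ?r * Re ?p - Re ?r * Im ?p) / cmod ?r \<ge> 0" by (rule divide_nonneg_nonneg) simp
    hence "sin (ang ?r) * Re ?p - cos (ang ?r) * Im ?p \<ge> 0"
      unfolding sin_ang[OF r] cos_ang by (simp only: diff_divide_distrib times_divide_eq_left)
    thus ?thesis using ang_less_iff(2)[OF p ang_bounds] by blast
  qed
qed

text \<open>Extends functions of an angle in \<open>[0, pi]\<close> continuously to all real thresholds.\<close>
definition clamp_pi :: "real \<Rightarrow> real" where "clamp_pi c = max 0 (min pi c)"

lemma clamp_pi: "0 \<le> clamp_pi c" "clamp_pi c \<le> pi" "c \<le> d \<Longrightarrow> clamp_pi c \<le> clamp_pi d"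
  "0 \<le> c \<Longrightarrow> c \<le> pi \<Longrightarrow> clamp_pi c = c"
  by (auto simp: clamp_pi_def)

text \<open>
  The \<open>t\<close> with \<open>cot t = Im M * cot c - Re M\<close>, including the endpoints \<open>0\<close> and \<open>pi\<close>.  As
  \<open>cot \<theta>\<^sub>0 = (u / v + A) / B\<close>, this translates a threshold for the reduced phase into one for the
  angle of \<open>(u, v)\<close>.
\<close>
definition phase_threshold :: "complex \<Rightarrow> real \<Rightarrow> real" where
  "phase_threshold M c = ang (Complex (Im M * cos c - Re M * sin c) (sin c))"

text \<open>
  The translation inverts \<open>h \<mapsto> ang (cos h + M sin h)\<close>, the limit distribution of the solution
  angle.  This is what makes the reduced phase uniformly distributed.
\<close>
lemma phase_threshold:
  assumes M: "Im M > 0" and c: "0 \<le> c" "c \<le> pi"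
  defines "h \<equiv> phase_threshold M c"
  shows "ang (of_real (cos h) + M * of_real (sin h)) = c"
    and "\<exists>k>0. sin h = k * sin c \<and> cos h = k * (Im M * cos c - Re M * sin c)"
proof -
  let ?w = "Complex (Im M * cos c - Re M * sin c) (sin c)"
  have sc: "sin c \<ge> 0" using c by (rule sin_ge_zero)
  have w0: "?w \<noteq> 0"
  proof
    assume "?w = 0"
    hence "sin c = 0" "Im M * cos c - Re M * sin c = 0" by (simp_all add: complex_eq_iff)
    hence "sin c = 0" "cos c = 0" using M by simp_all
    thus False using sin_cos_squared_add[of c] by simp
  qed
  have h: "sin h = sin c / cmod ?w" "cos h = (Im M * cos c - Re M * sin c) / cmod ?w"
    using sin_ang[of ?w] cos_ang[of ?w] sc w0 by (simp_all add: h_def phase_threshold_def)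
  show "\<exists>k>0. sin h = k * sin c \<and> cos h = k * (Im M * cos c - Re M * sin c)"
    using h w0 by (intro exI[of _ "1 / cmod ?w"]) auto
  have "of_real (cos h) + M * of_real (sin h) = of_real (Im M / cmod ?w) * cis c"
    by (simp add: h complex_eq_iff diff_divide_distrib)
  thus "ang (of_real (cos h) + M * of_real (sin h)) = c"
    using ang_rcis[of "Im M / cmod ?w" c] M w0 c by simp
qed

lemma ang_comp_measurable:
  assumes "f \<in> borel_measurable N" shows "(\<lambda>x. ang (f x)) \<in> borel_measurable N"
  using measurable_compose[OF assms ang_measurable] .

lemma phase_threshold_measurable:
  assumes "M \<in> borel_measurable N" "h \<in> borel_measurable N"
  shows "(\<lambda>x. phase_threshold (M x) (h x)) \<in> borel_measurable N"
proof -
  have [measurable]: "Re \<in> borel_measurable borel" "Im \<in> borel_measurable borel"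
    "(sin :: real \<Rightarrow> real) \<in> borel_measurable borel" "(cos :: real \<Rightarrow> real) \<in> borel_measurable borel"
    by (intro borel_measurable_continuous_onI continuous_intros)+
  note [measurable] = assms
  show ?thesis unfolding phase_threshold_def Complex_eq
    by (intro ang_comp_measurable) measurable
qed

context sturm_liouville begin

lemma phi_measurable:
  assumes x: "a \<le> x" shows "phi x \<in> borel_measurable borel"
proof -
  have c: "(\<lambda>lam :: real. Re (f (of_real lam))) \<in> borel_measurable borel" if "f holomorphic_on UNIV" for f
  proof (rule borel_measurable_continuous_onI, rule continuous_on_Re)
    show "continuous_on UNIV (\<lambda>lam :: real. f (of_real lam))"
      by (rule continuous_on_compose2[OF holomorphic_on_imp_continuous_on[OF that]])
         (auto intro: continuous_on_of_real continuous_on_id)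
  qed
  note [measurable] = c[OF uv_holomorphic(1)[OF x]] c[OF uv_holomorphic(2)[OF x]]
  show ?thesis unfolding phi_def[abs_def] Complex_eq
    by (intro ang_comp_measurable) measurable
qed

lemma weyl_m_line_measurable:
  assumes lp: "limit_point_at_infinity q a" and e: "e > 0"
  shows "(\<lambda>lam. weyl_m q a (Complex lam e)) \<in> borel_measurable borel"
proof (rule borel_measurable_LIMSEQ_metric)
  fix n :: nat
  have x: "a + 1 + real n \<ge> a + 1" by simp
  show "(\<lambda>lam. m_fin (a + 1 + real n) (Complex lam e)) \<in> borel_measurable borel"
  proof (rule borel_measurable_continuous_onI,
      rule continuous_on_compose2[OF holomorphic_on_imp_continuous_on[OF m_fin_holomorphic[OF x]]])
    show "continuous_on UNIV (\<lambda>lam. Complex lam e)" unfolding Complex_eq by (intro continuous_intros)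
  qed (use e in auto)
next
  fix lam
  have "filterlim (\<lambda>n. a + 1 + real n) at_top sequentially"
    by (intro filterlim_tendsto_add_at_top[OF tendsto_const] filterlim_real_sequentially)
  thus "(\<lambda>n. m_fin (a + 1 + real n) (Complex lam e)) \<longlonglongrightarrow> weyl_m q a (Complex lam e)"
    using filterlim_compose[OF m_fin_tendsto_weyl_m(1)[OF lp, of "Complex lam e"]] e by simp
qed

lemma phi_measurable_threshold_limit:
  assumes lp: "limit_point_at_infinity q a" and ab: "\<alpha> \<le> \<beta>"
    and M: "\<And>lam. \<alpha> < lam \<Longrightarrow> lam < \<beta> \<Longrightarrow> ((\<lambda>e. weyl_m q a (Complex lam e)) \<longlongrightarrow> M lam) (at_right 0)"
    and Mpos: "\<And>lam. Im (M lam) > 0" and Mm: "M \<in> borel_measurable borel"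
    and h: "h \<in> borel_measurable lebesgue" "\<And>lam. 0 \<le> h lam \<and> h lam \<le> pi"
    and E: "\<And>x. x \<ge> a + 1 \<Longrightarrow> E x \<in> borel_measurable lebesgue"
      "\<And>x l. x \<ge> a + 1 \<Longrightarrow> (if phi x l < h l then 1 else 0) \<le> E x l \<and> E x l \<le> (if phi x l \<le> h l then 1 else 0)"
  shows "((\<lambda>x. integral {\<alpha>..\<beta>} (E x)) \<longlongrightarrow>
      integral {\<alpha>..\<beta>} (\<lambda>l. ang (of_real (cos (h l)) + M l * of_real (sin (h l))) / pi)) at_top"
proof -
  define G where "G l c = ang (of_real (cos (clamp_pi c)) + M l * of_real (sin (clamp_pi c))) / pi" for l c
  have "((\<lambda>x. integral {\<alpha>..\<beta>} (E x)) \<longlongrightarrow> integral {\<alpha>..\<beta>} (\<lambda>l. G l (h l))) at_top"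
  proof (rule distribution_limit_measurable_threshold[where \<phi> = phi and G = G and h = h])
    fix c s t assume st: "\<alpha> \<le> s" "s \<le> t" "t \<le> \<beta>"
    have phi_b: "0 < phi x l" "phi x l < pi" for x l
      unfolding phi_def by (rule ang_pos_lt_pi; simp)+
    consider "c \<le> 0" | "0 < c" "c < pi" | "c \<ge> pi" by linarith
    thus "((\<lambda>x. integral {s..t} (\<lambda>l. if phi x l < c then 1 else 0)) \<longlongrightarrow> integral {s..t} (\<lambda>l. G l c)) at_top"
    proof cases
      case 1
      hence "\<not> phi x l < c" for x l using phi_b(1)[of x l] by linarith
      moreover have "G l c = 0" for l using 1 ang_of_real[of 1] by (simp add: G_def clamp_pi_def)
      ultimately show ?thesis by simp
    next
      case 2
      have "((\<lambda>x. integral {s..t} (\<lambda>lam. if phi x lam < c then 1 else 0)) \<longlongrightarrow>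
           integral {s..t} (\<lambda>lam. ang (of_real (cos c) + M lam * of_real (sin c)) / pi)) at_top"
        by (rule phi_distribution_limit[OF lp 2 st(2)]) (use M Mpos st in auto)
      thus ?thesis using 2 by (simp add: G_def clamp_pi_def)
    next
      case 3
      hence "phi x l < c" for x l using phi_b(2)[of x l] by linarith
      moreover have "G l c = 1" for l using 3 ang_of_real[of "-1"] by (simp add: G_def clamp_pi_def)
      ultimately show ?thesis by simp
    qed
  next
    show "\<forall>\<^sub>F x in at_top. phi x \<in> borel_measurable lebesgue"
      using eventually_ge_at_top[of a]
      by eventually_elim (simp add: measurable_completion phi_measurable)
    show "0 \<le> G l c \<and> G l c \<le> 1" for l c
      using ang_bounds[of "of_real (cos (clamp_pi c)) + M l * of_real (sin (clamp_pi c))"]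
      by (simp add: G_def)
    show "G l c \<le> G l d" if "c \<le> d" for l c d
      unfolding G_def by (intro divide_right_mono ang_moebius_mono Mpos clamp_pi that) simp
    show "isCont (G l) c" for l c
      unfolding G_def
    proof -
      have 1: "isCont (\<lambda>c. of_real (cos (clamp_pi c)) + M l * of_real (sin (clamp_pi c))) c"
        unfolding clamp_pi_def by (intro continuous_intros)
      have 2: "of_real (cos (clamp_pi c)) + M l * of_real (sin (clamp_pi c)) \<noteq> 0"
        by (intro moebius_nonzero Mpos clamp_pi)
      show "isCont (\<lambda>c. ang (of_real (cos (clamp_pi c)) + M l * of_real (sin (clamp_pi c))) / pi) c"
        by (intro isCont_divide isCont_o2[OF 1 isCont_ang[OF 2]] continuous_const) simp
    qed
    fix k :: "real \<Rightarrow> real" assume [measurable]: "k \<in> borel_measurable lebesgue"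
    have [measurable]: "(sin :: real \<Rightarrow> real) \<in> borel_measurable borel" "(cos :: real \<Rightarrow> real) \<in> borel_measurable borel"
      by (intro borel_measurable_continuous_onI continuous_intros)+
    have [measurable]: "M \<in> borel_measurable lebesgue" using Mm by (simp add: measurable_completion)
    have "(\<lambda>l. of_real (cos (clamp_pi (k l))) + M l * of_real (sin (clamp_pi (k l)))) \<in> borel_measurable lebesgue"
      unfolding clamp_pi_def by measurable
    from ang_comp_measurable[OF this] show "(\<lambda>l. G l (k l)) \<in> borel_measurable lebesgue"
      unfolding G_def by measurable
  next
    show "\<forall>\<^sub>F x in at_top. E x \<in> borel_measurable lebesgue \<and>
       (\<forall>l. (if phi x l < h l then 1 else 0) \<le> E x l \<and> E x l \<le> (if phi x l \<le> h l then 1 else 0))"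
      using eventually_ge_at_top[of "a+1"] by eventually_elim (use E in blast)
  qed (fact h ab)+
  thus ?thesis using h(2) by (simp add: G_def clamp_pi)
qed

lemma theta0_tilde_vs_phi:
  assumes B: "m_B q a lam > 0" and x: "x \<ge> a" and v0: "v (of_real lam) x \<noteq> 0"
    and c: "0 \<le> c" "c \<le> pi"
  shows "theta0_tilde q a x lam < c \<longleftrightarrow> phi x lam < phase_threshold (m_plus q a lam) c"
    and "theta0_tilde q a x lam \<le> c \<longleftrightarrow> phi x lam \<le> phase_threshold (m_plus q a lam) c"
proof -
  define A B where "A = m_A q a lam" and "B = m_B q a lam"
  define U V where "U = Re (u (of_real lam) x)" and "V = Re (v (of_real lam) x)"
  define \<tau> where "\<tau> = theta0_tilde q a x lam"
  have B0: "B > 0" using B by (simp add: B_def)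
  have V0: "V \<noteq> 0" using v0 uv_real(2)[OF x, of lam] by (auto simp: V_def)
  obtain r where r: "r \<noteq> 0" "U + A * V = r * cos \<tau>" "B * V = r * sin \<tau>" and \<tau>: "0 \<le> \<tau>" "\<tau> < pi"
    using theta0_tilde_polar[OF B x] unfolding A_def B_def U_def V_def \<tau>_def by blast
  have "sin \<tau> \<noteq> 0" using r(3) B0 V0 by auto
  hence s: "sin \<tau> > 0" using sin_ge_zero[of \<tau>] \<tau> by simp
  have "(U / V + A) / B = (U + A * V) / (B * V)" using V0 B0 by (simp add: field_simps)
  also have "\<dots> = cos \<tau> / sin \<tau>" using r by simp
  finally have "Complex ((U / V + A) / B) 1 = of_real (1 / sin \<tau>) * cis \<tau>"
    using s by (simp add: complex_eq_iff)
  hence \<tau>a: "\<tau> = ang (Complex ((U / V + A) / B) 1)" using ang_rcis[of "1 / sin \<tau>" \<tau>] s \<tau> by simp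
  define h where "h = phase_threshold (m_plus q a lam) c"
  have h: "0 \<le> h" "h \<le> pi" unfolding h_def phase_threshold_def by (rule ang_bounds)+
  obtain k where k: "k > 0" "sin h = k * sin c" "cos h = k * (B * cos c - A * sin c)"
    using phase_threshold(2)[of "m_plus q a lam" c] B c by (auto simp: h_def A_def B_def m_A_def m_B_def)
  have ph: "phi x lam = ang (Complex (U / V) 1)" by (simp add: phi_def U_def V_def)
  define X where "X = (U / V + A) / B"
  have eq: "sin h * (U / V) - cos h = k * B * (sin c * X - cos c)"
    using B0 V0 by (simp add: k X_def field_simps)
  have kB: "k * B > 0" using k B0 by simp
  note less = ang_less_iff[of "Complex X 1" c, unfolded complex.sel mult_1_right, OF zero_less_one c]
    ang_less_iff[of "Complex (U / V) 1" h, unfolded complex.sel mult_1_right, OF zero_less_one h]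
  show "theta0_tilde q a x lam < c \<longleftrightarrow> phi x lam < phase_threshold (m_plus q a lam) c"
    unfolding \<tau>_def[symmetric] ph h_def[symmetric] \<tau>a X_def[symmetric] less eq
    using kB by (metis zero_less_mult_iff less_asym)
  show "theta0_tilde q a x lam \<le> c \<longleftrightarrow> phi x lam \<le> phase_threshold (m_plus q a lam) c"
    unfolding \<tau>_def[symmetric] ph h_def[symmetric] \<tau>a X_def[symmetric] less eq
    using kB by (metis zero_le_mult_iff less_le_not_le less_imp_le)
qed

text \<open>
  Up to a null set, the event is \<open>{phi < hD}\<close> without \<open>{phi \<le> hC}\<close>.  The limit distribution
  evaluated at the translated thresholds is \<open>D / pi\<close> and \<open>C / pi\<close>.
\<close>
lemma theta0_tilde_equidistribution:
  assumes lp: "limit_point_at_infinity q a"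
    and bv: "\<And>lam. \<alpha> < lam \<Longrightarrow> lam < \<beta> \<Longrightarrow> has_m_boundary_value q a lam \<and> m_B q a lam > 0"
    and ab: "\<alpha> \<le> \<beta>" and \<Lambda>: "{\<alpha><..<\<beta>} \<subseteq> \<Lambda>" "\<Lambda> \<subseteq> {\<alpha>..\<beta>}"
    and C: "C \<in> borel_measurable (lebesgue_on \<Lambda>)" and D: "D \<in> borel_measurable (lebesgue_on \<Lambda>)"
    and CD: "\<And>lam. lam \<in> \<Lambda> \<Longrightarrow> 0 \<le> C lam \<and> C lam < D lam \<and> D lam \<le> pi"
  shows "((\<lambda>x. measure lebesgue
             (\<Lambda> \<inter> {lam. C lam < theta0_tilde q a x lam \<and> theta0_tilde q a x lam < D lam}))
          \<longlongrightarrow> 1 / pi * (LINT lam:\<Lambda>|lebesgue. D lam - C lam)) at_top"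
proof -
  \<comment> \<open>only the open interval matters; outside it \<open>M\<close> is any constant of the upper half-plane\<close>
  have neg\<Lambda>: "negligible (\<Lambda> - {\<alpha><..<\<beta>})"
    by (rule negligible_subset[of "{\<alpha>, \<beta>}"]) (use \<Lambda> in auto)
  have \<Lambda>m: "\<Lambda> \<in> sets lebesgue"
    by (rule sets_negligible_symdiff[of "{\<alpha><..<\<beta>}"])
       (use \<Lambda>(1) neg\<Lambda> in \<open>auto simp: Diff_eq_empty_iff[THEN iffD2]\<close>)
  define M where "M lam = (if \<alpha> < lam \<and> lam < \<beta> then m_plus q a lam else \<i>)" for lam
  have Mlim: "((\<lambda>e. weyl_m q a (Complex lam e)) \<longlongrightarrow> m_plus q a lam) (at_right 0)"
    if "\<alpha> < lam" "lam < \<beta>" for lam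
    using bv[OF that] tendsto_Lim[of "at_right (0::real)"] unfolding has_m_boundary_value_def m_plus_def by force
  have Mpos: "Im (M lam) > 0" for lam using bv[of lam] by (simp add: M_def m_B_def)
  have Mm: "M \<in> borel_measurable borel"
  proof (rule borel_measurable_LIMSEQ_metric)
    fix n :: nat
    have [measurable]: "(\<lambda>lam. weyl_m q a (Complex lam (inverse (real (Suc n))))) \<in> borel_measurable borel"
      by (rule weyl_m_line_measurable[OF lp]) simp
    show "(\<lambda>lam. if \<alpha> < lam \<and> lam < \<beta> then weyl_m q a (Complex lam (inverse (real (Suc n)))) else \<i>) \<in> borel_measurable borel"
      by measurable
  next
    fix lam
    have "filterlim (\<lambda>n. inverse (real (Suc n))) (at_right 0) sequentially"
      unfolding filterlim_at using LIMSEQ_inverse_real_of_nat by (auto intro!: always_eventually)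
    thus "(\<lambda>n. if \<alpha> < lam \<and> lam < \<beta> then weyl_m q a (Complex lam (inverse (real (Suc n)))) else \<i>) \<longlonglongrightarrow> M lam"
      using filterlim_compose[OF Mlim[of lam]] by (auto simp: M_def)
  qed
  have Mm': "M \<in> borel_measurable lebesgue" using Mm by (simp add: measurable_completion)
  define C' D' where "C' lam = (if lam \<in> \<Lambda> then C lam else 0)" and "D' lam = (if lam \<in> \<Lambda> then D lam else 0)" for lam
  have C'm: "C' \<in> borel_measurable lebesgue" and D'm: "D' \<in> borel_measurable lebesgue"
    unfolding C'_def[abs_def] D'_def[abs_def] by (intro borel_measurable_if_I C D \<Lambda>m)+
  have C'b: "0 \<le> C' lam" "C' lam \<le> pi" and D'b: "0 \<le> D' lam" "D' lam \<le> pi" for lam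
    using CD[of lam] by (auto simp: C'_def D'_def)
  define hC hD where "hC lam = phase_threshold (M lam) (C' lam)" and "hD lam = phase_threshold (M lam) (D' lam)" for lam
  have hm [measurable]: "hC \<in> borel_measurable lebesgue" "hD \<in> borel_measurable lebesgue"
    unfolding hC_def[abs_def] hD_def[abs_def] by (intro phase_threshold_measurable Mm' C'm D'm)+
  have hb: "0 \<le> hC lam \<and> hC lam \<le> pi" "0 \<le> hD lam \<and> hD lam \<le> pi" for lam
    unfolding hC_def hD_def phase_threshold_def using ang_bounds by auto
  let ?I = "integral {\<alpha>..\<beta>}"
  define EC ED where "EC x lam = (if phi x lam \<le> hC lam then 1 else 0 :: real)"
    and "ED x lam = (if phi x lam < hD lam then 1 else 0 :: real)" for x lam
  have phm: "phi x \<in> borel_measurable lebesgue" if "x \<ge> a + 1" for x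
    using phi_measurable[of x] that by (simp add: measurable_completion)
  have Em: "EC x \<in> borel_measurable lebesgue" "ED x \<in> borel_measurable lebesgue" if "x \<ge> a + 1" for x
  proof -
    note [measurable] = phm[OF that]
    show "EC x \<in> borel_measurable lebesgue" "ED x \<in> borel_measurable lebesgue"
      unfolding EC_def[abs_def] ED_def[abs_def] by measurable
  qed
  have M': "((\<lambda>e. weyl_m q a (Complex lam e)) \<longlongrightarrow> M lam) (at_right 0)" if "\<alpha> < lam" "lam < \<beta>" for lam
    using Mlim[OF that] that by (simp add: M_def)
  have "((\<lambda>x. ?I (EC x)) \<longlongrightarrow> ?I (\<lambda>l. ang (of_real (cos (hC l)) + M l * of_real (sin (hC l))) / pi)) at_top"
    by (rule phi_measurable_threshold_limit[OF lp ab M' Mpos Mm hm(1) hb(1) Em(1)]) (auto simp: EC_def)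
  hence limC: "((\<lambda>x. ?I (EC x)) \<longlongrightarrow> ?I (\<lambda>l. C' l / pi)) at_top"
    unfolding hC_def by (simp only: phase_threshold(1)[OF Mpos C'b])
  have "((\<lambda>x. ?I (ED x)) \<longlongrightarrow> ?I (\<lambda>l. ang (of_real (cos (hD l)) + M l * of_real (sin (hD l))) / pi)) at_top"
    by (rule phi_measurable_threshold_limit[OF lp ab M' Mpos Mm hm(2) hb(2) Em(2)]) (auto simp: ED_def)
  hence limD: "((\<lambda>x. ?I (ED x)) \<longlongrightarrow> ?I (\<lambda>l. D' l / pi)) at_top"
    unfolding hD_def by (simp only: phase_threshold(1)[OF Mpos D'b])
  have CDi: "C' integrable_on {\<alpha>..\<beta>}" "D' integrable_on {\<alpha>..\<beta>}"
    by (rule bounded_measurable_integrable[of _ pi]; use C'm D'm C'b D'b in simp)+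
  have "?I (\<lambda>l. D' l / pi) - ?I (\<lambda>l. C' l / pi) = 1 / pi * ?I (\<lambda>l. D' l - C' l)"
    using CDi by (simp add: integral_diff diff_divide_distrib)
  also have "?I (\<lambda>l. D' l - C' l) = integral \<Lambda> (\<lambda>l. D l - C l)"
  proof -
    have "?I (\<lambda>l. D' l - C' l) = ?I (\<lambda>l. if l \<in> \<Lambda> then D l - C l else 0)"
      by (rule arg_cong[where f = ?I]) (auto simp: C'_def D'_def)
    also have "\<dots> = integral (\<Lambda> \<inter> {\<alpha>..\<beta>}) (\<lambda>l. D l - C l)" by (rule integral_restrict_Int)
    also have "\<Lambda> \<inter> {\<alpha>..\<beta>} = \<Lambda>" using \<Lambda>(2) by auto
    finally show ?thesis .
  qed
  also have "integral \<Lambda> (\<lambda>l. D l - C l) = (LINT lam:\<Lambda>|lebesgue. D lam - C lam)"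
  proof (rule set_lebesgue_integral_eq_integral(2)[symmetric])
    have "(\<lambda>l. D' l - C' l) integrable_on {\<alpha>..\<beta>}" by (rule integrable_diff[OF CDi(2,1)])
    moreover have "(\<lambda>l. D' l - C' l) = (\<lambda>l. if l \<in> \<Lambda> then D l - C l else 0)" by (auto simp: C'_def D'_def)
    ultimately have "(\<lambda>l. D l - C l) integrable_on (\<Lambda> \<inter> {\<alpha>..\<beta>})" by (simp add: integrable_restrict_Int)
    moreover have "\<Lambda> \<inter> {\<alpha>..\<beta>} = \<Lambda>" using \<Lambda>(2) by auto
    ultimately show "set_integrable lebesgue \<Lambda> (\<lambda>l. D l - C l)"
      using CD by (intro nonnegative_absolutely_integrable_1) (auto simp: less_imp_le)
  qed
  finally have lim: "((\<lambda>x. ?I (ED x) - ?I (EC x)) \<longlongrightarrow> 1 / pi * (LINT lam:\<Lambda>|lebesgue. D lam - C lam)) at_top"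
    using tendsto_diff[OF limD limC] by simp
  have eq: "measure lebesgue (\<Lambda> \<inter> {lam. C lam < theta0_tilde q a x lam \<and> theta0_tilde q a x lam < D lam})
      = ?I (ED x) - ?I (EC x)" (is "measure lebesgue ?X = _") if x: "x \<ge> a + 1" for x
  proof -
    note [measurable] = phm[OF x]
    define Y where "Y = {lam \<in> {\<alpha>..\<beta>}. phi x lam < hD lam \<and> \<not> phi x lam \<le> hC lam}"
    let ?N = "{\<alpha>, \<beta>} \<union> {lam. v (of_real lam) x = 0}"
    have N: "negligible ?N" using v_zeros_negligible[OF x] by simp
    have iff: "(theta0_tilde q a x lam < D lam \<longleftrightarrow> phi x lam < hD lam) \<and>
       (theta0_tilde q a x lam \<le> C lam \<longleftrightarrow> phi x lam \<le> hC lam) \<and> lam \<in> \<Lambda>"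
      if "lam \<in> {\<alpha>..\<beta>}" "lam \<notin> ?N" for lam
    proof -
      have l: "\<alpha> < lam" "lam < \<beta>" "v (of_real lam) x \<noteq> 0" using that by auto
      have l\<Lambda>: "lam \<in> \<Lambda>" using \<Lambda>(1) l by auto
      have B: "m_B q a lam > 0" using bv[OF l(1,2)] by blast
      have xa: "a \<le> x" using x by simp
      show ?thesis
        using theta0_tilde_vs_phi(1)[OF B xa l(3), of "D lam"] theta0_tilde_vs_phi(2)[OF B xa l(3), of "C lam"]
          CD[OF l\<Lambda>] l l\<Lambda> by (simp add: hC_def hD_def M_def C'_def D'_def)
    qed
    have mem: "lam \<in> Y \<longleftrightarrow> lam \<in> ?X" if "lam \<notin> ?N" for lam
    proof (cases "lam \<in> {\<alpha>..\<beta>}")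
      case True
      note i = iff[OF True that]
      hence "C lam < theta0_tilde q a x lam \<longleftrightarrow> hC lam < phi x lam" by (metis not_le)
      thus ?thesis using i True by (auto simp: Y_def)
    next
      case False
      thus ?thesis using \<Lambda>(2) by (auto simp: Y_def)
    qed
    have Ym: "Y \<in> sets lebesgue"
    proof -
      have "Y = {\<alpha>..\<beta>} \<inter> {lam \<in> space lebesgue. phi x lam < hD lam} - {lam \<in> space lebesgue. phi x lam \<le> hC lam}"
        by (auto simp: Y_def)
      also have "\<dots> \<in> sets lebesgue"
        by (intro sets.Diff sets.Int borel_measurable_less borel_measurable_le phm[OF x] hm) simp
      finally show ?thesis .
    qed
    have Yl: "Y \<in> lmeasurable"
      by (rule bounded_set_imp_lmeasurable[OF _ Ym]) (rule bounded_subset[of "{\<alpha>..\<beta>}"], auto simp: Y_def)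
    have "measure lebesgue ?X = measure lebesgue Y"
    proof (rule measure_negligible_symdiff[OF Yl])
      show "negligible (Y - ?X \<union> (?X - Y))"
        by (rule negligible_subset[OF N]) (use mem in blast)
    qed
    also have "\<dots> = integral Y (\<lambda>_. 1)" by (rule lmeasure_integral[OF Yl])
    also have "\<dots> = integral (Y \<inter> {\<alpha>..\<beta>}) (\<lambda>_. 1)" by (rule arg_cong[where f = "\<lambda>S. integral S _"]) (auto simp: Y_def)
    also have "\<dots> = ?I (\<lambda>lam. if lam \<in> Y then 1 else 0)" by (rule integral_restrict_Int[symmetric])
    also have "\<dots> = ?I (\<lambda>lam. ED x lam - EC x lam)"
    proof (rule integral_spike[OF N])
      fix lam assume l: "lam \<in> {\<alpha>..\<beta>} - ?N"
      hence "phi x lam \<le> hC lam \<Longrightarrow> phi x lam < hD lam" using iff[of lam] CD[of lam] by auto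
      thus "ED x lam - EC x lam = (if lam \<in> Y then 1 else 0)" using l by (auto simp: ED_def EC_def Y_def)
    qed
    also have "\<dots> = ?I (ED x) - ?I (EC x)"
    proof (rule integral_diff)
      show "ED x integrable_on {\<alpha>..\<beta>}" "EC x integrable_on {\<alpha>..\<beta>}"
        using Em[OF x] by (auto intro!: bounded_measurable_integrable[of _ 1] simp: ED_def EC_def)
    qed
    finally show ?thesis .
  qed
  have "\<forall>\<^sub>F x in at_top. ?I (ED x) - ?I (EC x) =
      measure lebesgue (\<Lambda> \<inter> {lam. C lam < theta0_tilde q a x lam \<and> theta0_tilde q a x lam < D lam})"
    using eventually_ge_at_top[of "a+1"] by eventually_elim (simp add: eq)
  with lim show ?thesis by (rule Lim_transform_eventually)
qed

end

theorem theorem3: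
  fixes q :: "real \<Rightarrow> real" and a :: real
    and I \<Lambda> :: "real set" and C D :: "real \<Rightarrow> real"
  assumes "continuous_on {a..} q"
    and "limit_point_at_infinity q a"
    and "(\<forall>lam. oscillatory_at_infinity q a lam) \<or>
         (\<exists>\<Lambda>0. (\<forall>lam>\<Lambda>0. oscillatory_at_infinity q a lam) \<and>
                (\<forall>lam<\<Lambda>0. nonoscillatory_at_infinity q a lam))"
    and "is_interval I"
    and "\<forall>lam\<in>I. has_m_boundary_value q a lam \<and> m_B q a lam > 0"
    and "is_interval \<Lambda>" and "bounded \<Lambda>" and "\<Lambda> \<subseteq> I"
    and "C \<in> borel_measurable (lebesgue_on \<Lambda>)"
    and "D \<in> borel_measurable (lebesgue_on \<Lambda>)"
    and "\<forall>lam\<in>\<Lambda>. 0 \<le> C lam \<and> C lam < D lam \<and> D lam \<le> pi"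
  shows "((\<lambda>x. measure lebesgue
             (\<Lambda> \<inter> {lam. C lam < theta0_tilde q a x lam \<and> theta0_tilde q a x lam < D lam}))
          \<longlongrightarrow> 1 / pi * (LINT lam:\<Lambda>|lebesgue. D lam - C lam)) at_top"
proof (cases "\<Lambda> = {}")
  case True
  thus ?thesis by (simp add: set_lebesgue_integral_def)
next
  case False
  interpret sturm_liouville q a by unfold_locales (rule assms(1))
  have bd: "bdd_below \<Lambda>" "bdd_above \<Lambda>"
    using assms(7) by (auto intro: bounded_imp_bdd_below bounded_imp_bdd_above)
  have sub: "\<Lambda> \<subseteq> {Inf \<Lambda>..Sup \<Lambda>}" using bd by (auto intro: cInf_lower cSup_upper)
  have sup: "{Inf \<Lambda><..<Sup \<Lambda>} \<subseteq> \<Lambda>"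
  proof
    fix l assume "l \<in> {Inf \<Lambda><..<Sup \<Lambda>}"
    then obtain s t where "s \<in> \<Lambda>" "s < l" "t \<in> \<Lambda>" "l < t"
      using cInf_less_iff[OF False bd(1)] less_cSup_iff[OF False bd(2)] by auto
    thus "l \<in> \<Lambda>" using assms(6) unfolding is_interval_1 by (meson less_imp_le)
  qed
  show ?thesis
  proof (rule theta0_tilde_equidistribution[OF assms(2) _ _ sup sub assms(9,10)])
    show "has_m_boundary_value q a lam \<and> m_B q a lam > 0" if "Inf \<Lambda> < lam" "lam < Sup \<Lambda>" for lam
    proof -
      have "lam \<in> \<Lambda>" using that sup by auto
      thus ?thesis using assms(5,8) by blast
    qed
    show "Inf \<Lambda> \<le> Sup \<Lambda>" by (rule cInf_le_cSup[OF False bd(2,1)])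
    show "0 \<le> C lam \<and> C lam < D lam \<and> D lam \<le> pi" if "lam \<in> \<Lambda>" for lam using assms(11) that by blast
  qed
qed

end
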